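(* Let $X$ be a Banach space with norm $\|\cdot\|$, let $T>0$, let $\mathcal{B}$ be a bounded linear operator on $X$, and let $\mathcal{A}$, $\mathcal{C}$ and $\mathcal{A}+\mathcal{C}$ be linear operators generating strongly continuous semigroups $\mathrm{e}^{t\mathcal{A}}$, $\mathrm{e}^{t\mathcal{C}}$ and $\mathrm{e}^{t(\mathcal{A}+\mathcal{C})}$ on $X$. Let $u(t)=\mathrm{e}^{t(\mathcal{A}+\mathcal{B}+\mathcal{C})}u_0$ be the exact solution of $\partial_t u=(\mathcal{A}+\mathcal{B}+\mathcal{C})u$, $0\le t\le T$, $u(0)=u_0$. Assume that there are constants $c_1,\dots,c_5$ such that for all $t,s,\sigma\in[0,T]$ $$\|[\mathcal{A},\mathcal{C}]\,\mathrm{e}^{s\mathcal{A}}u(t)\|\le c_1,\qquad \|\mathcal{C}\,\mathrm{e}^{s\mathcal{A}}\mathcal{B}u(t)\|\le c_2,\qquad \|\mathcal{C}^2\mathrm{e}^{s\mathcal{A}}u(t)\|\le c_3,$$ $$\|\mathcal{C}\,\mathrm{e}^{\sigma\mathcal{A}}\mathcal{C}\,\mathrm{e}^{s(\mathcal{A}+\mathcal{C})}u(t)\|\le c_4,\qquad \|[\mathcal{A}+\mathcal{C},\mathcal{B}]\,\mathrm{e}^{s(\mathcal{A}+\mathcal{C})}u(t)\|\le c_5 .$$ Let $\|\cdot\|_*$ be an equivalent norm on $X$ for which there is a constant $\omega_{\mathcal{A}}$ with $\|\mathrm{e}^{t\mathcal{A}}\|_*\le \mathrm{e}^{t\omega_{\mathcal{A}}}$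 for all $t\ge0$, and assume that there is a constant $\omega_{\mathcal{C}}$ such that $\|\mathrm{e}^{t\mathcal{C}}\|_*\le \mathrm{e}^{t\omega_{\mathcal{C}}}$ for all $t\ge 0$. For a step size $\tau>0$ define the Lie splitting approximations by $u_{n+1}=\mathrm{e}^{\tau\mathcal{C}}\mathrm{e}^{\tau\mathcal{A}}\mathrm{e}^{\tau\mathcal{B}}u_n$, $n\ge0$, starting from the initial value $u_0=u(0)$, and set $t_n=n\tau$. Then Lie splitting is convergent of order 1: there exists a constant $C$, independent of $n$ and $\tau$, such that $$\|u_n-u(t_n)\|\le C\tau$$ for all $n\in\mathbb{N}$ and $\tau>0$ satisfying $0\le n\tau=t_n\le T$.
   Context: $[\mathcal{E},\mathcal{F}]=\mathcal{E}\mathcal{F}-\mathcal{F}\mathcal{E}$ denotes the commutator. $\mathrm{e}^{\tau\mathcal{L}}w$ denotes the exact solution at time $\tau$ of the abstract linear differential equation $\partial_t v=\mathcal{L}v$ with initial value $v(0)=w$. Operators $\mathcal{A}$ and $\mathcal{C}$ may be unbounded; the sum $\mathcal{A}+\mathcal{C}$ is the operator sum on its natural domain $D(\mathcal{A})\cap D(\mathcal{C})$, and since $\mathcal{B}$ is bounded, $\mathcal{A}+\mathcal{B}+\mathcal{C}$ also generates a strongly continuous semigroup. Each assumed bound implicitly includes the requirement that the vectors involved lie in the domains of the operators applied to them (e.g. $\mathrm{e}^{s\mathcal{A}}u(t)$ lies in the domains of $\mathcal{A}\mathcal{C}$ and $\mathcal{C}\mathcal{A}$ in the first bound). An operator norm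 $\|\cdot\|_*$ is the one induced by the equivalent norm $\|\cdot\|_*$ on $X$. *)

theory Defs
  imports "HOL-Analysis.Analysis"
begin

text \<open>A possibly unbounded operator is a partial map \<open>L :: 'a \<rightharpoonup> 'a\<close> with domain \<open>dom L\<close>.
  Composition \<open>\<circ>\<^sub>m\<close>, sum and difference below carry the natural (maximal) domains;
  for instance \<open>x \<in> dom (K \<circ>\<^sub>m L)\<close> iff \<open>x \<in> dom L\<close> and \<open>the (L x) \<in> dom K\<close>.\<close>

definition op_add :: "('a::real_vector \<rightharpoonup> 'a) \<Rightarrow> ('a \<rightharpoonup> 'a) \<Rightarrow> ('a \<rightharpoonup> 'a)"  (infixl "+\<^sub>m" 52)
  where "K +\<^sub>m L = (\<lambda>x. if x \<in> dom K \<inter> dom L then Some (the (K x) + the (L x)) else None)"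

definition op_diff :: "('a::real_vector \<rightharpoonup> 'a) \<Rightarrow> ('a \<rightharpoonup> 'a) \<Rightarrow> ('a \<rightharpoonup> 'a)"  (infixl "-\<^sub>m" 52)
  where "K -\<^sub>m L = (\<lambda>x. if x \<in> dom K \<inter> dom L then Some (the (K x) - the (L x)) else None)"

definition commutator :: "('a::real_vector \<rightharpoonup> 'a) \<Rightarrow> ('a \<rightharpoonup> 'a) \<Rightarrow> ('a \<rightharpoonup> 'a)"
  where "commutator K L = (K \<circ>\<^sub>m L) -\<^sub>m (L \<circ>\<^sub>m K)"

definition bop :: "('a::real_normed_vector \<Rightarrow>\<^sub>L 'a) \<Rightarrow> ('a \<rightharpoonup> 'a)"
  where "bop E = (\<lambda>x. Some (blinfun_apply E x))"

text \<open>\<open>\<parallel>L x\<parallel> \<le> c\<close>, including the requirement that \<open>x\<close> lies in the domain of \<open>L\<close>.\<close>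

definition bounded_at :: "('a::real_normed_vector \<rightharpoonup> 'a) \<Rightarrow> 'a \<Rightarrow> real \<Rightarrow> bool"
  where "bounded_at L x c \<longleftrightarrow> x \<in> dom L \<and> norm (the (L x)) \<le> c"

text \<open>Only the values \<open>S t\<close> for \<open>t \<ge> 0\<close> are meaningful.\<close>

definition C0_semigroup :: "(real \<Rightarrow> ('a::real_normed_vector \<Rightarrow>\<^sub>L 'a)) \<Rightarrow> bool"
  where "C0_semigroup S \<longleftrightarrow>
    S 0 = id_blinfun \<and>
    (\<forall>s\<ge>0. \<forall>t\<ge>0. S (s + t) = S s o\<^sub>L S t) \<and>
    (\<forall>x. continuous_on {0..} (\<lambda>t. blinfun_apply (S t) x))"

definition generator :: "(real \<Rightarrow> ('a::real_normed_vector \<Rightarrow>\<^sub>L 'a)) \<Rightarrow> ('a \<rightharpoonup> 'a)"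
  where "generator S = (\<lambda>x.
    if \<exists>y. ((\<lambda>h. (blinfun_apply (S h) x - x) /\<^sub>R h) \<longlongrightarrow> y) (at_right 0)
    then Some (Lim (at_right 0) (\<lambda>h. (blinfun_apply (S h) x - x) /\<^sub>R h))
    else None)"

text \<open>Linearity is automatic: see \<open>generator_linear\<close> below.\<close>

definition generates_semigroup :: "('a::real_normed_vector \<rightharpoonup> 'a) \<Rightarrow> bool"
  where "generates_semigroup L \<longleftrightarrow> (\<exists>S. C0_semigroup S \<and> generator S = L)"

text \<open>\<open>exp_op L t\<close> is the operator \<open>e\<^sup>t\<^sup>L\<close> (meaningful for \<open>t \<ge> 0\<close>): the value at time \<open>t\<close> of the
  semigroup generated by \<open>L\<close>. A generator determines its semigroup on \<open>t \<ge> 0\<close>; the description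
  is of \<open>S t\<close> rather than of \<open>S\<close>, since \<open>S\<close> is unconstrained for negative times.\<close>

definition exp_op :: "('a::real_normed_vector \<rightharpoonup> 'a) \<Rightarrow> real \<Rightarrow> ('a \<Rightarrow>\<^sub>L 'a)"
  where "exp_op L t = (THE E. \<exists>S. C0_semigroup S \<and> generator S = L \<and> E = S t)"

definition equivalent_norm :: "('a::real_normed_vector \<Rightarrow> real) \<Rightarrow> bool"
  where "equivalent_norm N \<longleftrightarrow>
    (\<forall>x. N x = 0 \<longleftrightarrow> x = 0) \<and>
    (\<forall>x y. N (x + y) \<le> N x + N y) \<and>
    (\<forall>r x. N (r *\<^sub>R x) = \<bar>r\<bar> * N x) \<and>
    (\<exists>a>0. \<exists>b>0. \<forall>x. a * norm x \<le> N x \<and> N x \<le> b * norm x)"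

text \<open>The analogue of \<^const>\<open>onorm\<close> for a norm \<open>N\<close> other than that of the type class.\<close>

definition induced_norm :: "('a::real_normed_vector \<Rightarrow> real) \<Rightarrow> ('a \<Rightarrow>\<^sub>L 'a) \<Rightarrow> real"
  where "induced_norm N E = (SUP x. N (blinfun_apply E x) / N x)"

primrec lie_splitting ::
  "('a::real_normed_vector \<rightharpoonup> 'a) \<Rightarrow> ('a \<Rightarrow>\<^sub>L 'a) \<Rightarrow> ('a \<rightharpoonup> 'a) \<Rightarrow> real \<Rightarrow> 'a \<Rightarrow> nat \<Rightarrow> 'a"
  where
    "lie_splitting A B C \<tau> u0 0 = u0"
  | "lie_splitting A B C \<tau> u0 (Suc n) =
      exp_op C \<tau> (exp_op A \<tau> (exp_op (bop B) \<tau> (lie_splitting A B C \<tau> u0 n)))"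

lemma generator_eq_Some_iff:
  "generator S x = Some y \<longleftrightarrow>
    ((\<lambda>h. (blinfun_apply (S h) x - x) /\<^sub>R h) \<longlongrightarrow> y) (at_right 0)"
  by (auto simp: generator_def intro: tendsto_Lim[OF trivial_limit_at_right_real]
      dest: tendsto_Lim[OF trivial_limit_at_right_real])

lemma generator_linear:
  assumes "generator S x = Some x'" "generator S y = Some y'"
  shows "generator S (a *\<^sub>R x + b *\<^sub>R y) = Some (a *\<^sub>R x' + b *\<^sub>R y')"
proof -
  have "((\<lambda>h. a *\<^sub>R ((S h x - x) /\<^sub>R h) + b *\<^sub>R ((S h y - y) /\<^sub>R h)) \<longlongrightarrow> a *\<^sub>R x' + b *\<^sub>R y') (at_right 0)"
    using assms unfolding generator_eq_Some_iff by (intro tendsto_intros)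
  then show ?thesis
    unfolding generator_eq_Some_iff
    by (simp add: blinfun.add_right blinfun.scaleR_right algebra_simps)
qed

end

theory Submission
  imports Defs
begin

text \<open>Write \<open>D = A + C\<close>, let \<open>V\<close> be the semigroup generated by \<open>D + B\<close>, and let \<open>w = u t\<close> be a point of the exact
solution. Since \<open>e\<^sup>\<tau>\<^sup>A\<close> and \<open>e\<^sup>\<tau>\<^sup>C\<close> are quasi-contractions for the same norm \<open>N\<close> and \<open>e\<^sup>\<tau>\<^sup>B\<close> is one for every norm
equivalent to the given one, powers of the splitting step stay bounded on \<open>[0, T]\<close>. So it is enough that
one step, started on the exact solution, has an error of order \<open>\<tau>\<^sup>2\<close> (\<open>local_error\<close>); errors then
accumulate \<open>n\<close> times at most (\<open>error_recursion\<close>).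

For the local error put \<open>z = C e\<^sup>\<tau>\<^sup>A w\<close> and compare both sides up to \<open>O(\<tau>\<^sup>2)\<close>:
\<^item> \<open>e\<^sup>\<tau>\<^sup>C e\<^sup>\<tau>\<^sup>A w = e\<^sup>\<tau>\<^sup>A w + \<tau> z\<close>, as \<open>C\<^sup>2 e\<^sup>\<tau>\<^sup>A w\<close> is bounded (\<open>taylor_C\<close>);
\<^item> \<open>e\<^sup>\<tau>\<^sup>D w = e\<^sup>\<tau>\<^sup>A w + \<tau> z\<close>, as the derivative of \<open>s \<mapsto> e\<^bsup>(\<tau>-s)A\<^esup> e\<^sup>s\<^sup>D w\<close> is \<open>e\<^bsup>(\<tau>-s)A\<^esup> C e\<^sup>s\<^sup>D w\<close>, which differs
  from \<open>z\<close> by \<open>O(\<tau>)\<close> (\<open>taylor_AC\<close>);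
\<^item> \<open>V \<tau> w = e\<^sup>\<tau>\<^sup>D w + \<tau> e\<^sup>\<tau>\<^sup>C e\<^sup>\<tau>\<^sup>A B w\<close>, by the same method and the bounds with \<open>B\<close> (\<open>taylor_B\<close>);
\<^item> \<open>e\<^sup>\<tau>\<^sup>B w = w + \<tau> B w\<close>, as \<open>B\<close> is bounded (\<open>taylor_exp_B\<close>).

All these expansions come from the mean value inequality for curves such as \<open>s \<mapsto> S (\<tau> - s) (R s x)\<close>
(\<open>duhamel_derivative\<close>), which asks only for a pointwise bound of the derivative. Unbounded operators
are handled through the bounded quotients \<open>(S d - 1) / d\<close>, which on the domain of the generator
coincide with the generator followed by an average of the semigroup.

The delicate point is that \<open>e\<^bsup>(\<tau>-s)A\<^esup> C e\<^sup>s\<^sup>A w\<close> differs from \<open>z\<close> by \<open>O(\<tau>)\<close>. Formally its derivative in \<open>s\<close> is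
\<open>- e\<^bsup>(\<tau>-s)A\<^esup> [A, C] e\<^sup>s\<^sup>A w\<close>, which is bounded. But \<open>s \<mapsto> C e\<^sup>s\<^sup>A w\<close> is not known to be differentiable: the two
halves \<open>A C e\<^sup>s\<^sup>A w\<close> and \<open>C A e\<^sup>s\<^sup>A w\<close> of the commutator exist for every \<open>s\<close>, yet nothing bounds them, or even makes
them integrable, in \<open>s\<close>. In general, pointwise convergence of derivatives to a bounded limit does not
control increments (the Cantor function is a limit of functions whose derivatives tend to zero
at every point), so an argument special to this situation is needed. Consider the closed set of
those \<open>s\<close> near which the estimate fails. By Baire's theorem
\<open>A C e\<^sup>s\<^sup>A w\<close> is bounded on some relatively open part of it, if it is nonempty. On the gaps of that part the
estimate holds, and since the bound of \<open>A C e\<^sup>s\<^sup>A w\<close> is available at the left end of each gap, the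
increments of \<open>C e\<^sup>s\<^sup>A w\<close> over the gaps are dominated by their lengths. This is enough for
dominated convergence, on the set itself and over its gaps at once, and the estimate
extends across the set: a contradiction (\<open>small_defect_across_closed_set\<close>, \<open>defect_small\<close>).\<close>

section \<open>Category and calculus in Banach spaces\<close>

text \<open>Baire's theorem in the form in which it serves twice: for the uniform boundedness principle, and to
locate times at which an unbounded operator is uniformly bounded along an orbit.\<close>

lemma closed_cover_has_interior:
  fixes G :: "nat \<Rightarrow> 'a set"
  assumes "completely_metrizable_space X" and "topspace X \<noteq> {}"
    and closed: "\<And>n. closedin X (G n)" and cover: "topspace X \<subseteq> (\<Union>n. G n)"
  obtains n U where "openin X U" "U \<noteq> {}" "U \<subseteq> G n"
proof -
  have "\<exists>n. X interior_of G n \<noteq> {}"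
  proof (rule ccontr)
    assume "\<not> ?thesis"
    then have "X interior_of \<Union>(range G) = {}"
      using assms by (intro Baire_category_alt) auto
    moreover have "\<Union>(range G) = topspace X"
      using cover closed closedin_subset by fastforce
    ultimately show False using assms(2) by simp
  qed
  then show ?thesis
    using that by (metis interior_of_subset openin_interior_of)
qed

text \<open>The sets \<open>G n\<close> on which all operators are bounded by \<open>n\<close> are closed and cover the space, so one of them
contains a ball; differences of its points scale to all vectors.\<close>

theorem uniform_boundedness:
  fixes F :: "'i \<Rightarrow> 'a::banach \<Rightarrow>\<^sub>L 'b::real_normed_vector"
  assumes pointwise: "\<And>x. \<exists>b. \<forall>i\<in>I. norm (F i x) \<le> b"
  shows "\<exists>b>0. \<forall>i\<in>I. norm (F i) \<le> b"
proof -
  define G where "G n = {x. \<forall>i\<in>I. norm (F i x) \<le> real n}" for n :: nat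
  have "G n = (\<Inter>i\<in>I. {x. norm (F i x) \<le> real n})" for n
    by (auto simp: G_def)
  then have cl: "closed (G n)" for n
    by (auto intro!: closed_Collect_le continuous_intros)
  have cov: "UNIV \<subseteq> (\<Union>n. G n)"
  proof
    fix x
    obtain b where "\<forall>i\<in>I. norm (F i x) \<le> b" using pointwise by blast
    moreover obtain n where "b \<le> real n" using real_arch_simple by blast
    ultimately show "x \<in> (\<Union>n. G n)" by (auto simp: G_def intro: order_trans)
  qed
  obtain n U where U: "open U" "U \<noteq> {}" "U \<subseteq> G n"
    using closed_cover_has_interior[of euclidean G] cl cov
    by (metis closed_closedin completely_metrizable_space_euclidean empty_not_UNIV open_openin
        topspace_euclidean)
  then obtain x0 e where e: "e > 0" "ball x0 e \<subseteq> G n"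
    by (meson equals0I openE subset_trans)
  have "norm (F i) \<le> 4 * real n / e + 1" if i: "i \<in> I" for i
  proof (rule norm_blinfun_bound)
    show "0 \<le> 4 * real n / e + 1" using e by simp
    fix x
    show "norm (F i x) \<le> (4 * real n / e + 1) * norm x"
    proof (cases "x = 0")
      case False
      define y where "y = (e / 2 / norm x) *\<^sub>R x"
      have "norm y = e / 2" using False e by (simp add: y_def)
      then have "x0 + y \<in> G n" "x0 \<in> G n" using e by (auto simp: dist_norm subset_iff)
      then have "norm (F i (x0 + y)) \<le> n" "norm (F i x0) \<le> n" using i by (auto simp: G_def)
      moreover have "F i y = F i (x0 + y) - F i x0" by (simp add: blinfun.add_right)
      ultimately have "norm (F i y) \<le> 2 * real n"
        using norm_triangle_ineq4[of "F i (x0 + y)" "F i x0"] by simp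
      then have "e / 2 / norm x * norm (F i x) \<le> 2 * real n"
        using e by (simp add: y_def blinfun.scaleR_right)
      then have "norm (F i x) \<le> 4 * real n / e * norm x"
        using e False by (simp add: field_simps)
      then show ?thesis
        by (simp add: distrib_right add_increasing2)
    qed simp
  qed
  then show ?thesis
    using e by (intro exI[of _ "4 * real n / e + 1"]) (auto intro!: add_nonneg_pos)
qed

lemma has_vector_derivative_iff_quotient:
  fixes f :: "real \<Rightarrow> 'a::real_normed_vector"
  shows "(f has_vector_derivative D) (at x within X) \<longleftrightarrow>
    ((\<lambda>y. (f y - f x) /\<^sub>R (y - x)) \<longlongrightarrow> D) (at x within X)"
proof -
  have "((\<lambda>y. (f y - f x) /\<^sub>R (y - x)) \<longlongrightarrow> D) (at x within X) \<longleftrightarrow>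
    ((\<lambda>y. norm ((f y - f x) /\<^sub>R (y - x) - D)) \<longlongrightarrow> 0) (at x within X)"
    by (simp add: tendsto_norm_zero_iff LIM_zero_iff)
  also have "\<dots> \<longleftrightarrow>
    ((\<lambda>y. norm (f y - f x - (y - x) *\<^sub>R D) / norm (y - x)) \<longlongrightarrow> 0) (at x within X)"
  proof (rule tendsto_cong, rule eventually_at_filter[THEN iffD2], rule always_eventually, safe)
    fix y assume "y \<noteq> x"
    then have "(f y - f x) /\<^sub>R (y - x) - D = (f y - f x - (y - x) *\<^sub>R D) /\<^sub>R (y - x)"
      by (simp add: scaleR_diff_right)
    then show "norm ((f y - f x) /\<^sub>R (y - x) - D) = norm (f y - f x - (y - x) *\<^sub>R D) / norm (y - x)"
      by (simp add: divide_inverse mult.commute)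
  qed
  also have "\<dots> \<longleftrightarrow> (f has_vector_derivative D) (at x within X)"
    unfolding has_vector_derivative_def has_derivative_iff_norm
    by (simp add: bounded_linear_scaleR_left)
  finally show ?thesis by simp
qed

text \<open>Every first-order expansion below is an instance. The derivative is compared with a constant
vector instead of being integrated, so it may be an arbitrary bounded function.\<close>

lemma mean_value_affine:
  fixes f :: "real \<Rightarrow> 'a::real_normed_vector"
  assumes "a \<le> b"
    and deriv: "\<And>s. s \<in> {a..b} \<Longrightarrow> (f has_vector_derivative f' s) (at s within {a..b})"
    and bound: "\<And>s. s \<in> {a..b} \<Longrightarrow> norm (f' s - k) \<le> c"
  shows "norm (f b - f a - (b - a) *\<^sub>R k) \<le> c * (b - a)"
proof -
  have "norm ((f b - b *\<^sub>R k) - (f a - a *\<^sub>R k)) \<le> c * norm (b - a)"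
  proof (rule differentiable_bound[of "{a..b}" "\<lambda>s. f s - s *\<^sub>R k" "\<lambda>s h. h *\<^sub>R (f' s - k)"])
    fix s assume s: "s \<in> {a..b}"
    have "((\<lambda>s. f s - s *\<^sub>R k) has_vector_derivative f' s - 1 *\<^sub>R k) (at s within {a..b})"
      by (intro has_vector_derivative_diff deriv s) (auto intro!: derivative_eq_intros)
    then show "((\<lambda>s. f s - s *\<^sub>R k) has_derivative (\<lambda>h. h *\<^sub>R (f' s - k))) (at s within {a..b})"
      by (simp add: has_vector_derivative_def)
    show "onorm (\<lambda>h. h *\<^sub>R (f' s - k)) \<le> c"
      using bound[OF s] by (intro onorm_le) (metis abs_ge_zero mult.commute mult_right_mono norm_scaleR real_norm_def)
  qed (use assms in auto)
  moreover have "f b - f a - (b - a) *\<^sub>R k = (f b - b *\<^sub>R k) - (f a - a *\<^sub>R k)"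
    by (simp add: scaleR_left_diff_distrib)
  ultimately show ?thesis using \<open>a \<le> b\<close> by (metis abs_of_nonneg diff_ge_0_iff_ge real_norm_def)
qed

text \<open>Semigroups are continuous only in the strong topology; a bound on the operator norms makes up for
the missing norm convergence when the argument moves too.\<close>

lemma tendsto_blinfun_apply_strong:
  fixes L :: "'i \<Rightarrow> 'a::real_normed_vector \<Rightarrow>\<^sub>L 'b::real_normed_vector"
  assumes bound: "eventually (\<lambda>i. norm (L i) \<le> M) F"
    and g: "(g \<longlongrightarrow> x) F" and L: "((\<lambda>i. L i x) \<longlongrightarrow> y) F"
  shows "((\<lambda>i. L i (g i)) \<longlongrightarrow> y) F"
proof -
  have "((\<lambda>i. L i (g i - x)) \<longlongrightarrow> 0) F"
  proof (rule Lim_null_comparison)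
    show "eventually (\<lambda>i. norm (L i (g i - x)) \<le> M * norm (g i - x)) F"
      using bound by eventually_elim (meson mult_right_mono norm_blinfun norm_ge_zero order_trans)
    show "((\<lambda>i. M * norm (g i - x)) \<longlongrightarrow> 0) F"
      using g by (simp add: LIM_zero tendsto_mult_right_zero tendsto_norm_zero)
  qed
  from tendsto_add[OF this L] show ?thesis
    by (simp add: blinfun.diff_right)
qed

text \<open>The product rule for an operator family that is differentiable only at the single vector \<open>g s\<close>, from
\<open>L r (g r) - L s (g s) = (L r (g s) - L s (g s)) + L r (g r - g s)\<close>.\<close>

lemma has_vector_derivative_blinfun_apply_strong:
  fixes L :: "real \<Rightarrow> 'a::real_normed_vector \<Rightarrow>\<^sub>L 'b::real_normed_vector"
  assumes L: "((\<lambda>r. L r (g s)) has_vector_derivative d) (at s within X)"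
    and g: "(g has_vector_derivative g') (at s within X)"
    and bound: "\<And>r. r \<in> X \<Longrightarrow> norm (L r) \<le> M"
    and cont: "((\<lambda>r. L r g') \<longlongrightarrow> L s g') (at s within X)"
  shows "((\<lambda>r. L r (g r)) has_vector_derivative d + L s g') (at s within X)"
proof -
  have b: "eventually (\<lambda>r. norm (L r) \<le> M) (at s within X)"
    using bound by (auto simp: eventually_at_filter)
  have "((\<lambda>r. L r ((g r - g s) /\<^sub>R (r - s))) \<longlongrightarrow> L s g') (at s within X)"
    using tendsto_blinfun_apply_strong[OF b] g cont
    unfolding has_vector_derivative_iff_quotient by blast
  from tendsto_add[OF L[unfolded has_vector_derivative_iff_quotient] this]
  show ?thesis
    unfolding has_vector_derivative_iff_quotient
    by (simp add: blinfun.scaleR_right blinfun.diff_right scaleR_diff_right)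
qed

section \<open>Strongly continuous semigroups\<close>

lemma C0_semigroup_0: "C0_semigroup S \<Longrightarrow> S 0 = id_blinfun"
  unfolding C0_semigroup_def by blast

lemma C0_semigroup_add:
  "C0_semigroup S \<Longrightarrow> s \<ge> 0 \<Longrightarrow> t \<ge> 0 \<Longrightarrow> S (s + t) x = S s (S t x)"
  unfolding C0_semigroup_def by (metis blinfun_apply_blinfun_compose)

lemma C0_semigroup_orbit_continuous: 
  "C0_semigroup S \<Longrightarrow> X \<subseteq> {0..} \<Longrightarrow> continuous_on X (\<lambda>t. S t x)"
  unfolding C0_semigroup_def using continuous_on_subset by blast

lemma C0_semigroup_commute:
  "C0_semigroup S \<Longrightarrow> s \<ge> 0 \<Longrightarrow> t \<ge> 0 \<Longrightarrow> S s (S t x) = S t (S s x)"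
  using C0_semigroup_add[of S s t x] C0_semigroup_add[of S t s x] by (simp add: add.commute)

lemma C0_semigroup_locally_bounded:
  fixes S :: "real \<Rightarrow> 'a::banach \<Rightarrow>\<^sub>L 'a"
  assumes "C0_semigroup S"
  shows "\<exists>M>0. \<forall>t\<in>{0..T}. norm (S t) \<le> M"
proof (rule uniform_boundedness)
  fix x
  have "compact ((\<lambda>t. S t x) ` {0..T})"
    by (intro compact_continuous_image C0_semigroup_orbit_continuous[OF assms]) auto
  then show "\<exists>b. \<forall>t\<in>{0..T}. norm (S t x) \<le> b"
    using compact_imp_bounded by (force simp: bounded_iff)
qed

lemma C0_semigroup_tendsto:
  fixes S :: "real \<Rightarrow> 'a::banach \<Rightarrow>\<^sub>L 'a"
  assumes S: "C0_semigroup S" and f: "(f \<longlongrightarrow> t) F" and g: "(g \<longlongrightarrow> x) F"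
    and nonneg: "eventually (\<lambda>i. f i \<ge> 0) F" "t \<ge> 0"
  shows "((\<lambda>i. S (f i) (g i)) \<longlongrightarrow> S t x) F"
proof -
  obtain M where M: "\<forall>s\<in>{0..t + 1}. norm (S s) \<le> M"
    using C0_semigroup_locally_bounded[OF S] by blast
  show ?thesis
  proof (rule tendsto_blinfun_apply_strong[OF _ g])
    have "eventually (\<lambda>i. f i < t + 1) F"
      using f by (simp add: order_tendsto_iff)
    with nonneg(1) show "eventually (\<lambda>i. norm (S (f i)) \<le> M) F"
      by (rule eventually_elim2) (use M in auto)
    have "continuous (at t within {0..}) (\<lambda>s. S s x)"
      using C0_semigroup_orbit_continuous[OF S order_refl] nonneg by (auto simp: continuous_on_eq_continuous_within)
    then show "((\<lambda>i. S (f i) x) \<longlongrightarrow> S t x) F"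
      using f nonneg(1) by (intro continuous_within_tendsto_compose[where f="\<lambda>s. S s x" and S="{0..}"]) auto
  qed
qed

lemma C0_semigroup_continuous_on:
  fixes S :: "real \<Rightarrow> 'a::banach \<Rightarrow>\<^sub>L 'a"
  assumes "C0_semigroup S" "continuous_on X f" "continuous_on X g" "\<And>x. x \<in> X \<Longrightarrow> f x \<ge> 0"
  shows "continuous_on X (\<lambda>x. S (f x) (g x))"
  unfolding continuous_on_def
proof
  fix x assume "x \<in> X"
  then show "((\<lambda>x. S (f x) (g x)) \<longlongrightarrow> S (f x) (g x)) (at x within X)"
    using assms(2-4) unfolding continuous_on_def
    by (intro C0_semigroup_tendsto[OF assms(1)]) (auto simp: eventually_at_filter)
qed

lemma generator_orbit:
  fixes S :: "real \<Rightarrow> 'a::banach \<Rightarrow>\<^sub>L 'a"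
  assumes S: "C0_semigroup S" and x: "generator S x = Some y" and "t \<ge> 0"
  shows "generator S (S t x) = Some (S t y)"
proof -
  have "((\<lambda>h. S t ((S h x - x) /\<^sub>R h)) \<longlongrightarrow> S t y) (at_right 0)"
    using x unfolding generator_eq_Some_iff by (intro tendsto_intros)
  moreover have "eventually (\<lambda>h. S t ((S h x - x) /\<^sub>R h) = (S h (S t x) - S t x) /\<^sub>R h) (at_right 0)"
    using C0_semigroup_commute[OF S _ \<open>t \<ge> 0\<close>, of _ x]
    by (auto simp: eventually_at_filter blinfun.scaleR_right blinfun.diff_right)
  ultimately show ?thesis
    unfolding generator_eq_Some_iff using tendsto_cong by force
qed

text \<open>On either side of \<open>t\<close>, the difference quotient between \<open>r\<close> and \<open>t\<close> is \<open>S (min r t)\<close> applied to the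
quotient of length \<open>\<bar>r - t\<bar>\<close> at time zero, so the one-sided limit that defines the generator suffices.\<close>

lemma orbit_derivative:
  fixes S :: "real \<Rightarrow> 'a::banach \<Rightarrow>\<^sub>L 'a"
  assumes S: "C0_semigroup S" and x: "generator S x = Some y" and "t \<ge> 0" and "X \<subseteq> {0..}"
  shows "((\<lambda>t. S t x) has_vector_derivative S t y) (at t within X)"
proof (rule has_vector_derivative_within_subset[OF _ \<open>X \<subseteq> {0..}\<close>])
  have "filterlim (\<lambda>r. \<bar>r - t\<bar>) (at_right 0) (at t within {0..})"
    unfolding filterlim_at
    by (auto simp: eventually_at_filter intro!: tendsto_eq_intros)
  with x have Q: "((\<lambda>r. (S \<bar>r - t\<bar> x - x) /\<^sub>R \<bar>r - t\<bar>) \<longlongrightarrow> y) (at t within {0..})"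
    unfolding generator_eq_Some_iff by (rule filterlim_compose)
  have "((\<lambda>r. S (min r t) ((S \<bar>r - t\<bar> x - x) /\<^sub>R \<bar>r - t\<bar>)) \<longlongrightarrow> S (min t t) y) (at t within {0..})"
    using \<open>t \<ge> 0\<close>
    by (intro C0_semigroup_tendsto[OF S _ Q] tendsto_intros) (auto simp: eventually_at_filter)
  moreover have "eventually (\<lambda>r. S (min r t) ((S \<bar>r - t\<bar> x - x) /\<^sub>R \<bar>r - t\<bar>) = (S r x - S t x) /\<^sub>R (r - t))
    (at t within {0..})"
    unfolding eventually_at_filter
  proof (rule always_eventually, safe)
    fix r assume r: "r \<noteq> t" "(0::real) \<le> r"
    show "S (min r t) ((S \<bar>r - t\<bar> x - x) /\<^sub>R \<bar>r - t\<bar>) = (S r x - S t x) /\<^sub>R (r - t)"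
    proof (cases "r < t")
      case True
      then have "S r (S (t - r) x) = S t x"
        using C0_semigroup_add[OF S, of r "t - r" x] r by simp
      moreover have "inverse (t - r) = - inverse (r - t)"
        by (metis inverse_minus_eq minus_diff_eq)
      ultimately show ?thesis
        using True by (simp add: blinfun.scaleR_right blinfun.diff_right algebra_simps)
    next
      case False
      then have "S t (S (r - t) x) = S r x"
        using C0_semigroup_add[OF S, of t "r - t" x] \<open>t \<ge> 0\<close> by simp
      then show ?thesis
        using False r by (simp add: blinfun.scaleR_right blinfun.diff_right)
    qed
  qed
  ultimately show "((\<lambda>t. S t x) has_vector_derivative S t y) (at t within {0..})"
    unfolding has_vector_derivative_iff_quotient using tendsto_cong by fastforce
qed

lemma reversed_orbit_derivative:
  fixes S :: "real \<Rightarrow> 'a::banach \<Rightarrow>\<^sub>L 'a"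
  assumes S: "C0_semigroup S" and x: "generator S x = Some y" and "r \<le> b"
  shows "((\<lambda>r. S (b - r) x) has_vector_derivative - S (b - r) y) (at r within {a..b})"
proof -
  have "((\<lambda>r. b - r) has_vector_derivative -1) (at r within {a..b})"
    by (auto intro!: derivative_eq_intros)
  moreover have "((\<lambda>t. S t x) has_vector_derivative S (b - r) y) (at (b - r) within (\<lambda>r. b - r) ` {a..b})"
    using \<open>r \<le> b\<close> by (intro orbit_derivative[OF S x]) auto
  ultimately have "((\<lambda>t. S t x) \<circ> (\<lambda>r. b - r) has_vector_derivative -1 *\<^sub>R S (b - r) y) (at r within {a..b})"
    by (rule vector_diff_chain_within)
  then show ?thesis by (simp add: comp_def)
qed

text \<open>Variation of constants in differential form. With \<open>g\<close> an orbit of another semigroup, the left side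
connects the two semigroups as \<open>s\<close> runs from \<open>0\<close> to \<open>b\<close>, and only the difference of the
two generators enters its derivative.\<close>

lemma duhamel_derivative:
  fixes S :: "real \<Rightarrow> 'a::banach \<Rightarrow>\<^sub>L 'a"
  assumes S: "C0_semigroup S" and g: "(g has_vector_derivative g') (at s within {a..b})"
    and gen: "generator S (g s) = Some y" and "s \<le> b"
  shows "((\<lambda>s. S (b - s) (g s)) has_vector_derivative S (b - s) (g' - y)) (at s within {a..b})"
proof -
  obtain M where M: "\<forall>t\<in>{0..b - a}. norm (S t) \<le> M"
    using C0_semigroup_locally_bounded[OF S] by blast
  have "((\<lambda>r. S (b - r) g') \<longlongrightarrow> S (b - s) g') (at s within {a..b})"
    using \<open>s \<le> b\<close>
    by (intro C0_semigroup_tendsto[OF S] tendsto_intros) (auto simp: eventually_at_filter)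
  then have "((\<lambda>s. S (b - s) (g s)) has_vector_derivative - S (b - s) y + S (b - s) g') (at s within {a..b})"
    using M
    by (intro has_vector_derivative_blinfun_apply_strong[OF reversed_orbit_derivative[OF S gen \<open>s \<le> b\<close>] g, where M=M]) auto
  then show ?thesis by (simp add: blinfun.diff_right)
qed

lemma orbit_taylor_1:
  fixes S :: "real \<Rightarrow> 'a::banach \<Rightarrow>\<^sub>L 'a"
  assumes S: "C0_semigroup S" and x: "generator S x = Some y" and "t \<ge> 0"
    and bound: "\<And>s. s \<in> {0..t} \<Longrightarrow> norm (S s y - k) \<le> c"
  shows "norm (S t x - x - t *\<^sub>R k) \<le> c * t"
proof -
  have "norm (S t x - S 0 x - (t - 0) *\<^sub>R k) \<le> c * (t - 0)"
    using bound
    by (intro mean_value_affine[OF \<open>t \<ge> 0\<close>, where f'="\<lambda>s. S s y"] orbit_derivative[OF S x]) auto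
  then show ?thesis by (simp add: C0_semigroup_0[OF S])
qed

lemma orbit_lipschitz:
  fixes S :: "real \<Rightarrow> 'a::banach \<Rightarrow>\<^sub>L 'a"
  assumes S: "C0_semigroup S" and x: "generator S x = Some y" and "t \<ge> 0"
    and M: "\<And>s. s \<in> {0..t} \<Longrightarrow> norm (S s) \<le> M"
  shows "norm (S t x - x) \<le> M * norm y * t"
proof -
  have "norm (S s y - 0) \<le> M * norm y" if "s \<in> {0..t}" for s
    using mult_right_mono[OF M[OF that], of "norm y"] norm_blinfun[of "S s" y] by simp
  from orbit_taylor_1[OF assms(1-3) this] show ?thesis by simp
qed

section \<open>Averages of a semigroup\<close>

definition semigroup_mean :: "(real \<Rightarrow> ('a::real_normed_vector \<Rightarrow>\<^sub>L 'a)) \<Rightarrow> real \<Rightarrow> ('a \<Rightarrow>\<^sub>L 'a)"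
  where "semigroup_mean S d = Blinfun (\<lambda>x. integral {0..d} (\<lambda>s. S s x) /\<^sub>R d)"

definition semigroup_quotient :: "(real \<Rightarrow> ('a::real_normed_vector \<Rightarrow>\<^sub>L 'a)) \<Rightarrow> real \<Rightarrow> ('a \<Rightarrow>\<^sub>L 'a)"
  where "semigroup_quotient S d = (S d - id_blinfun) /\<^sub>R d"

lemma semigroup_quotient_apply: "semigroup_quotient S d x = (S d x - x) /\<^sub>R d"
  by (simp add: semigroup_quotient_def blinfun.scaleR_left blinfun.diff_left)

lemma orbit_integrable:
  fixes S :: "real \<Rightarrow> 'a::banach \<Rightarrow>\<^sub>L 'a"
  assumes "C0_semigroup S" "a \<ge> 0"
  shows "(\<lambda>s. S s x) integrable_on {a..d}"
  using assms by (intro integrable_continuous_real C0_semigroup_orbit_continuous) auto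

lemma orbit_integral_bound:
  fixes S :: "real \<Rightarrow> 'a::banach \<Rightarrow>\<^sub>L 'a"
  assumes S: "C0_semigroup S" and "d \<ge> 0" and b: "\<And>s. s \<in> {0..d} \<Longrightarrow> norm (S s x - k) \<le> c"
  shows "norm (integral {0..d} (\<lambda>s. S s x) - d *\<^sub>R k) \<le> c * d"
proof -
  have c: "continuous_on {0..d} (\<lambda>s. S s x)"
    by (rule C0_semigroup_orbit_continuous[OF S]) auto
  have "norm (integral {0..d} (\<lambda>s. S s x) - integral {0..0} (\<lambda>s. S s x) - (d - 0) *\<^sub>R k) \<le> c * (d - 0)"
    by (intro mean_value_affine[OF \<open>d \<ge> 0\<close>, where f'="\<lambda>s. S s x"] integral_has_vector_derivative c b)
  then show ?thesis by simp
qed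

lemma semigroup_mean_apply:
  fixes S :: "real \<Rightarrow> 'a::banach \<Rightarrow>\<^sub>L 'a"
  assumes S: "C0_semigroup S" and "d > 0"
  shows "semigroup_mean S d x = integral {0..d} (\<lambda>s. S s x) /\<^sub>R d"
proof -
  obtain M where M: "\<forall>t\<in>{0..d}. norm (S t) \<le> M"
    using C0_semigroup_locally_bounded[OF S] by blast
  have "bounded_linear (\<lambda>x. integral {0..d} (\<lambda>s. S s x) /\<^sub>R d)"
  proof (rule bounded_linear_intro)
    fix x y :: 'a and r :: real
    show "integral {0..d} (\<lambda>s. S s (x + y)) /\<^sub>R d =
        integral {0..d} (\<lambda>s. S s x) /\<^sub>R d + integral {0..d} (\<lambda>s. S s y) /\<^sub>R d"
      using orbit_integrable[OF S, of 0] by (simp add: blinfun.add_right integral_add scaleR_add_right)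
    show "integral {0..d} (\<lambda>s. S s (r *\<^sub>R x)) /\<^sub>R d = r *\<^sub>R (integral {0..d} (\<lambda>s. S s x) /\<^sub>R d)"
      by (simp add: blinfun.scaleR_right)
    have "norm (integral {0..d} (\<lambda>s. S s x) - d *\<^sub>R 0) \<le> (norm x * M) * d"
    proof (rule orbit_integral_bound[OF S])
      fix s assume "s \<in> {0..d}"
      then show "norm (S s x - 0) \<le> norm x * M"
        using M norm_blinfun[of "S s" x]
        by (metis diff_zero mult.commute mult_left_mono norm_ge_zero order_trans)
    qed (use \<open>d > 0\<close> in auto)
    then show "norm (integral {0..d} (\<lambda>s. S s x) /\<^sub>R d) \<le> norm x * M"
      using \<open>d > 0\<close> by (simp add: field_simps)
  qed
  then show ?thesis
    by (simp add: semigroup_mean_def bounded_linear_Blinfun_apply)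
qed

lemma semigroup_mean_near:
  fixes S :: "real \<Rightarrow> 'a::banach \<Rightarrow>\<^sub>L 'a"
  assumes S: "C0_semigroup S" and "d > 0" and b: "\<And>s. s \<in> {0..d} \<Longrightarrow> norm (S s x - k) \<le> c"
  shows "norm (semigroup_mean S d x - k) \<le> c"
proof -
  have "semigroup_mean S d x - k = (integral {0..d} (\<lambda>s. S s x) - d *\<^sub>R k) /\<^sub>R d"
    using \<open>d > 0\<close> by (simp add: semigroup_mean_apply[OF S] scaleR_diff_right)
  also have "norm \<dots> \<le> c"
    using orbit_integral_bound[OF S less_imp_le[OF \<open>d > 0\<close>] b] \<open>d > 0\<close>
    by (simp add: divide_simps mult.commute)
  finally show ?thesis .
qed

lemma norm_semigroup_mean_le:
  fixes S :: "real \<Rightarrow> 'a::banach \<Rightarrow>\<^sub>L 'a"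
  assumes S: "C0_semigroup S" and "d > 0" and M: "\<And>s. s \<in> {0..d} \<Longrightarrow> norm (S s) \<le> M"
  shows "norm (semigroup_mean S d) \<le> M"
proof (rule norm_blinfun_bound)
  show "0 \<le> M" using M[of 0] \<open>d > 0\<close> by (meson atLeastAtMost_iff less_imp_le norm_ge_zero order_refl order_trans)
  fix x
  have "norm (S s x) \<le> M * norm x" if "s \<in> {0..d}" for s
    using M[OF that] by (meson mult_right_mono norm_blinfun norm_ge_zero order_trans)
  then show "norm (semigroup_mean S d x) \<le> M * norm x"
    using semigroup_mean_near[OF S \<open>d > 0\<close>, of x 0] by simp
qed

lemma semigroup_mean_tendsto:
  fixes S :: "real \<Rightarrow> 'a::banach \<Rightarrow>\<^sub>L 'a"
  assumes S: "C0_semigroup S"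
  shows "((\<lambda>d. semigroup_mean S d x) \<longlongrightarrow> x) (at_right 0)"
proof (rule tendstoI)
  fix e :: real assume "e > 0"
  have "((\<lambda>s. S s x) \<longlongrightarrow> S 0 x) (at 0 within {0..})"
    using C0_semigroup_orbit_continuous[OF S order_refl] by (auto simp: continuous_on_def)
  then obtain \<rho> where \<rho>: "\<rho> > 0" "\<And>s. s > 0 \<Longrightarrow> s < \<rho> \<Longrightarrow> dist (S s x) x < e / 2"
    using \<open>e > 0\<close> unfolding tendsto_iff eventually_at
    by (metis C0_semigroup_0[OF S] abs_of_nonneg atLeast_iff dist_real_def diff_zero half_gt_zero
        id_blinfun.rep_eq less_imp_le less_irrefl)
  have "dist (semigroup_mean S d x) x < e" if d: "d > 0" "d < \<rho>" for d
  proof -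
    have "norm (S s x - x) \<le> e / 2" if "s \<in> {0..d}" for s
      using \<rho>(2)[of s] that d \<open>e > 0\<close> C0_semigroup_0[OF S]
      by (cases "s = 0") (auto simp: dist_norm)
    from semigroup_mean_near[OF S d(1) this] show ?thesis
      using \<open>e > 0\<close> by (simp add: dist_norm)
  qed
  then show "eventually (\<lambda>d. dist (semigroup_mean S d x) x < e) (at_right 0)"
    using \<rho>(1) by (auto simp: eventually_at_right_field)
qed

lemma semigroup_mean_commute:
  fixes S :: "real \<Rightarrow> 'a::banach \<Rightarrow>\<^sub>L 'a"
  assumes S: "C0_semigroup S" and "d > 0" "t \<ge> 0"
  shows "semigroup_mean S d (S t x) = S t (semigroup_mean S d x)"
proof -
  have "integral {0..d} (\<lambda>s. S s (S t x)) = integral {0..d} (\<lambda>s. S t (S s x))"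
    using C0_semigroup_commute[OF S] \<open>t \<ge> 0\<close> by (intro integral_cong) auto
  also have "\<dots> = S t (integral {0..d} (\<lambda>s. S s x))"
    using integral_linear[OF orbit_integrable[OF S order_refl] blinfun.bounded_linear_right]
    by (simp add: comp_def)
  finally show ?thesis
    using \<open>d > 0\<close> by (simp add: semigroup_mean_apply[OF S] blinfun.scaleR_right)
qed

text \<open>Averaging maps every vector into the domain of the generator, and the generator composed with the
average is the bounded difference quotient. On the domain the order can be reversed
(\<open>semigroup_mean_generator\<close>). These two identities are what lets bounded operators replace the
generator in derivatives.\<close>

lemma generator_semigroup_mean:
  fixes S :: "real \<Rightarrow> 'a::banach \<Rightarrow>\<^sub>L 'a"
  assumes S: "C0_semigroup S" and "d > 0"
  shows "generator S (semigroup_mean S d x) = Some (semigroup_quotient S d x)"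
proof -
  define \<Phi> where "\<Phi> t = integral {0..t} (\<lambda>s. S s x)" for t
  have deriv: "((\<lambda>h. (\<Phi> (t + h) - \<Phi> t) /\<^sub>R h) \<longlongrightarrow> S t x) (at_right 0)" if "t \<ge> 0" for t
  proof -
    have c: "continuous_on {0..t + 1} (\<lambda>s. S s x)"
      using that by (intro C0_semigroup_orbit_continuous[OF S]) auto
    have "(\<Phi> has_vector_derivative S t x) (at t within {0..t + 1})"
      unfolding \<Phi>_def using that by (intro integral_has_vector_derivative c) auto
    then have lim: "((\<lambda>y. (\<Phi> y - \<Phi> t) /\<^sub>R (y - t)) \<longlongrightarrow> S t x) (at t within {0..t + 1})"
      by (simp add: has_vector_derivative_iff_quotient)
    have "filterlim (\<lambda>h. t + h) (at t within {0..t + 1}) (at_right 0)"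
      unfolding filterlim_at using that
      by (auto simp: eventually_at_right_field intro!: tendsto_eq_intros exI[of _ 1])
    from filterlim_compose[OF lim this] show ?thesis by simp
  qed
  have shift: "S h (\<Phi> d) = \<Phi> (d + h) - \<Phi> h" if "h > 0" for h
  proof -
    have "S h (\<Phi> d) = integral {0..d} (\<lambda>s. S h (S s x))"
      unfolding \<Phi>_def
      by (rule integral_linear[OF orbit_integrable[OF S order_refl] blinfun.bounded_linear_right,
            unfolded comp_def, symmetric])
    also have "\<dots> = integral {0..d} (\<lambda>s. S (s + h) x)"
      using C0_semigroup_add[OF S, of h] \<open>h > 0\<close> by (intro integral_cong) (auto simp: add.commute)
    also have "\<dots> = integral {h..d + h} (\<lambda>s. S s x)"
      using integral_shift_real_ivl[of h h "d + h" "\<lambda>s. S s x"] by simp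
    finally show ?thesis
      using Henstock_Kurzweil_Integration.integral_combine[where f="\<lambda>s. S s x" and a=0 and c=h and b="d + h"] orbit_integrable[OF S] \<open>h > 0\<close> \<open>d > 0\<close>
      by (simp add: \<Phi>_def algebra_simps)
  qed
  have \<Phi>0: "\<Phi> 0 = 0" by (simp add: \<Phi>_def)
  have "((\<lambda>h. ((\<Phi> (d + h) - \<Phi> d) /\<^sub>R h - (\<Phi> (0 + h) - \<Phi> 0) /\<^sub>R h) /\<^sub>R d) \<longlongrightarrow> (S d x - S 0 x) /\<^sub>R d) (at_right 0)"
    using \<open>d > 0\<close> by (intro tendsto_intros deriv) auto
  moreover have "eventually (\<lambda>h. ((\<Phi> (d + h) - \<Phi> d) /\<^sub>R h - (\<Phi> (0 + h) - \<Phi> 0) /\<^sub>R h) /\<^sub>R d =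
     (S h (\<Phi> d /\<^sub>R d) - \<Phi> d /\<^sub>R d) /\<^sub>R h) (at_right 0)"
    unfolding eventually_at_filter
    by (rule always_eventually) (simp add: shift blinfun.scaleR_right \<Phi>0 algebra_simps)
  ultimately show ?thesis
    using \<open>d > 0\<close> unfolding generator_eq_Some_iff
    by (simp add: semigroup_mean_apply[OF S] semigroup_quotient_apply \<Phi>_def C0_semigroup_0[OF S] tendsto_cong)
qed

lemma semigroup_mean_generator:
  fixes S :: "real \<Rightarrow> 'a::banach \<Rightarrow>\<^sub>L 'a"
  assumes S: "C0_semigroup S" and "d > 0" and x: "generator S x = Some y"
  shows "semigroup_mean S d y = semigroup_quotient S d x"
proof -
  have "((\<lambda>s. S s y) has_integral (S d x - S 0 x)) {0..d}"
    using \<open>d > 0\<close> by (intro fundamental_theorem_of_calculus orbit_derivative[OF S x]) auto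
  then show ?thesis
    using \<open>d > 0\<close> by (simp add: semigroup_mean_apply[OF S] semigroup_quotient_apply C0_semigroup_0[OF S] integral_unique)
qed

text \<open>The rate depends on \<open>x\<close> only through the value of the generator. Applied to \<open>C x\<close> in place of \<open>x\<close>, a
bound on \<open>C (C x)\<close> makes the convergence of the quotients to \<open>C x\<close> uniform.\<close>

lemma semigroup_mean_error:
  fixes S :: "real \<Rightarrow> 'a::banach \<Rightarrow>\<^sub>L 'a"
  assumes S: "C0_semigroup S" and "d > 0" and x: "generator S x = Some y"
    and M: "\<And>s. s \<in> {0..d} \<Longrightarrow> norm (S s) \<le> M"
  shows "norm (semigroup_mean S d x - x) \<le> M * norm y * d"
proof (rule semigroup_mean_near[OF S \<open>d > 0\<close>])
  fix s assume s: "s \<in> {0..d}"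
  have "M \<ge> 0" using M[OF s] norm_ge_zero order_trans by blast
  then have "M * norm y * s \<le> M * norm y * d" using s by (intro mult_left_mono) auto
  then show "norm (S s x - x) \<le> M * norm y * d"
    using orbit_lipschitz[OF S x, of s M] s M by force
qed

section \<open>A generator determines its semigroup\<close>

text \<open>For \<open>x\<close> in the domain, \<open>s \<mapsto> S (t - s) (R s x)\<close> has derivative zero, so its end values \<open>S t x\<close> and \<open>R t x\<close>
agree. The domain is dense because it contains all averages.\<close>

theorem generator_determines_semigroup:
  fixes S R :: "real \<Rightarrow> 'a::banach \<Rightarrow>\<^sub>L 'a"
  assumes S: "C0_semigroup S" and R: "C0_semigroup R" and eq: "generator S = generator R" and "t \<ge> 0"
  shows "S t = R t"
proof (rule blinfun_eqI)
  have dom: "S t x = R t x" if x: "generator R x = Some y" for x y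
  proof -
    have "norm (S (t - t) (R t x) - S (t - 0) (R 0 x) - (t - 0) *\<^sub>R 0) \<le> 0 * (t - 0)"
    proof (rule mean_value_affine[OF \<open>t \<ge> 0\<close>])
      fix s assume s: "s \<in> {0..t}"
      have "((\<lambda>s. R s x) has_vector_derivative R s y) (at s within {0..t})"
        using s by (intro orbit_derivative[OF R x]) auto
      then show "((\<lambda>s. S (t - s) (R s x)) has_vector_derivative S (t - s) (R s y - R s y)) (at s within {0..t})"
        using s generator_orbit[OF R x, of s] eq by (intro duhamel_derivative[OF S]) auto
    qed simp
    then show ?thesis by (simp add: C0_semigroup_0[OF S] C0_semigroup_0[OF R])
  qed
  fix x
  have lim: "((\<lambda>d. S t (semigroup_mean R d x)) \<longlongrightarrow> S t x) (at_right 0)"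
    "((\<lambda>d. R t (semigroup_mean R d x)) \<longlongrightarrow> R t x) (at_right 0)"
    by (intro tendsto_intros semigroup_mean_tendsto[OF R])+
  have "eventually (\<lambda>d. S t (semigroup_mean R d x) = R t (semigroup_mean R d x)) (at_right 0)"
    using dom[OF generator_semigroup_mean[OF R]] by (auto simp: eventually_at_filter)
  from lim(1)[unfolded tendsto_cong[OF this]] lim(2) show "S t x = R t x"
    by (rule tendsto_unique[OF trivial_limit_at_right_real])
qed

lemma exp_op_eq:
  fixes S :: "real \<Rightarrow> 'a::banach \<Rightarrow>\<^sub>L 'a"
  assumes "C0_semigroup S" "generator S = L" "t \<ge> 0"
  shows "exp_op L t = S t"
  unfolding exp_op_def
proof (rule the_equality)
  show "\<exists>S'. C0_semigroup S' \<and> generator S' = L \<and> S t = S' t"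
    using assms by (intro exI[of _ S]) simp
next
  fix E assume "\<exists>S'. C0_semigroup S' \<and> generator S' = L \<and> E = S' t"
  then obtain S' where S': "C0_semigroup S'" "generator S' = L" "E = S' t" by (elim exE conjE)
  then have "S' t = S t"
    using assms by (intro generator_determines_semigroup) simp_all
  then show "E = S t" using S' by simp
qed

section \<open>Equivalent norms\<close>

lemma equivalent_norm_bounds:
  assumes "equivalent_norm N"
  obtains a b where "a > 0" "b > 0" "\<And>x. a * norm x \<le> N x" "\<And>x. N x \<le> b * norm x"
  using assms unfolding equivalent_norm_def by blast

lemma equivalent_norm_nonneg: "equivalent_norm N \<Longrightarrow> 0 \<le> N x"
  by (metis equivalent_norm_bounds less_imp_le mult_nonneg_nonneg norm_ge_zero order_trans)

lemma equivalent_norm_add: "equivalent_norm N \<Longrightarrow> N (x + y) \<le> N x + N y"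
  unfolding equivalent_norm_def by blast

lemma equivalent_norm_scaleR: "equivalent_norm N \<Longrightarrow> N (r *\<^sub>R x) = \<bar>r\<bar> * N x"
  unfolding equivalent_norm_def by blast

lemma equivalent_norm_eq_0: "equivalent_norm N \<Longrightarrow> N x = 0 \<longleftrightarrow> x = 0"
  unfolding equivalent_norm_def by blast

lemma equivalent_norm_minus: "equivalent_norm N \<Longrightarrow> N (- x) = N x"
  using equivalent_norm_scaleR[of N "-1" x] by simp

lemma equivalent_norm_reverse_triangle:
  assumes "equivalent_norm N"
  shows "\<bar>N x - N y\<bar> \<le> N (x - y)"
proof -
  have "N x \<le> N (x - y) + N y" "N y \<le> N (y - x) + N x"
    using equivalent_norm_add[OF assms, of "x - y" y] equivalent_norm_add[OF assms, of "y - x" x] by auto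
  moreover have "N (y - x) = N (x - y)"
    using equivalent_norm_minus[OF assms, of "x - y"] by simp
  ultimately show ?thesis by linarith
qed

lemma equivalent_norm_tendsto:
  assumes N: "equivalent_norm N" and f: "(f \<longlongrightarrow> x) F"
  shows "((\<lambda>i. N (f i)) \<longlongrightarrow> N x) F"
proof -
  obtain b where b: "\<And>x. N x \<le> b * norm x"
    using equivalent_norm_bounds[OF N] by metis
  have "((\<lambda>i. N (f i) - N x) \<longlongrightarrow> 0) F"
  proof (rule Lim_null_comparison)
    show "eventually (\<lambda>i. norm (N (f i) - N x) \<le> b * norm (f i - x)) F"
      using equivalent_norm_reverse_triangle[OF N] b
      by (intro always_eventually allI) (metis order_trans real_norm_def)
    show "((\<lambda>i. b * norm (f i - x)) \<longlongrightarrow> 0) F"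
      using f by (simp add: LIM_zero tendsto_mult_right_zero tendsto_norm_zero)
  qed
  then show ?thesis by (rule LIM_zero_cancel)
qed

lemma equivalent_norm_continuous_on:
  "equivalent_norm N \<Longrightarrow> continuous_on X f \<Longrightarrow> continuous_on X (\<lambda>x. N (f x))"
  unfolding continuous_on_def by (auto intro: equivalent_norm_tendsto)

section \<open>Increments of a function across a closed set\<close>

text \<open>For a closed set \<open>E\<close> with points on both sides of \<open>r\<close> and a point \<open>r\<close> outside \<open>E\<close>, these are the ends of the
gap of \<open>E\<close> around \<open>r\<close>.\<close>

definition left_end :: "real set \<Rightarrow> real \<Rightarrow> real"
  where "left_end E r = Sup (E \<inter> {..r})"

definition right_end :: "real set \<Rightarrow> real \<Rightarrow> real"
  where "right_end E r = Inf (E \<inter> {r..})"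

text \<open>The size of the derivative of the function that agrees with \<open>f\<close> on \<open>E\<close> and is affine on the gaps of
\<open>E\<close>, where \<open>f'\<close> is the derivative of \<open>f\<close>.\<close>

definition gap_slope :: "('a::real_normed_vector \<Rightarrow> real) \<Rightarrow> (real \<Rightarrow> 'a) \<Rightarrow> (real \<Rightarrow> 'a) \<Rightarrow> real set \<Rightarrow> real \<Rightarrow> real"
  where "gap_slope N f f' E r = (if r \<in> E then N (f' r)
    else N (f (right_end E r) - f (left_end E r)) / (right_end E r - left_end E r))"

lemma left_end:
  assumes "closed E" "e \<in> E" "e \<le> r"
  shows "left_end E r \<in> E" "left_end E r \<le> r" "x \<in> E \<Longrightarrow> x \<le> r \<Longrightarrow> x \<le> left_end E r"
proof -
  have "left_end E r \<in> E \<inter> {..r}"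
    unfolding left_end_def using assms
    by (intro closed_contains_Sup bdd_aboveI[of _ r] closed_Int) auto
  then show "left_end E r \<in> E" "left_end E r \<le> r" by auto
  show "x \<in> E \<Longrightarrow> x \<le> r \<Longrightarrow> x \<le> left_end E r"
    unfolding left_end_def by (intro cSup_upper bdd_aboveI[of _ r]) auto
qed

lemma right_end:
  assumes "closed E" "e \<in> E" "r \<le> e"
  shows "right_end E r \<in> E" "r \<le> right_end E r" "x \<in> E \<Longrightarrow> r \<le> x \<Longrightarrow> right_end E r \<le> x"
proof -
  have "right_end E r \<in> E \<inter> {r..}"
    unfolding right_end_def using assms
    by (intro closed_contains_Inf bdd_belowI[of _ r] closed_Int) auto
  then show "right_end E r \<in> E" "r \<le> right_end E r" by auto
  show "x \<in> E \<Longrightarrow> r \<le> x \<Longrightarrow> right_end E r \<le> x"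
    unfolding right_end_def by (intro cInf_lower bdd_belowI[of _ r]) auto
qed

lemma gap_ends:
  assumes E: "closed E" "a \<in> E" "b \<in> E" and r: "a \<le> r" "r \<le> b" "r \<notin> E"
  shows "left_end E r < r" "r < right_end E r" "{left_end E r<..<right_end E r} \<inter> E = {}"
    "a \<le> left_end E r" "right_end E r \<le> b"
proof -
  note l = left_end[OF E(1,2) r(1)] and u = right_end[OF E(1,3) r(2)]
  show "left_end E r < r" "r < right_end E r"
    using l(1,2) u(1,2) r(3) by (metis order_le_less)+
  show "{left_end E r<..<right_end E r} \<inter> E = {}"
    using l(3) u(3) by fastforce
  show "a \<le> left_end E r" "right_end E r \<le> b"
    using l(3)[OF E(2) r(1)] u(3)[OF E(3) r(2)] by auto
qed

lemma gap_ends_unique: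
  assumes E: "closed E" "p \<in> E" "q \<in> E" and r: "p < r" "r < q" and gap: "{p<..<q} \<inter> E = {}"
  shows "r \<notin> E" "left_end E r = p" "right_end E r = q"
proof -
  note l = left_end[OF E(1,2) less_imp_le[OF r(1)]] and u = right_end[OF E(1,3) less_imp_le[OF r(2)]]
  show "r \<notin> E" using gap r by auto
  have "p \<le> left_end E r" "right_end E r \<le> q"
    using l(3)[OF E(2)] u(3)[OF E(3)] r by auto
  moreover have "\<not> p < left_end E r" "\<not> right_end E r < q"
    using l(1,2) u(1,2) gap r by (fastforce simp: disjoint_iff)+
  ultimately show "left_end E r = p" "right_end E r = q" by auto
qed

text \<open>The ends of a gap are monotone functions of the point, hence Borel. The slope is a continuous real
function of the two ends; this route avoids measurability of functions with values in a space that may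
be nonseparable.\<close>

lemma gap_slope_integrable:
  fixes f f' :: "real \<Rightarrow> 'a::real_normed_vector"
  assumes N: "equivalent_norm N" and E: "closed E" "a \<in> E" "b \<in> E"
    and f: "continuous_on {a..b} f" and f': "continuous_on {a..b} f'"
    and bound: "\<And>r. r \<in> {a..b} \<Longrightarrow> gap_slope N f f' E r \<le> K"
  shows "gap_slope N f f' E integrable_on {a..b}"
proof (cases "a \<le> b")
  case True
  \<comment> \<open>Clamping to the interval turns functions that are continuous on it into continuous functions
    on the line, for which Borel measurability is immediate.\<close>
  define cl where "cl r = max a (min b r)" for r
  define l u where "l r = left_end E (max a r)" and "u r = right_end E (min b r)" for r
  have cl: "continuous_on UNIV cl" "cl r \<in> {a..b}" for r
    using True by (auto simp: cl_def intro!: continuous_intros)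
  have "mono l"
    unfolding l_def left_end_def using E
    by (intro monoI cSup_subset_mono bdd_aboveI[of _ "max a _"]) auto
  then have [measurable]: "l \<in> borel_measurable borel" by (rule borel_measurable_mono)
  have "mono u"
    unfolding u_def right_end_def using E
    by (intro monoI cInf_superset_mono bdd_belowI[of _ "min b _"]) auto
  then have [measurable]: "u \<in> borel_measurable borel" by (rule borel_measurable_mono)
  have "continuous_on UNIV (\<lambda>p::real \<times> real. N (f (cl (snd p)) - f (cl (fst p))))"
    using cl
    by (intro equivalent_norm_continuous_on[OF N] continuous_intros continuous_on_compose2[OF f]
        continuous_on_compose2[OF cl(1)]) auto
  then have [measurable]: "(\<lambda>r. N (f (cl (u r)) - f (cl (l r)))) \<in> borel_measurable borel"
    using borel_measurable_continuous_Pair[of l borel u "\<lambda>x y. N (f (cl y) - f (cl x))"] by simp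
  have "continuous_on UNIV (\<lambda>r. N (f' (cl r)))"
    using cl by (intro equivalent_norm_continuous_on[OF N] continuous_on_compose2[OF f']) auto
  then have [measurable]: "(\<lambda>r. N (f' (cl r))) \<in> borel_measurable borel"
    by (rule borel_measurable_continuous_onI)
  have [measurable]: "E \<in> sets borel" using E by auto
  define g where "g r = (if r \<in> E then N (f' (cl r)) else N (f (cl (u r)) - f (cl (l r))) / (u r - l r))" for r
  have [measurable]: "g \<in> borel_measurable borel" unfolding g_def by measurable
  have eq: "g r = gap_slope N f f' E r" if r: "r \<in> {a..b}" for r
  proof (cases "r \<in> E")
    case True
    then show ?thesis using r by (simp add: g_def gap_slope_def cl_def)
  next
    case False
    then show ?thesis
      using gap_ends[OF E, of r] r by (simp add: g_def gap_slope_def cl_def l_def u_def)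
  qed
  have "g integrable_on {a..b}"
  proof (rule measurable_bounded_by_integrable_imp_integrable)
    show "g \<in> borel_measurable (lebesgue_on {a..b})"
      by (intro measurable_restrict_space1 measurable_completion) simp
    show "(\<lambda>_. K) integrable_on {a..b}" by (rule integrable_const_ivl)
    fix r assume r: "r \<in> {a..b}"
    have "0 \<le> gap_slope N f f' E r"
    proof (cases "r \<in> E")
      case True
      then show ?thesis by (simp add: gap_slope_def equivalent_norm_nonneg[OF N])
    next
      case False
      then show ?thesis
        using gap_ends[OF E, of r] r
        by (auto simp: gap_slope_def equivalent_norm_nonneg[OF N] intro!: divide_nonneg_nonneg)
    qed
    then show "norm (g r) \<le> K" using bound[OF r] eq[OF r] by simp
  qed auto
  then show ?thesis using integrable_cong[of "{a..b}" g, OF eq] by blast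
qed (simp add: integrable_on_empty)

text \<open>Inside the gaps of \<open>E\<close> the derivative of \<open>f\<close> does not occur on the right-hand side, only the increments
over whole gaps do. The proof is a continuous induction along \<open>E\<close>: a point of \<open>E\<close> either is the left end
of a gap, which is passed in one step, or it is a limit of points of \<open>E\<close> from the right. In the second
case continuity of \<open>f'\<close> makes the slopes of the nearby gaps almost as large as \<open>f'\<close> at the point.\<close>

lemma increment_le_integral_gap_slope:
  fixes f f' :: "real \<Rightarrow> 'a::real_normed_vector"
  assumes N: "equivalent_norm N" and E: "closed E" "E \<subseteq> {a..b}" "a \<in> E" "b \<in> E"
    and deriv: "\<And>r. r \<in> {a..b} \<Longrightarrow> (f has_vector_derivative f' r) (at r within {a..b})"
    and cont: "continuous_on {a..b} f'"
    and int: "gap_slope N f f' E integrable_on {a..b}"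
  shows "N (f b - f a) \<le> integral {a..b} (gap_slope N f f' E)"
proof (rule field_le_epsilon)
  fix e0 :: real assume "e0 > 0"
  define e where "e = e0 / (b - a + 1)"
  have "a \<le> b" using E by auto
  then have e: "e > 0" "e * (b - a) \<le> e0"
    using \<open>e0 > 0\<close> by (auto simp: e_def field_simps)
  define h where "h = gap_slope N f f' E"
  define I where "I r = integral {a..r} h" for r
  obtain B where B: "B > 0" "\<And>x. N x \<le> B * norm x"
    using equivalent_norm_bounds[OF N] by metis
  have int': "h integrable_on {p..q}" if "a \<le> p" "q \<le> b" for p q
    using integrable_on_subinterval[OF int, of p q] that by (auto simp: h_def)
  have I_diff: "I q - I p = integral {p..q} h" if "a \<le> p" "p \<le> q" "q \<le> b" for p q
    using Henstock_Kurzweil_Integration.integral_combine[of a p q h] int'[of a q] that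
    by (simp add: I_def)
  have contf: "continuous_on {a..b} f"
    using deriv by (meson continuous_on_eq_continuous_within has_vector_derivative_continuous)
  have contI: "continuous_on {a..b} I"
    unfolding I_def by (intro indefinite_integral_continuous_1 int') auto
  have gap_step: "N (f q - f p) \<le> I q - I p"
    if "p \<in> E" "q \<in> E" "p < q" "{p<..<q} \<inter> E = {}" for p q
  proof -
    have pq: "a \<le> p" "q \<le> b" using that E by auto
    have "integral {p..q} h = integral {p..q} (\<lambda>_. N (f q - f p) / (q - p))"
    proof (rule integral_spike[of "{p, q}"])
      fix r assume "r \<in> {p..q} - {p, q}"
      then have r: "p < r" "r < q" by auto
      show "N (f q - f p) / (q - p) = h r"
        using gap_ends_unique[OF E(1) that(1,2) r that(4)] by (simp add: h_def gap_slope_def)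
    qed auto
    then show ?thesis using I_diff[of p q] pq that by simp
  qed
  \<comment> \<open>The increment is at most \<open>(q - p) (N (f' p) + e / 2)\<close>, the integral at least \<open>(q - p) (N (f' p) - e / 2)\<close>.\<close>
  have local_step: "\<exists>\<rho>>0. \<forall>q\<in>E. p \<le> q \<and> q < p + \<rho> \<longrightarrow> N (f q - f p) \<le> I q - I p + e * (q - p)"
    if p: "p \<in> E" for p
  proof -
    have "p \<in> {a..b}" using p E by auto
    then obtain \<rho> where \<rho>: "\<rho> > 0" "\<And>s. s \<in> {a..b} \<Longrightarrow> dist s p < \<rho> \<Longrightarrow> dist (f' s) (f' p) < e / (2 * B)"
      using cont[unfolded continuous_on_iff, rule_format, of p "e / (2 * B)"] e B by auto
    have near: "N (f s - f r - (s - r) *\<^sub>R f' p) \<le> e / 2 * (s - r)"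
      if "p \<le> r" "r \<le> s" "s < p + \<rho>" "s \<le> b" for r s
    proof -
      have "norm (f s - f r - (s - r) *\<^sub>R f' p) \<le> e / (2 * B) * (s - r)"
      proof (rule mean_value_affine[OF that(2)])
        fix t assume t: "t \<in> {r..s}"
        then have t': "t \<in> {a..b}" "dist t p < \<rho>"
          using that \<open>p \<in> {a..b}\<close> by (auto simp: dist_real_def)
        show "(f has_vector_derivative f' t) (at t within {r..s})"
          using that \<open>p \<in> {a..b}\<close> by (intro has_vector_derivative_within_subset[OF deriv[OF t'(1)]]) auto
        show "norm (f' t - f' p) \<le> e / (2 * B)"
          using \<rho>(2)[OF t'] by (simp add: dist_norm)
      qed
      then have "B * norm (f s - f r - (s - r) *\<^sub>R f' p) \<le> e / 2 * (s - r)"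
        using B by (simp add: field_simps)
      then show ?thesis using B(2) order_trans by blast
    qed
    have N_near: "\<bar>N (f s - f r) - (s - r) * N (f' p)\<bar> \<le> e / 2 * (s - r)"
      if "p \<le> r" "r \<le> s" "s < p + \<rho>" "s \<le> b" for r s
      using equivalent_norm_reverse_triangle[OF N, of "f s - f r" "(s - r) *\<^sub>R f' p"] near[OF that] that
      by (simp add: equivalent_norm_scaleR[OF N])
    have "N (f q - f p) \<le> I q - I p + e * (q - p)" if q: "q \<in> E" "p \<le> q" "q < p + \<rho>" for q
    proof -
      have "q \<le> b" using q E by auto
      have "N (f' p) - e / 2 \<le> h r" if r: "r \<in> {p..q}" for r
      proof (cases "r \<in> E")
        case True
        have "dist (f' r) (f' p) < e / (2 * B)"
          using \<rho>(2)[of r] r q \<open>p \<in> {a..b}\<close> \<open>q \<le> b\<close> by (auto simp: dist_real_def)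
        then have "B * norm (f' p - f' r) \<le> e / 2"
          using B by (simp add: field_simps dist_norm norm_minus_commute)
        then have "N (f' p - f' r) \<le> e / 2" using B(2) order_trans by blast
        then have "N (f' p) - N (f' r) \<le> e / 2"
          using equivalent_norm_reverse_triangle[OF N, of "f' p" "f' r"] by linarith
        then show ?thesis using True by (simp add: h_def gap_slope_def)
      next
        case False
        define s t where "s = left_end E r" and "t = right_end E r"
        have st: "p \<le> s" "s < t" "t \<le> q"
          using gap_ends[OF E(1) p q(1) _ _ False] r by (auto simp: s_def t_def)
        have "(t - s) * N (f' p) - e / 2 * (t - s) \<le> N (f t - f s)"
          using N_near[of s t] st q \<open>q \<le> b\<close> by linarith
        then have "(t - s) * (N (f' p) - e / 2) \<le> N (f t - f s)"
          by (simp add: algebra_simps)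
        then show ?thesis
          using False st by (simp add: h_def gap_slope_def s_def[symmetric] t_def[symmetric] pos_le_divide_eq mult.commute)
      qed
      then have "integral {p..q} (\<lambda>_. N (f' p) - e / 2) \<le> integral {p..q} h"
        using \<open>p \<in> {a..b}\<close> \<open>q \<le> b\<close> by (intro integral_le integrable_const_ivl int') auto
      then have "(q - p) * (N (f' p) - e / 2) \<le> I q - I p"
        using I_diff[of p q] \<open>p \<in> {a..b}\<close> \<open>q \<le> b\<close> q by simp
      moreover have "N (f q - f p) \<le> (q - p) * N (f' p) + e / 2 * (q - p)"
        using N_near[of p q] q \<open>q \<le> b\<close> by linarith
      ultimately show ?thesis by (simp add: field_simps)
    qed
    with \<rho>(1) show ?thesis by blast
  qed
  \<comment> \<open>The largest point of \<open>E\<close> up to which the claim holds is \<open>b\<close>.\<close>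
  define R where "R = {r \<in> E. N (f r - f a) \<le> I r + e * (r - a)}"
  have "continuous_on E (\<lambda>r. N (f r - f a))" "continuous_on E (\<lambda>r. I r + e * (r - a))"
    using continuous_on_subset[OF contf E(2)] continuous_on_subset[OF contI E(2)]
    by (auto intro!: equivalent_norm_continuous_on[OF N] continuous_intros)
  then have "closed R"
    unfolding R_def using E(1) by (rule continuous_on_closed_Collect_le)
  have "a \<in> R"
    using E equivalent_norm_eq_0[OF N, of 0] by (simp add: R_def I_def)
  have R_sub: "R \<subseteq> {a..b}" using E by (auto simp: R_def)
  then have bdd: "bdd_above R" by (intro bdd_aboveI[of _ b]) auto
  define c where "c = Sup R"
  have "c \<in> R"
    unfolding c_def using \<open>closed R\<close> \<open>a \<in> R\<close> bdd by (intro closed_contains_Sup) auto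
  have c_max: "r \<le> c" if "r \<in> R" for r
    unfolding c_def using that bdd by (rule cSup_upper)
  have c: "c \<in> E" "N (f c - f a) \<le> I c + e * (c - a)" "c \<le> b"
    using \<open>c \<in> R\<close> R_sub by (auto simp: R_def)
  have extend: "q \<in> R" if "q \<in> E" "N (f q - f c) \<le> I q - I c + e * (q - c)" for q
    using that c(2) equivalent_norm_add[OF N, of "f q - f c" "f c - f a"]
    by (simp add: R_def algebra_simps)
  have "c = b"
  proof (rule ccontr)
    assume "c \<noteq> b"
    then have "c < b" using c by simp
    obtain \<rho> where \<rho>: "\<rho> > 0" "\<And>q. q \<in> E \<Longrightarrow> c \<le> q \<Longrightarrow> q < c + \<rho> \<Longrightarrow> N (f q - f c) \<le> I q - I c + e * (q - c)"
      using local_step[OF c(1)] by blast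
    show False
    proof (cases "\<exists>q\<in>E. c < q \<and> q < c + \<rho>")
      case True
      then obtain q where q: "q \<in> E" "c < q" "q < c + \<rho>" by blast
      then have "q \<in> R" using \<rho>(2)[of q] by (intro extend) auto
      then show False using c_max[of q] q by simp
    next
      case False
      define r where "r = (c + min b (c + \<rho>)) / 2"
      have r: "c < r" "r < b" "r < c + \<rho>"
        using \<open>c < b\<close> \<rho>(1) by (auto simp: r_def min_def)
      then have "r \<notin> E" using False by auto
      note g = gap_ends[OF E(1) c(1) E(4) less_imp_le[OF r(1)] less_imp_le[OF r(2)] this]
      have mem: "left_end E r \<in> E" "right_end E r \<in> E"
        using left_end(1)[OF E(1) c(1) less_imp_le[OF r(1)]] right_end(1)[OF E(1,4) less_imp_le[OF r(2)]] by auto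
      have "left_end E r = c"
        using g(1,4) r mem(1) False by (metis less_trans order_le_less)
      then have "N (f (right_end E r) - f c) \<le> I (right_end E r) - I c"
        using gap_step[OF mem] g by simp
      moreover have "0 \<le> e * (right_end E r - c)"
        using e g r by (intro mult_nonneg_nonneg) auto
      ultimately have "right_end E r \<in> R" using mem by (intro extend) auto
      then show False using c_max[of "right_end E r"] g r by simp
    qed
  qed
  then show "N (f b - f a) \<le> integral {a..b} (gap_slope N f f' E) + e0"
    using c(2) e by (simp add: I_def h_def)
qed

text \<open>The preceding lemma for a set without gaps replaces the triangle inequality for integrals, which is
at hand only for the norm of the type class.\<close>

lemma mean_le_sup_equivalent_norm:
  fixes S :: "real \<Rightarrow> 'a::banach \<Rightarrow>\<^sub>L 'a"
  assumes S: "C0_semigroup S" and N: "equivalent_norm N" and "d > 0"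
    and bound: "\<And>s. s \<in> {0..d} \<Longrightarrow> N (S s x) \<le> c"
  shows "N (semigroup_mean S d x) \<le> c"
proof -
  define \<Phi> where "\<Phi> t = integral {0..t} (\<lambda>s. S s x)" for t
  have cont: "continuous_on {0..d} (\<lambda>s. S s x)"
    by (intro C0_semigroup_orbit_continuous[OF S]) auto
  have deriv: "(\<Phi> has_vector_derivative S s x) (at s within {0..d})" if "s \<in> {0..d}" for s
    unfolding \<Phi>_def using that by (intro integral_has_vector_derivative cont)
  have slope: "gap_slope N \<Phi> (\<lambda>s. S s x) {0..d} s \<le> c" if "s \<in> {0..d}" for s
    using bound[OF that] that by (simp add: gap_slope_def)
  have contP: "continuous_on {0..d} \<Phi>"
    using deriv by (meson continuous_on_eq_continuous_within has_vector_derivative_continuous)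
  have int: "gap_slope N \<Phi> (\<lambda>s. S s x) {0..d} integrable_on {0..d}"
    using \<open>d > 0\<close> slope by (intro gap_slope_integrable[OF N _ _ _ contP cont]) auto
  have "N (\<Phi> d - \<Phi> 0) \<le> integral {0..d} (gap_slope N \<Phi> (\<lambda>s. S s x) {0..d})"
    using \<open>d > 0\<close> by (intro increment_le_integral_gap_slope[OF N _ _ _ _ deriv cont int]) auto
  also have "\<dots> \<le> integral {0..d} (\<lambda>_. c)"
    by (intro integral_le int integrable_const_ivl slope)
  finally have "N (\<Phi> d) \<le> d * c"
    using \<open>d > 0\<close> by (simp add: \<Phi>_def)
  then show ?thesis
    using \<open>d > 0\<close> by (simp add: semigroup_mean_apply[OF S] equivalent_norm_scaleR[OF N] \<Phi>_def field_simps)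
qed

section \<open>Commutator bounds along an orbit\<close>

text \<open>The intended curve is \<open>y r = e\<^sup>r\<^sup>A x\<close>, with \<open>z = C y\<close>, \<open>v = C y'\<close>, \<open>q = A z\<close> and \<open>w = C z\<close>; then
\<open>q r - v r\<close> is the commutator of \<open>A\<close> and \<open>C\<close> at \<open>y r\<close>. Formally \<open>z' = v = A z - (q - v)\<close>, so \<open>z\<close> should follow
the semigroup of \<open>A\<close> up to an error bounded by \<open>c\<close> per unit of time. The aim is to prove this although
\<open>q\<close> and \<open>v\<close> are merely functions without any bound or regularity.\<close>

locale commutator_orbit =
  fixes SA SC :: "real \<Rightarrow> 'a::banach \<Rightarrow>\<^sub>L 'a" and N :: "'a \<Rightarrow> real"
    and y y' z v w q :: "real \<Rightarrow> 'a" and \<omega> \<tau> c c3 :: real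
  assumes SA: "C0_semigroup SA" and SC: "C0_semigroup SC" and N: "equivalent_norm N"
    and quasi: "\<And>t x. t \<ge> 0 \<Longrightarrow> N (SA t x) \<le> exp (\<omega> * t) * N x" and \<omega>: "\<omega> \<ge> 0"
    and y: "\<And>r. r \<in> {0..\<tau>} \<Longrightarrow> (y has_vector_derivative y' r) (at r within {0..\<tau>})"
    and y': "continuous_on {0..\<tau>} y'"
    and z: "\<And>r. r \<in> {0..\<tau>} \<Longrightarrow> generator SC (y r) = Some (z r)"
    and v: "\<And>r. r \<in> {0..\<tau>} \<Longrightarrow> generator SC (y' r) = Some (v r)"
    and w: "\<And>r. r \<in> {0..\<tau>} \<Longrightarrow> generator SC (z r) = Some (w r)"
    and w_bound: "\<And>r. r \<in> {0..\<tau>} \<Longrightarrow> norm (w r) \<le> c3"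
    and q: "\<And>r. r \<in> {0..\<tau>} \<Longrightarrow> generator SA (z r) = Some (q r)"
    and commutator: "\<And>r. r \<in> {0..\<tau>} \<Longrightarrow> N (q r - v r) \<le> c"
begin

abbreviation mean_C :: "nat \<Rightarrow> 'a \<Rightarrow>\<^sub>L 'a"
  where "mean_C k \<equiv> semigroup_mean SC (inverse (real (Suc k)))"

abbreviation quotient_C :: "nat \<Rightarrow> 'a \<Rightarrow>\<^sub>L 'a"
  where "quotient_C k \<equiv> semigroup_quotient SC (inverse (real (Suc k)))"

definition defect :: "real \<Rightarrow> real \<Rightarrow> 'a"
  where "defect a b = z b - SA (b - a) (z a)"

text \<open>The exponential weight makes the estimate transitive under concatenation of intervals when the
semigroup of \<open>A\<close> grows like \<open>exp (\<omega> t)\<close>.\<close>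

definition small_defect :: "real \<Rightarrow> real \<Rightarrow> bool"
  where "small_defect a b \<longleftrightarrow> N (defect a b) \<le> c * (b - a) * exp (\<omega> * (b - a))"

lemma inverse_Suc_at_right: "filterlim (\<lambda>k. inverse (real (Suc k))) (at_right 0) sequentially"
  unfolding filterlim_at using LIMSEQ_inverse_real_of_nat by (auto simp: always_eventually)

lemma mean_C_bound: "\<exists>M>0. \<forall>k. norm (mean_C k) \<le> M"
proof -
  obtain M where M: "M > 0" "\<forall>t\<in>{0..1}. norm (SC t) \<le> M"
    using C0_semigroup_locally_bounded[OF SC] by blast
  have "norm (mean_C k) \<le> M" for k
  proof (rule norm_semigroup_mean_le[OF SC])
    fix s assume s: "s \<in> {0..inverse (real (Suc k))}"
    have "inverse (real (Suc k)) \<le> 1" by (simp add: field_simps)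
    then show "norm (SC s) \<le> M" using M(2) s by auto
  qed simp
  with M show ?thesis by blast
qed

lemma mean_C_tendsto: "(\<lambda>k. mean_C k x) \<longlonglongrightarrow> x"
  using filterlim_compose[OF semigroup_mean_tendsto[OF SC] inverse_Suc_at_right] .

lemma quotient_C_eq: "generator SC x = Some u \<Longrightarrow> quotient_C k x = mean_C k u"
  using semigroup_mean_generator[OF SC, of "inverse (real (Suc k))" x u] by simp

text \<open>The bound on \<open>w = C (C y)\<close> turns the pointwise convergence of the continuous functions \<open>quotient_C k (y r)\<close>
to \<open>z r\<close> into uniform convergence. Continuity of \<open>z\<close> is what makes the sets in the Baire argument closed.\<close>

lemma z_continuous: "continuous_on {0..\<tau>} z"
proof (rule uniform_limit_theorem)
  obtain M where M: "\<forall>t\<in>{0..1}. norm (SC t) \<le> M"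
    using C0_semigroup_locally_bounded[OF SC] by blast
  have est: "norm (quotient_C k (y r) - z r) \<le> M * c3 * inverse (real (Suc k))" if r: "r \<in> {0..\<tau>}" for k r
  proof -
    have M': "norm (SC s) \<le> M" if s: "s \<in> {0..inverse (real (Suc k))}" for s
    proof -
      have "inverse (real (Suc k)) \<le> 1" by (simp add: field_simps)
      then show ?thesis using M s by auto
    qed
    have "M \<ge> 0" using M norm_ge_zero[of "SC 0"] by (meson atLeastAtMost_iff order_refl order_trans zero_le_one)
    then have "M * norm (w r) * inverse (real (Suc k)) \<le> M * c3 * inverse (real (Suc k))"
      using w_bound[OF r] by (intro mult_right_mono mult_left_mono) auto
    then show ?thesis
      using semigroup_mean_error[OF SC _ w[OF r] M', of "inverse (real (Suc k))"] quotient_C_eq[OF z[OF r]] by simp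
  qed
  show "uniform_limit {0..\<tau>} (\<lambda>k r. quotient_C k (y r)) z sequentially"
  proof (rule uniform_limitI)
    fix e :: real assume "e > 0"
    have "(\<lambda>k. M * c3 * inverse (real (Suc k))) \<longlonglongrightarrow> M * c3 * 0"
      by (intro tendsto_intros LIMSEQ_inverse_real_of_nat)
    then have "eventually (\<lambda>k. M * c3 * inverse (real (Suc k)) < e) sequentially"
      using \<open>e > 0\<close> by (intro order_tendstoD) auto
    then show "eventually (\<lambda>k. \<forall>r\<in>{0..\<tau>}. dist (quotient_C k (y r)) (z r) < e) sequentially"
      by eventually_elim (auto simp: dist_norm simp del: of_nat_Suc intro: le_less_trans[OF est])
  qed
  have "continuous_on {0..\<tau>} y"
    using y by (meson continuous_on_eq_continuous_within has_vector_derivative_continuous)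
  then show "eventually (\<lambda>k. continuous_on {0..\<tau>} (\<lambda>r. quotient_C k (y r))) sequentially"
    by (intro always_eventually allI blinfun.continuous_on continuous_on_const)
qed simp

lemma small_defect_refl: "small_defect a a"
  using equivalent_norm_eq_0[OF N, of 0] C0_semigroup_0[OF SA] by (simp add: small_defect_def defect_def)

lemma c_nonneg: "r \<in> {0..\<tau>} \<Longrightarrow> c \<ge> 0"
  using commutator equivalent_norm_nonneg[OF N] order_trans by blast

lemma small_defect_trans:
  assumes r: "a \<in> {0..\<tau>}" and ab: "a \<le> b" "b \<le> d" and small_defect: "small_defect a b" "small_defect b d"
  shows "small_defect a d"
proof -
  have "SA (d - b) (SA (b - a) x) = SA (d - a) x" for x
    using C0_semigroup_add[OF SA, of "d - b" "b - a" x] ab by simp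
  then have "defect a d = defect b d + SA (d - b) (defect a b)"
    by (simp add: defect_def blinfun.diff_right)
  then have "N (defect a d) \<le> N (defect b d) + N (SA (d - b) (defect a b))"
    using equivalent_norm_add[OF N] by simp
  also have "\<dots> \<le> c * (d - b) * exp (\<omega> * (d - b)) + exp (\<omega> * (d - b)) * (c * (b - a) * exp (\<omega> * (b - a)))"
    using small_defect ab quasi[of "d - b" "defect a b"]
    by (intro add_mono order_trans[OF quasi] mult_left_mono) (auto simp: small_defect_def)
  also have "\<dots> = c * (d - b) * exp (\<omega> * (d - b)) + c * (b - a) * exp (\<omega> * (d - a))"
    by (simp add: exp_add[symmetric] algebra_simps)
  also have "\<dots> \<le> c * (d - b) * exp (\<omega> * (d - a)) + c * (b - a) * exp (\<omega> * (d - a))"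
    using c_nonneg[OF r] ab \<omega> by (intro add_right_mono mult_left_mono) (auto intro: mult_left_mono)
  finally show ?thesis by (simp add: small_defect_def algebra_simps)
qed

text \<open>Needed at the ends of gaps, where no neighbourhood is under control.\<close>

lemma small_defect_limit:
  assumes ab: "0 \<le> a" "a < b" "b \<le> \<tau>"
    and inner: "\<And>a' b'. a < a' \<Longrightarrow> a' \<le> b' \<Longrightarrow> b' < b \<Longrightarrow> small_defect a' b'"
  shows "small_defect a b"
proof -
  have z_lim: "((\<lambda>h. z (g h)) \<longlongrightarrow> z r) (at_right 0)"
    if "r \<in> {0..\<tau>}" "(g \<longlongrightarrow> r) (at_right 0)" "eventually (\<lambda>h. g h \<in> {0..\<tau>}) (at_right (0::real))" for g r
    using z_continuous that
    by (intro continuous_within_tendsto_compose[where f=z and S="{0..\<tau>}"])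
      (auto simp: continuous_on_eq_continuous_within)
  have ev: "eventually (\<lambda>h. a < a + h \<and> a + h \<le> b - h \<and> b - h < b) (at_right (0::real))"
    using ab by (auto simp: eventually_at_right_field intro!: exI[of _ "(b - a) / 2"])
  have lim_a: "((\<lambda>h. a + h) \<longlongrightarrow> a) (at_right (0::real))" and lim_b: "((\<lambda>h. b - h) \<longlongrightarrow> b) (at_right (0::real))"
    by (auto intro!: tendsto_eq_intros)
  have "((\<lambda>h. defect (a + h) (b - h)) \<longlongrightarrow> defect a b) (at_right 0)"
    unfolding defect_def
  proof (intro tendsto_diff z_lim lim_b C0_semigroup_tendsto[OF SA] lim_a)
    show "eventually (\<lambda>h. b - h \<in> {0..\<tau>}) (at_right 0)" "eventually (\<lambda>h. a + h \<in> {0..\<tau>}) (at_right 0)"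
      "eventually (\<lambda>h. 0 \<le> b - h - (a + h)) (at_right 0)"
      using ev ab by (auto elim!: eventually_mono)
  qed (use ab in auto)
  then have "((\<lambda>h. N (defect (a + h) (b - h))) \<longlongrightarrow> N (defect a b)) (at_right 0)"
    by (rule equivalent_norm_tendsto[OF N])
  moreover have "((\<lambda>h. c * ((b - h) - (a + h)) * exp (\<omega> * ((b - h) - (a + h)))) \<longlongrightarrow>
      c * (b - a) * exp (\<omega> * (b - a))) (at_right 0)"
    by (intro tendsto_intros lim_a lim_b)
  moreover have "eventually (\<lambda>h. N (defect (a + h) (b - h)) \<le>
      c * ((b - h) - (a + h)) * exp (\<omega> * ((b - h) - (a + h)))) (at_right 0)"
    using ev by eventually_elim (rule inner[unfolded small_defect_def], auto)
  ultimately show ?thesis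
    unfolding small_defect_def using tendsto_le[OF trivial_limit_at_right_real] by blast
qed

text \<open>The set \<open>E\<close> collects the times at which \<open>q = A z\<close> is bounded by \<open>n\<close>; between them only the desired estimate on
whole gaps is known. The curve \<open>r \<mapsto> SA (b - r) (z r)\<close>, whose total increment is the defect, is approximated by
the continuously differentiable curves \<open>f k\<close>, in which \<open>z = C y\<close> is replaced by \<open>quotient_C k (y r)\<close> and an average \<open>J\<close> of
the semigroup of \<open>A\<close> is inserted, so that \<open>A J\<close> is bounded. As \<open>k\<close> grows, the derivative of \<open>f k\<close> converges
at each point of \<open>E\<close> to minus the averaged commutator, and the increments of \<open>f k\<close> over each gap converge to
the averaged defect, both carried on to time \<open>b\<close>. All of these are bounded independently of \<open>k\<close>: on \<open>E\<close> because \<open>q\<close> and hence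
\<open>v\<close> are bounded there, and on a gap because \<open>z\<close> changes by the defect of the gap plus
\<open>SA l (z s) - z s\<close>, where \<open>l\<close> is its length and its left end \<open>s\<close> lies in \<open>E\<close> (\<open>defect_bound\<close>). Dominated convergence for the gap
slopes gives the estimate without loss in the constant, so that it can be fed back into itself; the
average is removed at the end.\<close>

lemma small_defect_across_closed_set:
  assumes ab: "0 \<le> a" "a < b" "b \<le> \<tau>"
    and E: "closed E" "E \<subseteq> {a..b}" "a \<in> E" "b \<in> E"
    and q_bound: "\<And>r. r \<in> E \<Longrightarrow> norm (q r) \<le> n"
    and gaps: "\<And>s t. s \<in> E \<Longrightarrow> t \<in> E \<Longrightarrow> s < t \<Longrightarrow> {s<..<t} \<inter> E = {} \<Longrightarrow> small_defect s t"
  shows "small_defect a b"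
proof -
  have sub: "{a..b} \<subseteq> {0..\<tau>}" using ab by auto
  then have E\<tau>: "r \<in> {0..\<tau>}" if "r \<in> E" for r using that E by auto
  have "c \<ge> 0" using c_nonneg[of a] ab by auto
  obtain MA where MA: "MA > 0" "\<forall>t\<in>{0..\<tau> + 1}. norm (SA t) \<le> MA"
    using C0_semigroup_locally_bounded[OF SA] by blast
  have SA_bound: "norm (SA t x) \<le> MA * norm x" if "t \<in> {0..\<tau>}" for t x
  proof -
    have "norm (SA t) \<le> MA" using MA that by auto
    then show ?thesis by (meson mult_right_mono norm_blinfun norm_ge_zero order_trans)
  qed
  obtain MP where MP: "MP > 0" "\<And>k. norm (mean_C k) \<le> MP" using mean_C_bound by blast
  have mean_C_bound': "norm (mean_C k x) \<le> MP * norm x" for k x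
    using MP(2) by (meson mult_right_mono norm_blinfun norm_ge_zero order_trans)
  obtain NL NU where NL: "NL > 0" "\<And>x. NL * norm x \<le> N x" and NU: "NU > 0" "\<And>x. N x \<le> NU * norm x"
    using equivalent_norm_bounds[OF N] by metis
  obtain Z where "\<forall>r\<in>{0..\<tau>}. norm (z r) \<le> Z"
    using compact_imp_bounded[OF compact_continuous_image[OF z_continuous compact_Icc]]
    by (auto simp: bounded_iff)
  then have Z: "norm (z r) \<le> Z" if "r \<in> {0..\<tau>}" for r
    using that by blast
  have "Z \<ge> 0" using Z[of a] ab norm_ge_zero order_trans by (metis atLeastAtMost_iff less_imp_le)
  have "n \<ge> 0" using q_bound[OF E(3)] norm_ge_zero order_trans by blast
  have v_bound: "norm (v r) \<le> n + c / NL" if "r \<in> E" for r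
  proof -
    have "NL * norm (q r - v r) \<le> c" using NL(2) commutator[OF E\<tau>[OF that]] order_trans by blast
    then have "norm (q r - v r) \<le> c / NL" using NL by (simp add: field_simps)
    then show ?thesis
      using q_bound[OF that] norm_triangle_ineq3[of "v r" "q r"] by (simp add: norm_minus_commute)
  qed
  have defect_bound: "norm (z t - z s) \<le> (c * exp (\<omega> * \<tau>) / NL + MA * n) * (t - s)"
    if st: "s \<in> E" "t \<in> E" "s < t" "{s<..<t} \<inter> E = {}" for s t
  proof -
    have st': "0 \<le> s" "t \<le> \<tau>" using E\<tau>[OF st(1)] E\<tau>[OF st(2)] by auto
    have "NL * norm (defect s t) \<le> c * (t - s) * exp (\<omega> * (t - s))"
      using NL(2) gaps[OF st] order_trans unfolding small_defect_def by blast
    also have "\<dots> \<le> c * (t - s) * exp (\<omega> * \<tau>)"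
      using \<open>c \<ge> 0\<close> st st' \<omega> by (intro mult_left_mono) (auto intro: mult_left_mono)
    finally have "norm (defect s t) \<le> c * exp (\<omega> * \<tau>) / NL * (t - s)"
      using NL by (simp add: field_simps)
    moreover have "norm (SA (t - s) (z s) - z s) \<le> MA * norm (q s) * (t - s)"
      using st st' MA by (intro orbit_lipschitz[OF SA q[OF E\<tau>[OF st(1)]]]) auto
    moreover have "MA * norm (q s) * (t - s) \<le> MA * n * (t - s)"
      using q_bound[OF st(1)] MA st by (intro mult_right_mono mult_left_mono) auto
    moreover have "norm (z t - z s) \<le> norm (defect s t) + norm (SA (t - s) (z s) - z s)"
      using norm_triangle_ineq[of "defect s t" "SA (t - s) (z s) - z s"] by (simp add: defect_def)
    ultimately show ?thesis
      unfolding distrib_right by linarith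
  qed
  have step: "N (semigroup_mean SA d (defect a b)) \<le> exp (\<omega> * d) * (c * (b - a) * exp (\<omega> * (b - a)))"
    if d: "0 < d" "d < 1" for d
  proof -
    define J where "J = semigroup_mean SA d"
    define Q where "Q = semigroup_quotient SA d"
    have gen_J: "generator SA (J x) = Some (Q x)" for x
      unfolding J_def Q_def by (rule generator_semigroup_mean[OF SA d(1)])
    have J_q: "J (q r) = Q (z r)" if "r \<in> {0..\<tau>}" for r
      unfolding J_def Q_def by (rule semigroup_mean_generator[OF SA d(1) q[OF that]])
    have N_J: "N (J x) \<le> exp (\<omega> * d) * N x" for x
      unfolding J_def
    proof (rule mean_le_sup_equivalent_norm[OF SA N d(1)])
      fix s assume "s \<in> {0..d}"
      then have "N (SA s x) \<le> exp (\<omega> * s) * N x" "exp (\<omega> * s) \<le> exp (\<omega> * d)"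
        using quasi[of s x] \<omega> by (auto intro: mult_left_mono)
      then show "N (SA s x) \<le> exp (\<omega> * d) * N x"
        using equivalent_norm_nonneg[OF N, of x] by (meson mult_right_mono order_trans)
    qed
    \<comment> \<open>Since \<open>quotient_C k\<close> is bounded, \<open>f k\<close> is differentiable whatever the regularity of \<open>v\<close>.\<close>
    define f where "f k r = SA (b - r) (J (quotient_C k (y r)))" for k r
    define f' where "f' k r = SA (b - r) (J (quotient_C k (y' r)) - Q (quotient_C k (y r)))" for k r
    have deriv: "(f k has_vector_derivative f' k r) (at r within {a..b})" if r: "r \<in> {a..b}" for k r
    proof -
      have "(y has_vector_derivative y' r) (at r within {a..b})"
        using r sub by (intro has_vector_derivative_within_subset[OF y]) auto
      then have "((\<lambda>s. J (quotient_C k (y s))) has_vector_derivative J (quotient_C k (y' r))) (at r within {a..b})"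
        by (intro bounded_linear.has_vector_derivative[OF blinfun.bounded_linear_right])
      then show ?thesis
        unfolding f_def f'_def using r by (intro duhamel_derivative[OF SA] gen_J) auto
    qed
    have conty: "continuous_on {a..b} y"
      using y sub by (meson continuous_on_eq_continuous_within continuous_on_subset has_vector_derivative_continuous)
    have conty': "continuous_on {a..b} y'"
      using y' sub by (rule continuous_on_subset)
    have contf': "continuous_on {a..b} (f' k)" for k
      unfolding f'_def
      by (intro C0_semigroup_continuous_on[OF SA] continuous_intros conty conty') auto
    have contf: "continuous_on {a..b} (f k)" for k
      using deriv by (meson continuous_on_eq_continuous_within has_vector_derivative_continuous)
    have on_E: "f k r = SA (b - r) (J (mean_C k (z r)))"
      "f' k r = SA (b - r) (J (mean_C k (v r)) - Q (mean_C k (z r)))" if "r \<in> E" for k r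
      using quotient_C_eq[OF z[OF E\<tau>[OF that]]] quotient_C_eq[OF v[OF E\<tau>[OF that]]] by (auto simp: f_def f'_def)
    have b_minus: "b - r \<in> {0..\<tau>}" if "r \<in> {a..b}" for r using that ab by auto
    \<comment> \<open>The first entry dominates the slopes at points of \<open>E\<close>, the second those of the gaps; neither
      involves \<open>k\<close>.\<close>
    define K where "K = max (NU * (MA * (norm J * (MP * (n + c / NL)) + norm Q * (MP * Z))))
      (NU * (MA * (norm J * (MP * (c * exp (\<omega> * \<tau>) / NL + MA * n)) + MA * (norm Q * (MP * Z)))))"
    have bound: "gap_slope N (f k) (f' k) E r \<le> K" if r: "r \<in> {a..b}" for k r
    proof (cases "r \<in> E")
      case True
      have "norm (J (mean_C k (v r))) \<le> norm J * (MP * (n + c / NL))"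
        using MP v_bound[OF True] \<open>n \<ge> 0\<close>
        by (intro order_trans[OF norm_blinfun] mult_left_mono order_trans[OF mean_C_bound']) auto
      moreover have "norm (Q (mean_C k (z r))) \<le> norm Q * (MP * Z)"
        using MP Z[OF E\<tau>[OF True]]
        by (intro order_trans[OF norm_blinfun] mult_left_mono order_trans[OF mean_C_bound']) auto
      ultimately have "norm (f' k r) \<le> MA * (norm J * (MP * (n + c / NL)) + norm Q * (MP * Z))"
        unfolding on_E[OF True] using MA
        by (intro order_trans[OF SA_bound[OF b_minus[OF r]]] mult_left_mono order_trans[OF norm_triangle_ineq4] add_mono) auto
      then have "N (f' k r) \<le> NU * (MA * (norm J * (MP * (n + c / NL)) + norm Q * (MP * Z)))"
        using NU by (intro order_trans[OF NU(2)] mult_left_mono) auto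
      then show ?thesis using True by (simp add: gap_slope_def K_def)
    next
      case False
      define s t where "s = left_end E r" and "t = right_end E r"
      have st: "a \<le> s" "s < t" "t \<le> b" "{s<..<t} \<inter> E = {}"
        using gap_ends[OF E(1,3,4) _ _ False] r by (auto simp: s_def t_def)
      have mem: "s \<in> E" "t \<in> E"
        using left_end(1)[OF E(1,3)] right_end(1)[OF E(1,4)] r by (auto simp: s_def t_def)
      have "SA (b - s) x = SA (b - t) (SA (t - s) x)" for x
        using C0_semigroup_add[OF SA, of "b - t" "t - s" x] st by simp
      then have eq: "f k t - f k s = SA (b - t) (J (mean_C k (z t - z s)) - (SA (t - s) (J (mean_C k (z s))) - J (mean_C k (z s))))"
        by (simp add: on_E mem blinfun.diff_right)
      have "norm (J (mean_C k (z t - z s))) \<le> norm J * (MP * ((c * exp (\<omega> * \<tau>) / NL + MA * n) * (t - s)))"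
        using MP defect_bound[OF mem st(2,4)]
        by (intro order_trans[OF norm_blinfun] mult_left_mono order_trans[OF mean_C_bound']) auto
      moreover have "norm (SA (t - s) (J (mean_C k (z s))) - J (mean_C k (z s))) \<le> MA * norm (Q (mean_C k (z s))) * (t - s)"
        using st ab MA by (intro orbit_lipschitz[OF SA gen_J]) auto
      moreover have "MA * norm (Q (mean_C k (z s))) * (t - s) \<le> MA * (norm Q * (MP * Z)) * (t - s)"
        using MP MA st Z[OF E\<tau>[OF mem(1)]]
        by (intro mult_right_mono mult_left_mono order_trans[OF norm_blinfun] order_trans[OF mean_C_bound']) auto
      ultimately have "norm (J (mean_C k (z t - z s)) - (SA (t - s) (J (mean_C k (z s))) - J (mean_C k (z s))))
        \<le> norm J * (MP * ((c * exp (\<omega> * \<tau>) / NL + MA * n) * (t - s))) + MA * (norm Q * (MP * Z)) * (t - s)"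
        using norm_triangle_ineq4[of "J (mean_C k (z t - z s))" "SA (t - s) (J (mean_C k (z s))) - J (mean_C k (z s))"]
        by linarith
      then have "norm (f k t - f k s) \<le> MA * (norm J * (MP * ((c * exp (\<omega> * \<tau>) / NL + MA * n) * (t - s)))
          + MA * (norm Q * (MP * Z)) * (t - s))"
        unfolding eq using MA b_minus[of t] st
        by (intro order_trans[OF SA_bound mult_left_mono]) auto
      then have "N (f k t - f k s) \<le> NU * (MA * (norm J * (MP * ((c * exp (\<omega> * \<tau>) / NL + MA * n) * (t - s)))
          + MA * (norm Q * (MP * Z)) * (t - s)))"
        using NU by (intro order_trans[OF NU(2)] mult_left_mono) auto
      also have "\<dots> = NU * (MA * (norm J * (MP * (c * exp (\<omega> * \<tau>) / NL + MA * n)) + MA * (norm Q * (MP * Z)))) * (t - s)"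
        by (simp add: algebra_simps)
      also have "\<dots> \<le> K * (t - s)"
        using st by (intro mult_right_mono) (auto simp: K_def)
      finally show ?thesis
        using False st by (simp add: gap_slope_def s_def[symmetric] t_def[symmetric] pos_divide_le_eq)
    qed
    \<comment> \<open>The limit of the gap slopes, which are formed with \<open>z\<close> and \<open>v\<close> in place of their approximations.\<close>
    define g where "g r = gap_slope N (\<lambda>r. SA (b - r) (J (z r))) (\<lambda>r. SA (b - r) (J (v r) - Q (z r))) E r" for r
    have f_lim: "(\<lambda>k. f k r) \<longlonglongrightarrow> SA (b - r) (J (z r))" if "r \<in> E" for r
      unfolding on_E[OF that] by (intro tendsto_intros mean_C_tendsto)
    have h_lim: "(\<lambda>k. gap_slope N (f k) (f' k) E r) \<longlonglongrightarrow> g r" if r: "r \<in> {a..b}" for r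
    proof (cases "r \<in> E")
      case True
      have "(\<lambda>k. f' k r) \<longlonglongrightarrow> SA (b - r) (J (v r) - Q (z r))"
        unfolding on_E[OF True] by (intro tendsto_intros mean_C_tendsto)
      then show ?thesis
        using True by (simp add: g_def gap_slope_def equivalent_norm_tendsto[OF N])
    next
      case False
      have "left_end E r \<in> E" "right_end E r \<in> E" "left_end E r < right_end E r"
        using left_end(1)[OF E(1,3)] right_end(1)[OF E(1,4)] gap_ends[OF E(1,3,4) _ _ False] r by auto
      then show ?thesis
        using False unfolding g_def gap_slope_def
        by (simp, intro tendsto_intros equivalent_norm_tendsto[OF N] f_lim) auto
    qed
    have g_le: "g r \<le> exp (\<omega> * d) * (c * exp (\<omega> * (b - a)))" if r: "r \<in> {a..b}" for r
    proof (cases "r \<in> E")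
      case True
      have "J (v r) - Q (z r) = - J (q r - v r)"
        using J_q[OF E\<tau>[OF True]] by (simp add: blinfun.diff_right)
      then have "g r = N (SA (b - r) (J (q r - v r)))"
        using True by (simp add: g_def gap_slope_def blinfun.minus_right equivalent_norm_minus[OF N])
      also have "\<dots> \<le> exp (\<omega> * (b - r)) * (exp (\<omega> * d) * c)"
        using r commutator[OF E\<tau>[OF True]]
        by (intro order_trans[OF quasi] mult_left_mono order_trans[OF N_J]) auto
      also have "\<dots> \<le> exp (\<omega> * (b - a)) * (exp (\<omega> * d) * c)"
        using r \<open>c \<ge> 0\<close> \<omega> by (intro mult_right_mono) (auto intro: mult_left_mono)
      finally show ?thesis by (simp add: mult_ac)
    next
      case False
      define s t where "s = left_end E r" and "t = right_end E r"
      have st: "a \<le> s" "s < t" "t \<le> b" "{s<..<t} \<inter> E = {}"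
        using gap_ends[OF E(1,3,4) _ _ False] r by (auto simp: s_def t_def)
      have mem: "s \<in> E" "t \<in> E"
        using left_end(1)[OF E(1,3)] right_end(1)[OF E(1,4)] r by (auto simp: s_def t_def)
      have "SA (b - s) x = SA (b - t) (SA (t - s) x)" for x
        using C0_semigroup_add[OF SA, of "b - t" "t - s" x] st by simp
      moreover have "SA (t - s) (J (z s)) = J (SA (t - s) (z s))"
        unfolding J_def using st d by (simp add: semigroup_mean_commute[OF SA])
      ultimately have "N (SA (b - t) (J (z t)) - SA (b - s) (J (z s))) = N (SA (b - t) (J (defect s t)))"
        by (simp add: blinfun.diff_right defect_def)
      also have "\<dots> \<le> exp (\<omega> * (b - t)) * (exp (\<omega> * d) * (c * (t - s) * exp (\<omega> * (t - s))))"
        using st gaps[OF mem st(2,4)]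
        by (intro order_trans[OF quasi] mult_left_mono order_trans[OF N_J]) (auto simp: small_defect_def)
      also have "\<dots> = exp (\<omega> * d) * (c * exp (\<omega> * (b - s))) * (t - s)"
        by (simp add: exp_add[symmetric] algebra_simps)
      also have "\<dots> \<le> exp (\<omega> * d) * (c * exp (\<omega> * (b - a))) * (t - s)"
        using st \<open>c \<ge> 0\<close> \<omega> by (intro mult_right_mono mult_left_mono) (auto intro: mult_left_mono)
      finally show ?thesis
        using False st by (simp add: g_def gap_slope_def s_def[symmetric] t_def[symmetric] pos_divide_le_eq)
    qed
    have int: "gap_slope N (f k) (f' k) E integrable_on {a..b}" for k
      using bound by (intro gap_slope_integrable[OF N E(1,3,4) contf contf'])
    have nonneg: "0 \<le> gap_slope N (f k) (f' k) E r" if "r \<in> {a..b}" for k r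
    proof (cases "r \<in> E")
      case False
      then show ?thesis
        using gap_ends[OF E(1,3,4) _ _ False] that
        by (auto simp: gap_slope_def equivalent_norm_nonneg[OF N] intro!: divide_nonneg_nonneg)
    qed (simp add: gap_slope_def equivalent_norm_nonneg[OF N])
    have dom: "g integrable_on {a..b}"
      "(\<lambda>k. integral {a..b} (gap_slope N (f k) (f' k) E)) \<longlonglongrightarrow> integral {a..b} g"
      using dominated_convergence[where f="\<lambda>k. gap_slope N (f k) (f' k) E" and S="{a..b}" and h="\<lambda>_. K" and g=g]
        int bound nonneg h_lim integrable_const_ivl by auto
    have "(\<lambda>k. f k b - f k a) \<longlonglongrightarrow> SA (b - b) (J (z b)) - SA (b - a) (J (z a))"
      by (intro tendsto_diff f_lim E)
    moreover have "SA (b - a) (J (z a)) = J (SA (b - a) (z a))"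
      unfolding J_def using ab d by (simp add: semigroup_mean_commute[OF SA])
    ultimately have "(\<lambda>k. f k b - f k a) \<longlonglongrightarrow> J (defect a b)"
      by (simp add: defect_def blinfun.diff_right C0_semigroup_0[OF SA])
    then have "(\<lambda>k. N (f k b - f k a)) \<longlonglongrightarrow> N (J (defect a b))"
      by (rule equivalent_norm_tendsto[OF N])
    moreover have "N (f k b - f k a) \<le> integral {a..b} (gap_slope N (f k) (f' k) E)" for k
      by (rule increment_le_integral_gap_slope[OF N E deriv contf' int])
    ultimately have "N (J (defect a b)) \<le> integral {a..b} g"
      using dom(2) by (intro LIMSEQ_le) auto
    also have "\<dots> \<le> integral {a..b} (\<lambda>_. exp (\<omega> * d) * (c * exp (\<omega> * (b - a))))"
      by (intro integral_le dom(1) integrable_const_ivl g_le)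
    also have "\<dots> = exp (\<omega> * d) * (c * (b - a) * exp (\<omega> * (b - a)))"
      using ab by (simp add: mult_ac)
    finally show ?thesis by (simp add: J_def)
  qed
  \<comment> \<open>Letting \<open>d\<close> tend to zero removes the average.\<close>
  have "((\<lambda>d. N (semigroup_mean SA d (defect a b))) \<longlongrightarrow> N (defect a b)) (at_right 0)"
    by (intro equivalent_norm_tendsto[OF N] semigroup_mean_tendsto[OF SA])
  moreover have "((\<lambda>d. exp (\<omega> * d) * (c * (b - a) * exp (\<omega> * (b - a)))) \<longlongrightarrow>
      exp (\<omega> * 0) * (c * (b - a) * exp (\<omega> * (b - a)))) (at_right 0)"
    by (intro tendsto_intros)
  moreover have "eventually (\<lambda>d. N (semigroup_mean SA d (defect a b)) \<le>
      exp (\<omega> * d) * (c * (b - a) * exp (\<omega> * (b - a)))) (at_right 0)"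
    using step by (auto simp: eventually_at_right_field intro!: exI[of _ 1])
  ultimately have "N (defect a b) \<le> exp (\<omega> * 0) * (c * (b - a) * exp (\<omega> * (b - a)))"
    using tendsto_le[OF trivial_limit_at_right_real] by blast
  then show ?thesis by (simp add: small_defect_def)
qed

definition locally_small_defect :: "real \<Rightarrow> bool"
  where "locally_small_defect r \<longleftrightarrow> (\<exists>\<rho>>0. \<forall>a\<in>{0..\<tau>}. \<forall>b\<in>{0..\<tau>}.
    a \<le> b \<and> \<bar>a - r\<bar> < \<rho> \<and> \<bar>b - r\<bar> < \<rho> \<longrightarrow> small_defect a b)"

lemma small_defect_if_locally:
  assumes ab: "0 \<le> a" "a < b" "b \<le> \<tau>" and loc: "\<And>r. a < r \<Longrightarrow> r < b \<Longrightarrow> locally_small_defect r"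
  shows "small_defect a b"
proof (rule small_defect_limit[OF ab])
  fix a' b' assume ab': "a < a'" "a' \<le> b'" "b' < b"
  have "a' \<le> a' \<and> b' \<le> b' \<longrightarrow> small_defect a' b'"
  proof (rule Bolzano[where P="\<lambda>s t. a' \<le> s \<and> t \<le> b' \<longrightarrow> small_defect s t", OF ab'(2)])
    fix r s t assume "a' \<le> r \<and> s \<le> b' \<longrightarrow> small_defect r s" "a' \<le> s \<and> t \<le> b' \<longrightarrow> small_defect s t" "r \<le> s" "s \<le> t"
    then show "a' \<le> r \<and> t \<le> b' \<longrightarrow> small_defect r t"
      using small_defect_trans[of r s t] ab ab' by auto
  next
    fix x assume x: "a' \<le> x" "x \<le> b'"
    then obtain \<rho> where \<rho>: "\<rho> > 0" "\<forall>a\<in>{0..\<tau>}. \<forall>b\<in>{0..\<tau>}. a \<le> b \<and> \<bar>a - x\<bar> < \<rho> \<and> \<bar>b - x\<bar> < \<rho> \<longrightarrow> small_defect a b"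
      using loc[of x] ab' unfolding locally_small_defect_def by auto
    show "\<exists>d>0. \<forall>s t. s \<le> x \<and> x \<le> t \<and> t - s < d \<longrightarrow> a' \<le> s \<and> t \<le> b' \<longrightarrow> small_defect s t"
      using \<rho> ab ab' x by (intro exI[of _ \<rho>]) auto
  qed
  then show "small_defect a' b'" by simp
qed

text \<open>Let \<open>S\<close> be the closed set of times near which the estimate fails. For each time in \<open>S\<close> the quotients
\<open>(SA d - 1) / d\<close> applied to \<open>z\<close> converge, hence are bounded for the sequence \<open>d = 1, 1/2, 1/3, \<dots>\<close>; by Baire's
theorem they have a common bound on a relatively open part of \<open>S\<close>, which bounds \<open>q\<close> there. An interval
around a point of this part meets \<open>S\<close> in a set across which the estimate extends, so the point does not
belong to \<open>S\<close>.\<close>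

theorem defect_small:
  assumes ab: "0 \<le> a" "a \<le> b" "b \<le> \<tau>"
  shows "small_defect a b"
proof -
  define S where "S = {r \<in> {0..\<tau>}. \<not> locally_small_defect r}"
  have "S = {}"
  proof (rule ccontr)
    assume "S \<noteq> {}"
    have "open {r. locally_small_defect r}"
      unfolding open_dist
    proof safe
      fix r assume "locally_small_defect r"
      then obtain \<rho> where \<rho>: "\<rho> > 0" "\<forall>a\<in>{0..\<tau>}. \<forall>b\<in>{0..\<tau>}. a \<le> b \<and> \<bar>a - r\<bar> < \<rho> \<and> \<bar>b - r\<bar> < \<rho> \<longrightarrow> small_defect a b"
        unfolding locally_small_defect_def by auto
      have "locally_small_defect s" if s: "dist s r < \<rho> / 2" for s
        unfolding locally_small_defect_def
      proof (intro exI[of _ "\<rho> / 2"] conjI ballI impI)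
        fix a b assume ab: "a \<in> {0..\<tau>}" "b \<in> {0..\<tau>}" "a \<le> b \<and> \<bar>a - s\<bar> < \<rho> / 2 \<and> \<bar>b - s\<bar> < \<rho> / 2"
        then have "\<bar>a - r\<bar> < \<rho>" "\<bar>b - r\<bar> < \<rho>"
          using s unfolding dist_real_def by linarith+
        then show "small_defect a b" using \<rho>(2) ab by blast
      qed (use \<rho>(1) in simp)
      then show "\<exists>e>0. \<forall>s. dist s r < e \<longrightarrow> s \<in> {r. locally_small_defect r}"
        using \<rho>(1) by (intro exI[of _ "\<rho> / 2"]) auto
    qed
    moreover have "S = {0..\<tau>} - {r. locally_small_defect r}" by (auto simp: S_def)
    ultimately have "closed S" by (simp add: closed_Diff)
    define G where "G n = {r \<in> S. \<forall>m. norm (semigroup_quotient SA (inverse (real (Suc m))) (z r)) \<le> real n}" for n :: nat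
    have quotient_lim: "(\<lambda>m. semigroup_quotient SA (inverse (real (Suc m))) (z r)) \<longlonglongrightarrow> q r"
      if "r \<in> {0..\<tau>}" for r
      using filterlim_compose[OF q[OF that, unfolded generator_eq_Some_iff] inverse_Suc_at_right]
      by (simp add: semigroup_quotient_apply)
    have "closed (G n)" for n
    proof -
      have zS: "continuous_on S z"
        using z_continuous by (rule continuous_on_subset) (auto simp: S_def)
      have "closed {r \<in> S. norm (semigroup_quotient SA (inverse (real (Suc m))) (z r)) \<le> real n}" for m
        using \<open>closed S\<close> zS by (intro continuous_on_closed_Collect_le continuous_intros)
      then have "closed (\<Inter>m. {r \<in> S. norm (semigroup_quotient SA (inverse (real (Suc m))) (z r)) \<le> real n})"
        by blast
      moreover have "(\<Inter>m. {r \<in> S. norm (semigroup_quotient SA (inverse (real (Suc m))) (z r)) \<le> real n}) = G n"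
        by (auto simp: G_def)
      ultimately show ?thesis by simp
    qed
    then have G_closed: "closedin (top_of_set S) (G n)" for n
      by (intro closed_subset) (auto simp: G_def)
    have cover: "topspace (top_of_set S) \<subseteq> (\<Union>n. G n)"
    proof
      fix r assume "r \<in> topspace (top_of_set S)"
      then have r: "r \<in> S" by simp
      then have "r \<in> {0..\<tau>}" by (simp add: S_def)
      from convergent_imp_Bseq[OF convergentI[OF quotient_lim[OF this]]]
      obtain K where K: "\<And>m. norm (semigroup_quotient SA (inverse (real (Suc m))) (z r)) \<le> K"
        by (auto simp: Bseq_def)
      obtain n where "K \<le> real n" using real_arch_simple by blast
      then show "r \<in> (\<Union>n. G n)" using K r by (auto simp: G_def intro: order_trans)
    qed
    have "completely_metrizable_space (top_of_set S)"
      using \<open>closed S\<close> completely_metrizable_space_closedin[OF completely_metrizable_space_euclidean] by simp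
    moreover have "topspace (top_of_set S) \<noteq> {}" using \<open>S \<noteq> {}\<close> by simp
    ultimately obtain n U where U: "openin (top_of_set S) U" "U \<noteq> {}" "U \<subseteq> G n"
      using closed_cover_has_interior[of "top_of_set S" G] G_closed cover by metis
    then obtain r0 where r0: "r0 \<in> U" by blast
    with U(1) obtain \<rho> where \<rho>: "\<rho> > 0" "ball r0 \<rho> \<inter> S \<subseteq> U"
      by (auto simp: openin_contains_ball)
    have q_bound: "norm (q r) \<le> n" if "r \<in> S" "\<bar>r - r0\<bar> < \<rho>" for r
    proof (rule Lim_norm_ubound[OF sequentially_bot quotient_lim])
      show "r \<in> {0..\<tau>}" using that by (simp add: S_def)
      have "r \<in> ball r0 \<rho> \<inter> S" using that by (simp add: dist_real_def abs_minus_commute)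
      then have "r \<in> G n" using \<rho>(2) U(3) by blast
      then show "eventually (\<lambda>m. norm (semigroup_quotient SA (inverse (real (Suc m))) (z r)) \<le> real n) sequentially"
        by (simp add: G_def)
    qed
    have "locally_small_defect r0"
      unfolding locally_small_defect_def
    proof (intro exI[of _ \<rho>] conjI ballI impI \<rho>)
      fix s t assume st: "s \<in> {0..\<tau>}" "t \<in> {0..\<tau>}" and "s \<le> t \<and> \<bar>s - r0\<bar> < \<rho> \<and> \<bar>t - r0\<bar> < \<rho>"
      then have near: "s \<le> t" "\<bar>s - r0\<bar> < \<rho>" "\<bar>t - r0\<bar> < \<rho>" by auto
      show "small_defect s t"
      proof (cases "s = t")
        case True
        then show ?thesis by (simp add: small_defect_refl)
      next
        case False
        \<comment> \<open>The end points are added with their own values of \<open>q\<close>, since they may lie in gaps of \<open>S\<close>.\<close>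
        define E where "E = insert s (insert t (S \<inter> {s..t}))"
        show ?thesis
        proof (rule small_defect_across_closed_set)
          show "closed E" unfolding E_def using \<open>closed S\<close> by (intro closed_insert closed_Int) auto
          show "norm (q r) \<le> max (real n) (max (norm (q s)) (norm (q t)))" if "r \<in> E" for r
          proof (cases "r = s \<or> r = t")
            case False
            then have r: "r \<in> S" "s \<le> r" "r \<le> t" using that by (auto simp: E_def)
            then have "\<bar>r - r0\<bar> < \<rho>" using near by linarith
            then show ?thesis using q_bound[OF r(1)] by simp
          qed auto
          fix s' t' assume *: "s' \<in> E" "t' \<in> E" "s' < t'" "{s'<..<t'} \<inter> E = {}"
          show "small_defect s' t'"
          proof (rule small_defect_if_locally)
            fix r assume r: "s' < r" "r < t'"
            have "r \<notin> E" using * r by auto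
            then show "locally_small_defect r"
              using r * st near by (auto simp: E_def S_def)
          qed (use * st near in \<open>auto simp: E_def\<close>)
        qed (use st near False in \<open>auto simp: E_def\<close>)
      qed
    qed
    then show False using r0 U by (auto simp: G_def S_def)
  qed
  then have "locally_small_defect r" if "r \<in> {0..\<tau>}" for r using that by (auto simp: S_def)
  then show ?thesis
    using small_defect_if_locally[of a b] ab small_defect_refl by (cases "a = b") auto
qed

end

section \<open>Bounded perturbations of a generator\<close>

definition convolution :: "(real \<Rightarrow> ('a::banach \<Rightarrow>\<^sub>L 'a)) \<Rightarrow> (real \<Rightarrow> 'a) \<Rightarrow> real \<Rightarrow> 'a"
  where "convolution S g t = integral {0..t} (\<lambda>s. S (t - s) (g s))"

lemma convolution_integrand_continuous:
  fixes S :: "real \<Rightarrow> 'a::banach \<Rightarrow>\<^sub>L 'a"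
  assumes S: "C0_semigroup S" and g: "continuous_on {0..} g" and "a \<ge> 0" "b \<le> t"
  shows "continuous_on {a..b} (\<lambda>s. S (t - s) (g s))"
  using assms(3,4)
  by (intro C0_semigroup_continuous_on[OF S] continuous_intros continuous_on_subset[OF g]) auto

text \<open>Truncating \<open>t - s\<close> at zero extends the integrand continuously to a fixed interval \<open>[0, T]\<close>, where
integrals depend continuously on parameters; the extension contributes \<open>integral {t..T} g\<close>.\<close>

lemma convolution_continuous:
  fixes S :: "real \<Rightarrow> 'a::banach \<Rightarrow>\<^sub>L 'a"
  assumes S: "C0_semigroup S" and g: "continuous_on {0..} g"
  shows "continuous_on {0..} (convolution S g)"
proof -
  have cont: "continuous_on {0..T} (convolution S g)" for T
  proof -
    have "continuous_on ({0..T} \<times> cbox 0 T) (\<lambda>(t, s). S (max 0 (t - s)) (g s))"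
      unfolding case_prod_unfold
      by (intro C0_semigroup_continuous_on[OF S] continuous_intros continuous_on_compose2[OF g]) auto
    then have "continuous_on {0..T} (\<lambda>t. integral (cbox 0 T) (\<lambda>s. S (max 0 (t - s)) (g s)))"
      by (rule integral_continuous_on_param)
    moreover have "continuous_on {0..T} (\<lambda>t. integral {t..T} g)"
      using continuous_on_subset[OF g] by (intro indefinite_integral_continuous_1' integrable_continuous_real) auto
    ultimately have "continuous_on {0..T} (\<lambda>t. integral {0..T} (\<lambda>s. S (max 0 (t - s)) (g s)) - integral {t..T} g)"
      by (intro continuous_on_diff) auto
    then show ?thesis
    proof (rule continuous_on_eq)
      fix t assume t: "t \<in> {0..T}"
      have "continuous_on {0..T} (\<lambda>s. S (max 0 (t - s)) (g s))"
        by (intro C0_semigroup_continuous_on[OF S] continuous_intros continuous_on_subset[OF g]) auto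
      then have "(\<lambda>s. S (max 0 (t - s)) (g s)) integrable_on {0..T}"
        by (rule integrable_continuous_real)
      then have "integral {0..T} (\<lambda>s. S (max 0 (t - s)) (g s)) =
        integral {0..t} (\<lambda>s. S (max 0 (t - s)) (g s)) + integral {t..T} (\<lambda>s. S (max 0 (t - s)) (g s))"
        using t by (intro Henstock_Kurzweil_Integration.integral_combine[symmetric]) auto
      also have "integral {0..t} (\<lambda>s. S (max 0 (t - s)) (g s)) = convolution S g t"
        unfolding convolution_def by (intro integral_cong) auto
      also have "integral {t..T} (\<lambda>s. S (max 0 (t - s)) (g s)) = integral {t..T} g"
        by (intro integral_cong) (auto simp: C0_semigroup_0[OF S])
      finally show "integral {0..T} (\<lambda>s. S (max 0 (t - s)) (g s)) - integral {t..T} g = convolution S g t"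
        by simp
    qed
  qed
  show ?thesis
    unfolding continuous_on_eq_continuous_within
  proof
    fix t :: real assume "t \<in> {0..}"
    then have "continuous (at t within {0..t + 1}) (convolution S g)"
      using cont[of "t + 1"] by (auto simp: continuous_on_eq_continuous_within)
    moreover have "at t within {0..t + 1} = at t within {0..}"
      by (rule at_within_nhd[of _ "{..<t + 1}"]) auto
    ultimately show "continuous (at t within {0..}) (convolution S g)"
      by (simp add: continuous_within)
  qed
qed

text \<open>The powers with factorials make both the Dyson series and the iteration in \<open>volterra_unique\<close> converge on every
bounded time interval, without a smallness assumption.\<close>

lemma convolution_bound:
  fixes S :: "real \<Rightarrow> 'a::banach \<Rightarrow>\<^sub>L 'a"
  assumes S: "C0_semigroup S" and g: "continuous_on {0..} g" and t: "t \<in> {0..T}"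
    and M: "M \<ge> 0" "\<And>s. s \<in> {0..T} \<Longrightarrow> norm (S s) \<le> M"
    and bound: "\<And>s. s \<in> {0..t} \<Longrightarrow> norm (g s) \<le> K * s ^ n / fact n"
  shows "norm (convolution S g t) \<le> M * K * t ^ Suc n / fact (Suc n)"
proof -
  have "((\<lambda>s. M * K * s ^ n / fact n) has_integral
      (M * K / fact (Suc n) * t ^ Suc n - M * K / fact (Suc n) * 0 ^ Suc n)) {0..t}"
  proof (rule fundamental_theorem_of_calculus)
    fix s assume "s \<in> {0..t}"
    have "((\<lambda>s. M * K / fact (Suc n) * s ^ Suc n) has_real_derivative
        M * K / fact (Suc n) * (real (Suc n) * s ^ n)) (at s within {0..t})"
      using DERIV_cmult[OF DERIV_pow[of "Suc n" s "{0..t}"], of "M * K / fact (Suc n)"]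
      by (simp del: fact_Suc power_Suc of_nat_Suc)
    moreover have "M * K / fact (Suc n) * (real (Suc n) * s ^ n) = M * K * s ^ n / fact n"
      by (simp del: of_nat_Suc)
    ultimately show "((\<lambda>s. M * K / fact (Suc n) * s ^ Suc n) has_vector_derivative
        M * K * s ^ n / fact n) (at s within {0..t})"
      by (simp only: has_real_derivative_iff_has_vector_derivative)
  qed (use t in auto)
  then have "integral {0..t} (\<lambda>s. M * K * s ^ n / fact n) = M * K * t ^ Suc n / fact (Suc n)"
    by (simp add: integral_unique del: integral_mult_right integral_mult_left integral_divide)
  moreover have "norm (convolution S g t) \<le> integral {0..t} (\<lambda>s. M * K * s ^ n / fact n)"
    unfolding convolution_def
  proof (rule integral_norm_bound_integral)
    show "(\<lambda>s. S (t - s) (g s)) integrable_on {0..t}"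
      by (intro integrable_continuous_real convolution_integrand_continuous[OF S g]) auto
    show "(\<lambda>s. M * K * s ^ n / fact n) integrable_on {0..t}"
      by (intro integrable_continuous_real continuous_intros) auto
    fix s assume s: "s \<in> {0..t}"
    have "norm (S (t - s) (g s)) \<le> norm (S (t - s)) * norm (g s)" by (rule norm_blinfun)
    also have "\<dots> \<le> M * (K * s ^ n / fact n)"
      using s t M bound[OF s] by (intro mult_mono) auto
    finally show "norm (S (t - s) (g s)) \<le> M * K * s ^ n / fact n" by (simp add: mult.assoc)
  qed
  ultimately show ?thesis by (simp only:)
qed

lemma convolution_add:
  fixes S :: "real \<Rightarrow> 'a::banach \<Rightarrow>\<^sub>L 'a"
  assumes S: "C0_semigroup S" and g: "continuous_on {0..} g" and h: "continuous_on {0..} h"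
  shows "convolution S (\<lambda>s. g s + h s) t = convolution S g t + convolution S h t"
  unfolding convolution_def blinfun.add_right
  by (intro integral_add integrable_continuous_real convolution_integrand_continuous[OF S] g h, auto)

lemma convolution_scaleR: "convolution S (\<lambda>s. r *\<^sub>R g s) t = r *\<^sub>R convolution S g t"
  unfolding convolution_def blinfun.scaleR_right by simp

lemma convolution_split:
  fixes S :: "real \<Rightarrow> 'a::banach \<Rightarrow>\<^sub>L 'a"
  assumes S: "C0_semigroup S" and g: "continuous_on {0..} g" and "t \<ge> 0" "r \<ge> 0"
  shows "convolution S g (t + r) = S t (convolution S g r) + convolution S (\<lambda>s. g (r + s)) t"
proof -
  have "convolution S g (t + r) =
      integral {0..r} (\<lambda>s. S (t + r - s) (g s)) + integral {r..t + r} (\<lambda>s. S (t + r - s) (g s))"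
    unfolding convolution_def using assms(3,4)
    by (intro Henstock_Kurzweil_Integration.integral_combine[symmetric] integrable_continuous_real
        convolution_integrand_continuous[OF S g]) auto
  also have "integral {0..r} (\<lambda>s. S (t + r - s) (g s)) = integral {0..r} (\<lambda>s. S t (S (r - s) (g s)))"
  proof (rule integral_cong)
    fix s assume "s \<in> {0..r}"
    then show "S (t + r - s) (g s) = S t (S (r - s) (g s))"
      using C0_semigroup_add[OF S \<open>t \<ge> 0\<close>, of "r - s" "g s"] by (simp add: add_diff_eq)
  qed
  also have "\<dots> = S t (convolution S g r)"
    unfolding convolution_def
    using integral_linear[OF integrable_continuous_real[OF convolution_integrand_continuous[OF S g order_refl order_refl]]
        blinfun.bounded_linear_right, of r "S t"]
    by (simp add: comp_def)
  also have "integral {r..t + r} (\<lambda>s. S (t + r - s) (g s)) = convolution S (\<lambda>s. g (r + s)) t"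
    unfolding convolution_def
    using integral_shift_real_ivl[of r r "t + r" "\<lambda>s. S (t + r - s) (g s)"]
    by (simp add: add.commute)
  finally show ?thesis .
qed

lemma convolution_quotient_tendsto:
  fixes S :: "real \<Rightarrow> 'a::banach \<Rightarrow>\<^sub>L 'a"
  assumes S: "C0_semigroup S" and g: "continuous_on {0..} g"
  shows "((\<lambda>h. convolution S g h /\<^sub>R h) \<longlongrightarrow> g 0) (at_right 0)"
proof (rule tendstoI)
  fix e :: real assume "e > 0"
  have "continuous_on ({0..} \<times> {0..}) (\<lambda>p. S (fst p) (g (snd p)))"
    by (intro C0_semigroup_continuous_on[OF S] continuous_intros continuous_on_compose2[OF g]) auto
  from this[unfolded continuous_on_iff, rule_format, of "(0, 0)" "e / 2"]
  obtain \<rho> where \<rho>: "\<rho> > 0" "\<And>p. p \<in> {0..} \<times> {0..} \<Longrightarrow> dist p (0, 0) < \<rho> \<Longrightarrow>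
      dist (S (fst p) (g (snd p))) (S 0 (g 0)) < e / 2"
    using \<open>e > 0\<close> by auto
  have "dist (convolution S g h /\<^sub>R h) (g 0) < e" if h: "0 < h" "h < \<rho> / 2" for h
  proof -
    have c: "continuous_on {0..h} (\<lambda>s. S (h - s) (g s))"
      by (intro convolution_integrand_continuous[OF S g]) auto
    have "norm (integral {0..h} (\<lambda>s. S (h - s) (g s) - g 0)) \<le> e / 2 * (h - 0)"
    proof (rule integral_bound)
      show "continuous_on {0..h} (\<lambda>s. S (h - s) (g s) - g 0)"
        by (intro continuous_intros c)
      fix s assume s: "s \<in> {0..h}"
      have "dist (h - s, s) (0, 0) \<le> \<bar>h - s\<bar> + \<bar>s\<bar>"
        by (simp add: dist_Pair_Pair dist_real_def sqrt_sum_squares_le_sum_abs)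
      then have "dist (S (h - s) (g s)) (S 0 (g 0)) < e / 2"
        using \<rho>(2)[of "(h - s, s)"] s h by simp
      then show "norm (S (h - s) (g s) - g 0) \<le> e / 2"
        by (simp add: dist_norm C0_semigroup_0[OF S])
    qed (use h in auto)
    also have "integral {0..h} (\<lambda>s. S (h - s) (g s) - g 0) = convolution S g h - h *\<^sub>R g 0"
      using h integral_diff[OF integrable_continuous_real[OF c] integrable_const_ivl[of "g 0"]]
      by (simp add: convolution_def)
    finally have "norm (h *\<^sub>R (convolution S g h /\<^sub>R h - g 0)) \<le> e / 2 * h"
      using h by (simp add: scaleR_diff_right)
    then have "norm (convolution S g h /\<^sub>R h - g 0) \<le> e / 2"
      using h by simp
    then show ?thesis using \<open>e > 0\<close> by (simp add: dist_norm)
  qed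
  then show "eventually (\<lambda>h. dist (convolution S g h /\<^sub>R h) (g 0) < e) (at_right 0)"
    using \<rho>(1) by (auto simp: eventually_at_right_field intro!: exI[of _ "\<rho> / 2"])
qed

text \<open>Inserting the equation into itself \<open>n\<close> times bounds the solution by the \<open>n\<close>-th term of an exponential series.\<close>

lemma volterra_unique:
  fixes S :: "real \<Rightarrow> 'a::banach \<Rightarrow>\<^sub>L 'a" and B :: "'a \<Rightarrow>\<^sub>L 'a"
  assumes S: "C0_semigroup S" and d: "continuous_on {0..} d"
    and eq: "\<And>t. t \<ge> 0 \<Longrightarrow> d t = convolution S (\<lambda>s. B (d s)) t" and "t \<ge> 0"
  shows "d t = 0"
proof -
  obtain M where M: "M > 0" "\<forall>s\<in>{0..t}. norm (S s) \<le> M"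
    using C0_semigroup_locally_bounded[OF S] by blast
  have "continuous_on {0..t} d" using d by (rule continuous_on_subset) auto
  from compact_imp_bounded[OF compact_continuous_image[OF this compact_Icc]]
  obtain K where K: "\<forall>s\<in>{0..t}. norm (d s) \<le> K" by (auto simp: bounded_iff)
  have Bd: "continuous_on {0..} (\<lambda>s. B (d s))"
    by (intro continuous_intros d)
  define L where "L = M * norm B"
  have iter: "norm (d s) \<le> K * L ^ n * s ^ n / fact n" if "s \<in> {0..t}" for n s
    using that
  proof (induction n arbitrary: s)
    case (Suc n)
    have "norm (convolution S (\<lambda>s. B (d s)) s) \<le> M * (norm B * (K * L ^ n)) * s ^ Suc n / fact (Suc n)"
    proof (rule convolution_bound[OF S Bd Suc.prems])
      fix r assume r: "r \<in> {0..s}"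
      have "norm (B (d r)) \<le> norm B * norm (d r)" by (rule norm_blinfun)
      also have "\<dots> \<le> norm B * (K * L ^ n * r ^ n / fact n)"
        using Suc.IH[of r] r Suc.prems by (intro mult_left_mono) auto
      finally show "norm (B (d r)) \<le> norm B * (K * L ^ n) * r ^ n / fact n" by (simp add: mult_ac)
    qed (use M in auto)
    then show ?case
      using eq[of s] Suc.prems by (simp add: L_def mult_ac del: fact_Suc)
  qed (use K in auto)
  have "(\<lambda>n. K * ((L * t) ^ n / fact n)) \<longlonglongrightarrow> K * 0"
    using summable_LIMSEQ_zero[OF summable_exp_generic[of "L * t"]]
    by (intro tendsto_mult_left) (simp add: divide_inverse mult.commute)
  moreover have "norm (d t) \<le> K * ((L * t) ^ n / fact n)" for n
    using iter[of t n] \<open>t \<ge> 0\<close> by (simp add: power_mult_distrib mult_ac)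
  ultimately have "norm (d t) \<le> 0"
    by (intro LIMSEQ_le_const[of _ 0]) auto
  then show ?thesis by simp
qed

text \<open>The Dyson--Phillips series for the semigroup generated by \<open>A + B\<close>, where \<open>A\<close> is the generator of \<open>S\<close>.\<close>

primrec dyson :: "(real \<Rightarrow> ('a::banach \<Rightarrow>\<^sub>L 'a)) \<Rightarrow> ('a \<Rightarrow>\<^sub>L 'a) \<Rightarrow> 'a \<Rightarrow> nat \<Rightarrow> real \<Rightarrow> 'a"
  where
    "dyson S B x 0 = (\<lambda>t. S t x)"
  | "dyson S B x (Suc n) = convolution S (\<lambda>s. B (dyson S B x n s))"

definition perturbed_orbit :: "(real \<Rightarrow> ('a::banach \<Rightarrow>\<^sub>L 'a)) \<Rightarrow> ('a \<Rightarrow>\<^sub>L 'a) \<Rightarrow> 'a \<Rightarrow> real \<Rightarrow> 'a"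
  where "perturbed_orbit S B x t = (\<Sum>n. dyson S B x n t)"

definition perturbed_semigroup :: "(real \<Rightarrow> ('a::banach \<Rightarrow>\<^sub>L 'a)) \<Rightarrow> ('a \<Rightarrow>\<^sub>L 'a) \<Rightarrow> real \<Rightarrow> 'a \<Rightarrow>\<^sub>L 'a"
  where "perturbed_semigroup S B t = Blinfun (\<lambda>x. perturbed_orbit S B x t)"

context
  fixes S :: "real \<Rightarrow> 'a::banach \<Rightarrow>\<^sub>L 'a" and B :: "'a \<Rightarrow>\<^sub>L 'a"
  assumes S: "C0_semigroup S"
begin

lemma dyson_continuous: "continuous_on {0..} (dyson S B x n)"
proof (induction n)
  case 0
  then show ?case using C0_semigroup_orbit_continuous[OF S order_refl] by simp
next
  case (Suc n)
  then show ?case by (simp, intro convolution_continuous[OF S] continuous_intros)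
qed

lemma dyson_linear:
  assumes "t \<ge> 0"
  shows "dyson S B (x + y) n t = dyson S B x n t + dyson S B y n t" (is ?add)
    and "dyson S B (r *\<^sub>R x) n t = r *\<^sub>R dyson S B x n t" (is ?scale)
proof -
  have cont: "continuous_on {0..} (\<lambda>s. B (dyson S B x n s))" for x n
    by (intro continuous_intros dyson_continuous)
  show ?add using assms
  proof (induction n arbitrary: t)
    case (Suc n)
    have "convolution S (\<lambda>s. B (dyson S B (x + y) n s)) t =
        convolution S (\<lambda>s. B (dyson S B x n s) + B (dyson S B y n s)) t"
      unfolding convolution_def using Suc.IH by (intro integral_cong) (simp add: blinfun.add_right)
    then show ?case by (simp add: convolution_add[OF S cont cont])
  qed (simp add: blinfun.add_right)
  show ?scale using assms
  proof (induction n arbitrary: t)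
    case (Suc n)
    have "convolution S (\<lambda>s. B (dyson S B (r *\<^sub>R x) n s)) t =
        convolution S (\<lambda>s. r *\<^sub>R B (dyson S B x n s)) t"
      unfolding convolution_def using Suc.IH by (intro integral_cong) (simp add: blinfun.scaleR_right)
    then show ?case by (simp add: convolution_scaleR)
  qed (simp add: blinfun.scaleR_right)
qed

lemma dyson_bound:
  assumes M: "M \<ge> 0" "\<And>s. s \<in> {0..T} \<Longrightarrow> norm (S s) \<le> M" and t: "t \<in> {0..T}"
  shows "norm (dyson S B x n t) \<le> M * norm x * ((M * norm B * t) ^ n / fact n)"
  using t
proof (induction n arbitrary: t)
  case 0
  then show ?case using order_trans[OF norm_blinfun mult_right_mono[OF M(2)[of t]], of x] by simp
next
  case (Suc n)
  have "continuous_on {0..} (\<lambda>s. B (dyson S B x n s))"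
    by (intro continuous_intros dyson_continuous)
  then have "norm (dyson S B x (Suc n) t) \<le> M * (norm B * (M * norm x * (M * norm B) ^ n)) * t ^ Suc n / fact (Suc n)"
    unfolding dyson.simps
  proof (rule convolution_bound[OF S _ Suc.prems M])
    fix r assume r: "r \<in> {0..t}"
    have "norm (B (dyson S B x n r)) \<le> norm B * norm (dyson S B x n r)" by (rule norm_blinfun)
    also have "\<dots> \<le> norm B * (M * norm x * ((M * norm B * r) ^ n / fact n))"
      using Suc.IH[of r] r Suc.prems by (intro mult_left_mono) auto
    finally show "norm (B (dyson S B x n r)) \<le> norm B * (M * norm x * (M * norm B) ^ n) * r ^ n / fact n"
      by (simp add: power_mult_distrib mult_ac)
  qed auto
  then show ?case by (simp add: power_mult_distrib mult_ac del: fact_Suc dyson.simps)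
qed

lemma dyson_uniform_limit:
  "uniform_limit {0..T} (\<lambda>n t. \<Sum>i<n. dyson S B x i t) (perturbed_orbit S B x) sequentially"
proof -
  obtain M where M: "M > 0" "\<forall>s\<in>{0..T}. norm (S s) \<le> M"
    using C0_semigroup_locally_bounded[OF S] by blast
  have bound: "norm (dyson S B x n t) \<le> M * norm x * ((M * norm B * T) ^ n / fact n)" if t: "t \<in> {0..T}" for n t
  proof -
    have "(M * norm B * t) ^ n \<le> (M * norm B * T) ^ n"
      using M t by (intro power_mono mult_left_mono) auto
    then have "M * norm x * ((M * norm B * t) ^ n / fact n) \<le> M * norm x * ((M * norm B * T) ^ n / fact n)"
      using M by (intro mult_left_mono divide_right_mono) auto
    then show ?thesis
      using dyson_bound[of M T t x n] M t by fastforce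
  qed
  have "summable (\<lambda>n. M * norm x * ((M * norm B * T) ^ n / fact n))"
    using summable_exp_generic[of "M * norm B * T"] by (intro summable_mult) (simp add: divide_inverse mult.commute)
  then show ?thesis
    unfolding perturbed_orbit_def using bound by (intro Weierstrass_m_test) auto
qed

lemma dyson_sums: "t \<ge> 0 \<Longrightarrow> (\<lambda>n. dyson S B x n t) sums perturbed_orbit S B x t"
  using tendsto_uniform_limitI[OF dyson_uniform_limit, of t t] by (simp add: sums_def)

lemma perturbed_orbit_continuous: "continuous_on {0..} (perturbed_orbit S B x)"
  unfolding continuous_on_eq_continuous_within
proof
  fix t :: real assume "t \<in> {0..}"
  have "continuous_on {0..t + 1} (perturbed_orbit S B x)"
    by (rule uniform_limit_theorem[OF _ dyson_uniform_limit])
      (auto intro!: always_eventually continuous_on_sum continuous_on_subset[OF dyson_continuous])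
  then have "continuous (at t within {0..t + 1}) (perturbed_orbit S B x)"
    using \<open>t \<in> {0..}\<close> by (auto simp: continuous_on_eq_continuous_within)
  moreover have "at t within {0..t + 1} = at t within {0..}"
    by (rule at_within_nhd[of _ "{..<t + 1}"]) auto
  ultimately show "continuous (at t within {0..}) (perturbed_orbit S B x)"
    by (simp add: continuous_within)
qed

text \<open>The integral form of \<open>v' = (A + B) v\<close>, \<open>v 0 = x\<close>. From here on it replaces the series.\<close>

lemma perturbed_orbit_eq:
  assumes "t \<ge> 0"
  shows "perturbed_orbit S B x t = S t x + convolution S (\<lambda>s. B (perturbed_orbit S B x s)) t"
proof -
  obtain M where M: "M > 0" "\<forall>s\<in>{0..t}. norm (S s) \<le> M"
    using C0_semigroup_locally_bounded[OF S] by blast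
  define F where "F n s = (\<Sum>i<n. dyson S B x i s)" for n s
  have contF: "continuous_on {0..} (F n)" for n
    unfolding F_def by (intro continuous_on_sum dyson_continuous)
  have F_Suc: "F (Suc n) t = S t x + convolution S (\<lambda>s. B (F n s)) t" for n
  proof -
    have "convolution S (\<lambda>s. B (F n s)) t = (\<Sum>i<n. dyson S B x (Suc i) t)"
    proof (induction n)
      case 0
      then show ?case by (simp add: F_def convolution_def)
    next
      case (Suc n)
      have "convolution S (\<lambda>s. B (F (Suc n) s)) t = convolution S (\<lambda>s. B (F n s) + B (dyson S B x n s)) t"
        by (simp add: F_def blinfun.add_right)
      also have "\<dots> = convolution S (\<lambda>s. B (F n s)) t + dyson S B x (Suc n) t"
        by (simp add: convolution_add[OF S] continuous_intros contF dyson_continuous)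
      finally show ?case using Suc by simp
    qed
    then show ?thesis by (simp add: F_def sum.lessThan_Suc_shift del: sum.lessThan_Suc dyson.simps(2))
  qed
  have "uniform_limit {0..t} (\<lambda>n s. S (t - s) (B (F n s))) (\<lambda>s. S (t - s) (B (perturbed_orbit S B x s))) sequentially"
  proof (rule uniform_limitI)
    fix e :: real assume "e > 0"
    define K where "K = M * (norm B + 1)"
    have "K > 0" using M norm_ge_zero[of B] by (simp add: K_def add_nonneg_pos)
    have "eventually (\<lambda>n. \<forall>s\<in>{0..t}. dist (F n s) (perturbed_orbit S B x s) < e / K) sequentially"
      using uniform_limitD[OF dyson_uniform_limit, of "e / K" t x] \<open>e > 0\<close> \<open>K > 0\<close> by (simp add: F_def)
    then show "eventually (\<lambda>n. \<forall>s\<in>{0..t}. dist (S (t - s) (B (F n s))) (S (t - s) (B (perturbed_orbit S B x s))) < e) sequentially"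
    proof (eventually_elim, safe)
      fix n s assume *: "\<forall>s\<in>{0..t}. dist (F n s) (perturbed_orbit S B x s) < e / K" and s: "s \<in> {0..t}"
      have "norm (S (t - s) (B (F n s - perturbed_orbit S B x s))) \<le> M * (norm B * norm (F n s - perturbed_orbit S B x s))"
        using M s by (intro order_trans[OF norm_blinfun] mult_mono norm_blinfun) auto
      also have "\<dots> \<le> K * norm (F n s - perturbed_orbit S B x s)"
        using M by (simp add: K_def algebra_simps)
      also have "\<dots> < e" using * s \<open>K > 0\<close> by (simp add: dist_norm field_simps)
      finally show "dist (S (t - s) (B (F n s))) (S (t - s) (B (perturbed_orbit S B x s))) < e"
        by (simp add: dist_norm blinfun.diff_right)
    qed
  qed
  moreover have "continuous_on {0..t} (\<lambda>s. S (t - s) (B (F n s)))" for n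
    by (intro convolution_integrand_continuous[OF S] continuous_intros contF) auto
  ultimately obtain I J where IJ:
    "\<And>n. ((\<lambda>s. S (t - s) (B (F n s))) has_integral I n) {0..t}"
    "((\<lambda>s. S (t - s) (B (perturbed_orbit S B x s))) has_integral J) {0..t}" "I \<longlonglongrightarrow> J"
    using sequentially_bot by (rule uniform_limit_integral) (rule that)
  then have "(\<lambda>n. integral {0..t} (\<lambda>s. S (t - s) (B (F n s)))) \<longlonglongrightarrow>
      integral {0..t} (\<lambda>s. S (t - s) (B (perturbed_orbit S B x s)))"
    unfolding integral_unique[OF IJ(1)] integral_unique[OF IJ(2)] by simp
  then have "(\<lambda>n. F (Suc n) t) \<longlonglongrightarrow> S t x + convolution S (\<lambda>s. B (perturbed_orbit S B x s)) t"
    unfolding F_Suc convolution_def by (intro tendsto_intros)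
  moreover have "(\<lambda>n. F (Suc n) t) \<longlonglongrightarrow> perturbed_orbit S B x t"
    using dyson_sums[OF assms, of x] unfolding sums_def F_def by (rule LIMSEQ_Suc)
  ultimately show ?thesis by (rule LIMSEQ_unique[rotated])
qed

lemma perturbed_semigroup_apply:
  assumes "t \<ge> 0"
  shows "perturbed_semigroup S B t x = perturbed_orbit S B x t"
proof -
  obtain M where M: "M > 0" "\<forall>s\<in>{0..t}. norm (S s) \<le> M"
    using C0_semigroup_locally_bounded[OF S] by blast
  note sums = dyson_sums[OF assms]
  have "bounded_linear (\<lambda>x. perturbed_orbit S B x t)"
  proof (rule bounded_linear_intro)
    fix x y :: 'a and r :: real
    show "perturbed_orbit S B (x + y) t = perturbed_orbit S B x t + perturbed_orbit S B y t"
      using sums_add[OF sums[of x] sums[of y]] sums[of "x + y"]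
      by (simp add: dyson_linear(1)[OF assms] sums_unique2)
    show "perturbed_orbit S B (r *\<^sub>R x) t = r *\<^sub>R perturbed_orbit S B x t"
      using sums_scaleR_right[OF sums[of x], of r] sums[of "r *\<^sub>R x"]
      by (simp add: dyson_linear(2)[OF assms] sums_unique2)
    have "(\<lambda>n. (M * norm B * t) ^ n / fact n) sums exp (M * norm B * t)"
      using exp_converges[of "M * norm B * t"] by (simp add: divide_inverse mult.commute)
    then have sm: "(\<lambda>n. M * norm x * ((M * norm B * t) ^ n / fact n)) sums (M * norm x * exp (M * norm B * t))"
      by (rule sums_mult)
    have "norm (dyson S B x n t) \<le> M * norm x * ((M * norm B * t) ^ n / fact n)" for n
      using M assms by (intro dyson_bound[of M t]) auto
    from norm_suminf_le[OF this sums_summable[OF sm]]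
    have "norm (perturbed_orbit S B x t) \<le> M * norm x * exp (M * norm B * t)"
      unfolding perturbed_orbit_def sums_unique[OF sm, symmetric] .
    then show "norm (perturbed_orbit S B x t) \<le> norm x * (M * exp (M * norm B * t))"
      by (simp add: mult_ac)
  qed
  then show ?thesis
    by (simp add: perturbed_semigroup_def bounded_linear_Blinfun_apply)
qed

text \<open>The semigroup law is the uniqueness of solutions of the Volterra equation: both sides, as functions of
the first time, solve it with the same initial value.\<close>

lemma perturbed_semigroup_C0: "C0_semigroup (perturbed_semigroup S B)"
  unfolding C0_semigroup_def
proof (intro conjI allI impI)
  show "perturbed_semigroup S B 0 = id_blinfun"
    by (rule blinfun_eqI)
      (simp add: perturbed_semigroup_apply perturbed_orbit_eq convolution_def C0_semigroup_0[OF S])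
  show "continuous_on {0..} (\<lambda>t. perturbed_semigroup S B t x)" for x
    using perturbed_orbit_continuous[of x] by (rule continuous_on_eq) (simp add: perturbed_semigroup_apply)
  fix s t :: real assume st: "s \<ge> 0" "t \<ge> 0"
  show "perturbed_semigroup S B (s + t) = perturbed_semigroup S B s o\<^sub>L perturbed_semigroup S B t"
  proof (rule blinfun_eqI)
    fix x
    let ?V = "perturbed_orbit S B"
    have B_cont: "continuous_on {0..} (\<lambda>s. B (?V x s))" for x
      by (intro continuous_intros perturbed_orbit_continuous)
    have shift_cont: "continuous_on {0..} (\<lambda>s. ?V x (t + s))"
      using st by (intro continuous_on_compose2[OF perturbed_orbit_continuous] continuous_intros) auto
    define d where "d s = ?V x (t + s) + (-1) *\<^sub>R ?V (?V x t) s" for s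
    have "d s = 0"
    proof (rule volterra_unique[OF S _ _ st(1)])
      show "continuous_on {0..} d"
        unfolding d_def by (intro continuous_intros shift_cont perturbed_orbit_continuous)
      fix s :: real assume "s \<ge> 0"
      have "?V x (t + s) = S (s + t) x + convolution S (\<lambda>s. B (?V x s)) (s + t)"
        using perturbed_orbit_eq[of "s + t" x] st \<open>s \<ge> 0\<close> by (simp add: add.commute)
      also have "\<dots> = S s (?V x t) + convolution S (\<lambda>r. B (?V x (t + r))) s"
        unfolding convolution_split[OF S B_cont \<open>s \<ge> 0\<close> st(2)] perturbed_orbit_eq[OF st(2), of x]
          C0_semigroup_add[OF S \<open>s \<ge> 0\<close> st(2)] by (simp add: blinfun.add_right)
      finally have "d s = convolution S (\<lambda>r. B (?V x (t + r))) s + (-1) *\<^sub>R convolution S (\<lambda>r. B (?V (?V x t) r)) s"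
        unfolding d_def using perturbed_orbit_eq[OF \<open>s \<ge> 0\<close>, of "?V x t"] by simp
      also have "\<dots> = convolution S (\<lambda>r. B (?V x (t + r)) + (-1) *\<^sub>R B (?V (?V x t) r)) s"
        unfolding convolution_scaleR[symmetric]
        by (intro convolution_add[OF S, symmetric] continuous_intros shift_cont perturbed_orbit_continuous)
      also have "\<dots> = convolution S (\<lambda>r. B (d r)) s"
        by (simp add: d_def blinfun.add_right blinfun.diff_right)
      finally show "d s = convolution S (\<lambda>r. B (d r)) s" .
    qed
    then show "perturbed_semigroup S B (s + t) x = (perturbed_semigroup S B s o\<^sub>L perturbed_semigroup S B t) x"
      using st by (simp add: perturbed_semigroup_apply d_def add.commute)
  qed
qed

text \<open>By the Volterra equation the difference quotients of the two semigroups at \<open>x\<close> differ by a term that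
converges to \<open>B x\<close>; so the two generators have the same domain.\<close>

lemma generator_perturbed_semigroup: "generator (perturbed_semigroup S B) = generator S +\<^sub>m bop B"
proof
  fix x
  define b where "b h = convolution S (\<lambda>s. B (perturbed_orbit S B x s)) h /\<^sub>R h" for h
  have b: "(b \<longlongrightarrow> B x) (at_right 0)"
    unfolding b_def
    using convolution_quotient_tendsto[OF S, of "\<lambda>s. B (perturbed_orbit S B x s)"]
      perturbed_semigroup_C0 perturbed_semigroup_apply[of 0 x]
    by (simp add: continuous_intros perturbed_orbit_continuous C0_semigroup_0)
  have eq: "eventually (\<lambda>h. (perturbed_semigroup S B h x - x) /\<^sub>R h = (S h x - x) /\<^sub>R h + b h) (at_right 0)"
    by (auto simp: eventually_at_filter perturbed_semigroup_apply perturbed_orbit_eq b_def algebra_simps)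
  have iff: "generator (perturbed_semigroup S B) x = Some y \<longleftrightarrow> generator S x = Some (y - B x)" for y
  proof -
    have "generator (perturbed_semigroup S B) x = Some y \<longleftrightarrow> ((\<lambda>h. (S h x - x) /\<^sub>R h + b h) \<longlongrightarrow> y) (at_right 0)"
      unfolding generator_eq_Some_iff by (rule tendsto_cong[OF eq])
    also have "\<dots> \<longleftrightarrow> ((\<lambda>h. (S h x - x) /\<^sub>R h) \<longlongrightarrow> y - B x) (at_right 0)"
      using tendsto_diff[OF _ b, of "\<lambda>h. (S h x - x) /\<^sub>R h + b h" y]
        tendsto_add[OF _ b, of "\<lambda>h. (S h x - x) /\<^sub>R h" "y - B x"] by auto
    finally show ?thesis by (simp add: generator_eq_Some_iff)
  qed
  show "generator (perturbed_semigroup S B) x = (generator S +\<^sub>m bop B) x"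
  proof (cases "generator S x")
    case None
    then have "generator (perturbed_semigroup S B) x = None"
      using iff by (cases "generator (perturbed_semigroup S B) x") auto
    then show ?thesis using None by (auto simp: op_add_def dom_def)
  next
    case (Some y)
    then show ?thesis using iff[of "y + B x"] by (auto simp: op_add_def bop_def dom_def)
  qed
qed

end

lemma identity_semigroup:
  "C0_semigroup (\<lambda>_. id_blinfun)" "generator (\<lambda>_. id_blinfun) = bop 0"
  by (auto simp: C0_semigroup_def blinfun_eqI generator_eq_Some_iff bop_def)

text \<open>A bounded operator is a bounded perturbation of the zero operator, which generates the identity.\<close>

lemma bounded_operator_generates:
  fixes B :: "'a::banach \<Rightarrow>\<^sub>L 'a"
  shows "\<exists>S. C0_semigroup S \<and> generator S = bop B"
proof (intro exI conjI)
  show "C0_semigroup (perturbed_semigroup (\<lambda>_. id_blinfun) B)"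
    by (rule perturbed_semigroup_C0[OF identity_semigroup(1)])
  show "generator (perturbed_semigroup (\<lambda>_. id_blinfun) B) = bop B"
    by (simp add: generator_perturbed_semigroup identity_semigroup, auto simp: op_add_def bop_def dom_def)
qed

section \<open>Unbounded operators applied to vectors\<close>

lemma bounded_at_comp: "bounded_at (K \<circ>\<^sub>m L) x c \<longleftrightarrow> (\<exists>y. L x = Some y \<and> bounded_at K y c)"
  by (cases "L x") (auto simp: bounded_at_def map_comp_def dom_def)

lemma bounded_at_comp_bop: "bounded_at (L \<circ>\<^sub>m bop E) x c \<longleftrightarrow> bounded_at L (E x) c"
  by (simp add: bounded_at_comp bop_def)

lemma bounded_at_Some: "bounded_at L x c \<longleftrightarrow> (\<exists>y. L x = Some y \<and> norm y \<le> c)"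
  by (auto simp: bounded_at_def dom_def)

lemma bounded_at_commutator:
  "bounded_at (commutator K L) x c \<longleftrightarrow>
    (\<exists>k l kl lk. K x = Some k \<and> L x = Some l \<and> K l = Some kl \<and> L k = Some lk \<and> norm (kl - lk) \<le> c)"
  unfolding bounded_at_def commutator_def op_diff_def
  by (cases "K x"; cases "L x") (auto simp: map_comp_def dom_def split: option.splits)

lemma op_add_Some:
  "(K +\<^sub>m L) x = Some y \<longleftrightarrow> (\<exists>k l. K x = Some k \<and> L x = Some l \<and> y = k + l)"
  by (auto simp: op_add_def dom_def)

lemma op_add_right_commute: "K +\<^sub>m L +\<^sub>m H = K +\<^sub>m H +\<^sub>m L"
  by (rule ext) (auto simp: op_add_def dom_def)

section \<open>Two estimates along orbits\<close>

text \<open>Two semigroups agree up to first order in time as soon as their generators differ by approximately \<open>k\<close> along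
one orbit, transported to time \<open>t\<close>.\<close>

lemma duhamel_estimate:
  fixes S R :: "real \<Rightarrow> 'a::banach \<Rightarrow>\<^sub>L 'a"
  assumes S: "C0_semigroup S" and R: "C0_semigroup R" and "t \<ge> 0"
    and x: "generator R x = Some y"
    and gen: "\<And>s. s \<in> {0..t} \<Longrightarrow> generator S (R s x) = Some (a s)"
    and bound: "\<And>s. s \<in> {0..t} \<Longrightarrow> norm (S (t - s) (R s y - a s) - k) \<le> c"
  shows "norm (R t x - S t x - t *\<^sub>R k) \<le> c * t"
proof -
  have "norm (S (t - t) (R t x) - S (t - 0) (R 0 x) - (t - 0) *\<^sub>R k) \<le> c * (t - 0)"
  proof (rule mean_value_affine[OF \<open>t \<ge> 0\<close> _ bound])
    fix s assume s: "s \<in> {0..t}"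
    have "((\<lambda>s. R s x) has_vector_derivative R s y) (at s within {0..t})"
      using s by (intro orbit_derivative[OF R x]) auto
    then show "((\<lambda>s. S (t - s) (R s x)) has_vector_derivative S (t - s) (R s y - a s)) (at s within {0..t})"
      using s gen by (intro duhamel_derivative[OF S]) auto
  qed
  then show ?thesis by (simp add: C0_semigroup_0[OF S] C0_semigroup_0[OF R])
qed

text \<open>A mean value inequality for \<open>C (f s)\<close> with an unbounded \<open>C\<close>, although \<open>s \<mapsto> C (f s)\<close> need not be differentiable. It
is enough that the vectors \<open>f' s\<close> have bounded images under \<open>C\<close>: the inequality holds for the bounded quotients
uniformly, and they converge at the two end points.\<close>

lemma generator_mean_value:
  fixes S :: "real \<Rightarrow> 'a::banach \<Rightarrow>\<^sub>L 'a"
  assumes S: "C0_semigroup S" and M: "\<And>s. s \<in> {0..T} \<Longrightarrow> norm (S s) \<le> M" and "T > 0" and "a \<le> b"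
    and deriv: "\<And>s. s \<in> {a..b} \<Longrightarrow> (f has_vector_derivative f' s) (at s within {a..b})"
    and f': "\<And>s. s \<in> {a..b} \<Longrightarrow> \<exists>g. generator S (f' s) = Some g \<and> norm g \<le> c"
    and ends: "generator S (f a) = Some p" "generator S (f b) = Some q"
  shows "norm (q - p) \<le> M * c * (b - a)"
proof -
  have M0: "M \<ge> 0"
    using M[of 0] \<open>T > 0\<close> norm_ge_zero order_trans by (metis atLeastAtMost_iff less_imp_le order_refl)
  have est: "norm (semigroup_quotient S d (f b) - semigroup_quotient S d (f a)) \<le> M * c * (b - a)"
    if d: "0 < d" "d < T" for d
  proof -
    have "norm (semigroup_quotient S d (f b) - semigroup_quotient S d (f a) - (b - a) *\<^sub>R 0) \<le> M * c * (b - a)"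
    proof (rule mean_value_affine[OF \<open>a \<le> b\<close>])
      fix s assume s: "s \<in> {a..b}"
      show "((\<lambda>s. semigroup_quotient S d (f s)) has_vector_derivative semigroup_quotient S d (f' s)) (at s within {a..b})"
        by (intro bounded_linear.has_vector_derivative[OF blinfun.bounded_linear_right] deriv s)
      obtain g where g: "generator S (f' s) = Some g" "norm g \<le> c" using f'[OF s] by blast
      have "norm (semigroup_mean S d g) \<le> norm (semigroup_mean S d) * norm g" by (rule norm_blinfun)
      also have "\<dots> \<le> M * c"
        using d g(2) M M0 by (intro mult_mono norm_semigroup_mean_le[OF S]) auto
      finally show "norm (semigroup_quotient S d (f' s) - 0) \<le> M * c"
        by (simp add: semigroup_mean_generator[OF S d(1) g(1)])
    qed
    then show ?thesis by simp
  qed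
  have "((\<lambda>d. norm (semigroup_quotient S d (f b) - semigroup_quotient S d (f a))) \<longlongrightarrow> norm (q - p)) (at_right 0)"
    using ends unfolding generator_eq_Some_iff semigroup_quotient_apply by (intro tendsto_intros)
  moreover have "eventually (\<lambda>d. norm (semigroup_quotient S d (f b) - semigroup_quotient S d (f a)) \<le> M * c * (b - a)) (at_right 0)"
    using est \<open>T > 0\<close> by (auto simp: eventually_at_right_field)
  ultimately show ?thesis
    by (rule tendsto_upperbound) simp
qed

section \<open>The local error\<close>

text \<open>The set \<open>W\<close> stands for the values of the exact solution, and \<open>M\<close> bounds all semigroups on \<open>[0, T]\<close>. The two
sides of the comparison between \<open>N\<close> and the norm are kept as parameters so that the constants can be
written down.\<close>

locale splitting_bounds =
  fixes SA SC SD SB :: "real \<Rightarrow> 'a::banach \<Rightarrow>\<^sub>L 'a" and B :: "'a \<Rightarrow>\<^sub>L 'a" and N :: "'a \<Rightarrow> real"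
    and W :: "'a set" and NL NU T M U \<omega> c1 c2 c3 c4 c5 :: real
  assumes SA: "C0_semigroup SA" and SC: "C0_semigroup SC" and SD: "C0_semigroup SD" and SB: "C0_semigroup SB"
    and D: "generator SD = generator SA +\<^sub>m generator SC" and genB: "generator SB = bop B"
    and N: "equivalent_norm N"
    and NL: "NL > 0" "\<And>x. NL * norm x \<le> N x" and NU: "NU > 0" "\<And>x. N x \<le> NU * norm x"
    and quasi: "\<And>t x. t \<ge> 0 \<Longrightarrow> N (SA t x) \<le> exp (\<omega> * t) * N x" and \<omega>: "\<omega> \<ge> 0"
    and T: "T > 0"
    and M: "\<And>t. t \<in> {0..T} \<Longrightarrow> norm (SA t) \<le> M" "\<And>t. t \<in> {0..T} \<Longrightarrow> norm (SC t) \<le> M"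
      "\<And>t. t \<in> {0..T} \<Longrightarrow> norm (SD t) \<le> M" "\<And>t. t \<in> {0..T} \<Longrightarrow> norm (SB t) \<le> M"
      "\<And>t. t \<in> {0..T} \<Longrightarrow> norm (perturbed_semigroup SD B t) \<le> M"
    and U: "\<And>w. w \<in> W \<Longrightarrow> norm w \<le> U"
    and AC: "\<And>w s. w \<in> W \<Longrightarrow> s \<in> {0..T} \<Longrightarrow>
      bounded_at (commutator (generator SA) (generator SC)) (SA s w) c1"
    and CB: "\<And>w s. w \<in> W \<Longrightarrow> s \<in> {0..T} \<Longrightarrow> bounded_at (generator SC) (SA s (B w)) c2"
    and CC: "\<And>w s. w \<in> W \<Longrightarrow> s \<in> {0..T} \<Longrightarrow> bounded_at (generator SC \<circ>\<^sub>m generator SC) (SA s w) c3"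
    and CAC: "\<And>w s r. w \<in> W \<Longrightarrow> s \<in> {0..T} \<Longrightarrow> r \<in> {0..T} \<Longrightarrow>
      bounded_at (generator SC \<circ>\<^sub>m bop (SA r) \<circ>\<^sub>m generator SC) (SD s w) c4"
    and DB: "\<And>w s. w \<in> W \<Longrightarrow> s \<in> {0..T} \<Longrightarrow>
      bounded_at (commutator (generator SD) (bop B)) (SD s w) c5"
begin

abbreviation V :: "real \<Rightarrow> 'a \<Rightarrow>\<^sub>L 'a"
  where "V \<equiv> perturbed_semigroup SD B"

lemma M_nonneg: "M \<ge> 0"
  using M(1)[of 0] T norm_ge_zero order_trans by (metis atLeastAtMost_iff less_imp_le order_refl)

lemma M_apply:
  assumes "t \<in> {0..T}"
  shows "norm (SA t x) \<le> M * norm x" "norm (SC t x) \<le> M * norm x" "norm (SD t x) \<le> M * norm x"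
    "norm (SB t x) \<le> M * norm x" "norm (V t x) \<le> M * norm x"
  using M[OF assms] by (meson mult_right_mono norm_blinfun norm_ge_zero order_trans)+

lemma generator_D:
  "generator SD x = Some d \<longleftrightarrow> (\<exists>a c. generator SA x = Some a \<and> generator SC x = Some c \<and> d = a + c)"
  unfolding D by (rule op_add_Some)

lemma V_semigroup: "C0_semigroup V"
  by (rule perturbed_semigroup_C0[OF SD])

lemma generator_V: "generator V x = Some v \<longleftrightarrow> (\<exists>d. generator SD x = Some d \<and> v = d + B x)"
  unfolding generator_perturbed_semigroup[OF SD] op_add_Some by (auto simp: bop_def)

lemma domain_D:
  assumes "w \<in> W"
  obtains a c where "generator SA w = Some a" "generator SC w = Some c" "generator SD w = Some (a + c)"
proof -
  have "bounded_at (commutator (generator SD) (bop B)) (SD 0 w) c5"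
    using DB[OF assms, of 0] T by simp
  then obtain d where "generator SD w = Some d"
    by (auto simp: bounded_at_commutator C0_semigroup_0[OF SD])
  then show ?thesis using that unfolding generator_D by blast
qed

definition Kc :: real
  where "Kc = NU * c1 * exp (\<omega> * T) / NL"

lemma commutator_estimate:
  assumes w: "w \<in> W" and \<tau>: "\<tau> \<in> {0..T}" and s: "s \<in> {0..\<tau>}"
    and z1: "generator SC (SA \<tau> w) = Some z1" "generator SC (SA s w) = Some z1'"
  shows "norm (z1 - SA (\<tau> - s) z1') \<le> Kc * \<tau>"
proof -
  obtain aw where aw: "generator SA w = Some aw" using domain_D[OF w] by metis
  have "\<exists>z v q c. generator SC (SA r w) = Some z \<and> generator SC (SA r aw) = Some v \<and>
      generator SA z = Some q \<and> generator SC z = Some c \<and> norm (q - v) \<le> c1 \<and> norm c \<le> c3"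
    if r: "r \<in> {0..\<tau>}" for r
  proof -
    have r': "r \<in> {0..T}" using r \<tau> by auto
    obtain k l kl lk where "generator SA (SA r w) = Some k" "generator SC (SA r w) = Some l"
      "generator SA l = Some kl" "generator SC k = Some lk" "norm (kl - lk) \<le> c1"
      using AC[OF w r'] unfolding bounded_at_commutator by blast
    moreover obtain l' m where "generator SC (SA r w) = Some l'" "generator SC l' = Some m" "norm m \<le> c3"
      using CC[OF w r', unfolded bounded_at_comp] unfolding bounded_at_Some by blast
    moreover have "generator SA (SA r w) = Some (SA r aw)"
      using generator_orbit[OF SA aw] r by simp
    ultimately show ?thesis by auto
  qed
  then obtain z v q m where zvqm: "\<And>r. r \<in> {0..\<tau>} \<Longrightarrow> generator SC (SA r w) = Some (z r) \<and>
      generator SC (SA r aw) = Some (v r) \<and> generator SA (z r) = Some (q r) \<and>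
      generator SC (z r) = Some (m r) \<and> norm (q r - v r) \<le> c1 \<and> norm (m r) \<le> c3"
    by metis
  interpret commutator_orbit SA SC N "\<lambda>r. SA r w" "\<lambda>r. SA r aw" z v m q \<omega> \<tau> "NU * c1" c3
  proof unfold_locales
    fix r assume r: "r \<in> {0..\<tau>}"
    show "((\<lambda>r. SA r w) has_vector_derivative SA r aw) (at r within {0..\<tau>})"
      using r by (intro orbit_derivative[OF SA aw]) auto
    have "NU * norm (q r - v r) \<le> NU * c1" using zvqm[OF r] NU by simp
    then show "N (q r - v r) \<le> NU * c1" using NU(2) order_trans by blast
  qed (use SA SC N quasi \<omega> zvqm C0_semigroup_orbit_continuous[OF SA] in auto)
  have eq: "z \<tau> = z1" "z s = z1'" using zvqm[of \<tau>] zvqm[of s] z1 s \<tau> by auto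
  have "c1 \<ge> 0" using zvqm[OF s] norm_ge_zero order_trans by blast
  have "small_defect s \<tau>" using s by (intro defect_small) auto
  then have "NL * norm (z1 - SA (\<tau> - s) z1') \<le> NU * c1 * (\<tau> - s) * exp (\<omega> * (\<tau> - s))"
    using NL(2) order_trans unfolding small_defect_def defect_def eq by blast
  also have "\<dots> \<le> NU * c1 * \<tau> * exp (\<omega> * T)"
    using s \<tau> \<omega> NU \<open>c1 \<ge> 0\<close> by (intro mult_mono) (auto intro: mult_mono)
  finally show ?thesis
    using NL by (simp add: Kc_def field_simps)
qed

text \<open>Along \<open>s \<mapsto> SA (\<tau> - s) (SD s w)\<close> the derivative is \<open>SA (\<tau> - s) (C (SD s w))\<close>. Replacing \<open>SD s w\<close> by \<open>SA s w\<close> costs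
\<open>O(\<tau>)\<close> after application of \<open>C\<close>, by \<open>generator_mean_value\<close> and the bound on \<open>C e\<^sup>r\<^sup>A C e\<^sup>s\<^sup>D w\<close>; the commutator estimate then
moves the result to \<open>C (SA \<tau> w)\<close>.\<close>

lemma taylor_AC:
  assumes w: "w \<in> W" and \<tau>: "\<tau> \<in> {0..T}" and z: "generator SC (SA \<tau> w) = Some z"
  shows "norm (SD \<tau> w - SA \<tau> w - \<tau> *\<^sub>R z) \<le> (M * (M * c4) + Kc) * \<tau> * \<tau>"
proof -
  obtain a c where ac: "generator SA w = Some a" "generator SC w = Some c" "generator SD w = Some (a + c)"
    using domain_D[OF w] by metis
  have "\<exists>p q. generator SA (SD r w) = Some p \<and> generator SC (SD r w) = Some q \<and> SD r (a + c) = p + q"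
    if "r \<in> {0..\<tau>}" for r
    using generator_orbit[OF SD ac(3), of r] that unfolding generator_D by auto
  then obtain p q where pq: "\<And>r. r \<in> {0..\<tau>} \<Longrightarrow> generator SA (SD r w) = Some (p r) \<and>
      generator SC (SD r w) = Some (q r) \<and> SD r (a + c) = p r + q r" by metis
  have q_bound: "\<exists>g. generator SC (SA s (q r)) = Some g \<and> norm g \<le> c4" if "r \<in> {0..\<tau>}" "s \<in> {0..T}" for r s
    using CAC[OF w _ that(2), of r] pq[OF that(1)] that \<tau>
    by (auto simp: bounded_at_comp bounded_at_comp_bop bounded_at_Some bop_def)
  show ?thesis
  proof (rule duhamel_estimate[OF SA SD _ ac(3)])
    show "\<tau> \<ge> 0" using \<tau> by simp
    fix s assume s: "s \<in> {0..\<tau>}"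
    show "generator SA (SD s w) = Some (p s)" using pq[OF s] by simp
    have s': "s \<in> {0..T}" "\<tau> - s \<in> {0..T}" using s \<tau> by auto
    obtain z' where z': "generator SC (SA s w) = Some z'"
      using CC[OF w s'(1)] unfolding bounded_at_comp by blast
    have "norm (q s - z') \<le> M * c4 * (s - 0)"
    proof (rule generator_mean_value[OF SC M(2) T, where f="\<lambda>r. SA (s - r) (SD r w)" and f'="\<lambda>r. SA (s - r) (q r)"])
      show "0 \<le> s" using s by simp
      fix r assume r: "r \<in> {0..s}"
      then have r': "r \<in> {0..\<tau>}" using s by auto
      have "((\<lambda>r. SD r w) has_vector_derivative SD r (a + c)) (at r within {0..s})"
        using r by (intro orbit_derivative[OF SD ac(3)]) auto
      from duhamel_derivative[OF SA this conjunct1[OF pq[OF r']]]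
      show "((\<lambda>r. SA (s - r) (SD r w)) has_vector_derivative SA (s - r) (q r)) (at r within {0..s})"
        using pq[OF r'] r by simp
      show "\<exists>g. generator SC (SA (s - r) (q r)) = Some g \<and> norm g \<le> c4"
        using q_bound[OF r'] r s' by auto
    qed (use pq[OF s] z' in \<open>simp_all add: C0_semigroup_0[OF SA] C0_semigroup_0[OF SD]\<close>)
    then have "norm (q s - z') \<le> M * c4 * s" by simp
    also have "\<dots> \<le> M * c4 * \<tau>"
    proof (intro mult_left_mono mult_nonneg_nonneg M_nonneg)
      show "0 \<le> c4" using q_bound[OF s s'(1)] norm_ge_zero order_trans by blast
    qed (use s in auto)
    finally have "norm (SA (\<tau> - s) (q s - z')) \<le> M * (M * c4 * \<tau>)"
      using M_nonneg by (intro order_trans[OF M_apply(1)[OF s'(2)]] mult_left_mono)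
    moreover have "norm (z - SA (\<tau> - s) z') \<le> Kc * \<tau>"
      by (rule commutator_estimate[OF w \<tau> s z z'])
    moreover have "SA (\<tau> - s) (SD s (a + c) - p s) - z = SA (\<tau> - s) (q s - z') - (z - SA (\<tau> - s) z')"
      using pq[OF s] by (simp add: blinfun.diff_right)
    ultimately show "norm (SA (\<tau> - s) (SD s (a + c) - p s) - z) \<le> (M * (M * c4) + Kc) * \<tau>"
      using norm_triangle_ineq4[of "SA (\<tau> - s) (q s - z')" "z - SA (\<tau> - s) z'"]
      by (simp add: algebra_simps)
  qed
qed

lemma taylor_C:
  assumes w: "w \<in> W" and \<tau>: "\<tau> \<in> {0..T}" and z: "generator SC (SA \<tau> w) = Some z"
  shows "norm (SC \<tau> (SA \<tau> w) - SA \<tau> w - \<tau> *\<^sub>R z) \<le> M * c3 * \<tau> * \<tau>"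
proof (rule orbit_taylor_1[OF SC z])
  show "\<tau> \<ge> 0" using \<tau> by simp
  fix s assume s: "s \<in> {0..\<tau>}"
  obtain m where m: "generator SC z = Some m" "norm m \<le> c3"
    using CC[OF w \<tau>, unfolded bounded_at_comp] z unfolding bounded_at_Some by auto
  have "norm (SC s z - z) \<le> M * norm m * s"
    using s \<tau> by (intro orbit_lipschitz[OF SC m(1)] M) auto
  also have "\<dots> \<le> M * c3 * \<tau>"
    using s m(2) M_nonneg order_trans[OF norm_ge_zero m(2)] by (intro mult_mono mult_nonneg_nonneg) auto
  finally show "norm (SC s z - z) \<le> M * c3 * \<tau>" .
qed

text \<open>Both operators act on \<open>B w\<close>, whose orbit under \<open>SA\<close> stays where \<open>C\<close> is bounded by \<open>c2\<close>; an agreement to order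
zero is all that is needed, since this term carries a factor \<open>\<tau>\<close>.\<close>

lemma split_B:
  assumes w: "w \<in> W" and \<tau>: "\<tau> \<in> {0..T}"
  shows "norm (SC \<tau> (SA \<tau> (B w)) - SD \<tau> (B w)) \<le> 2 * (M * c2) * \<tau>"
proof -
  have "\<exists>g. generator SC (SA s (B w)) = Some g \<and> norm g \<le> c2" if "s \<in> {0..\<tau>}" for s
    using CB[OF w, of s] that \<tau> unfolding bounded_at_Some by auto
  then obtain g where g: "\<And>s. s \<in> {0..\<tau>} \<Longrightarrow> generator SC (SA s (B w)) = Some (g s) \<and> norm (g s) \<le> c2"
    by metis
  have "bounded_at (commutator (generator SD) (bop B)) (SD 0 w) c5" using DB[OF w, of 0] T by simp
  then obtain d where "generator SD (B w) = Some d"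
    by (auto simp: bounded_at_commutator bop_def C0_semigroup_0[OF SD])
  then obtain a where a: "generator SA (B w) = Some a" unfolding generator_D by blast
  have \<tau>0: "\<tau> \<in> {0..\<tau>}" "0 \<le> \<tau>" using \<tau> by auto
  have "norm (SA \<tau> (B w) - SD \<tau> (B w) - \<tau> *\<^sub>R 0) \<le> M * c2 * \<tau>"
  proof (rule duhamel_estimate[OF SD SA \<tau>0(2) a])
    fix s assume s: "s \<in> {0..\<tau>}"
    show "generator SD (SA s (B w)) = Some (SA s a + g s)"
      unfolding generator_D using generator_orbit[OF SA a, of s] g[OF s] s by auto
    have "norm (SD (\<tau> - s) (SA s a - (SA s a + g s))) \<le> M * norm (SA s a - (SA s a + g s))"
      using s \<tau> by (intro M_apply) auto
    also have "\<dots> \<le> M * c2" using g[OF s] M_nonneg by (intro mult_left_mono) auto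
    finally show "norm (SD (\<tau> - s) (SA s a - (SA s a + g s)) - 0) \<le> M * c2" by simp
  qed
  moreover have "norm (SC \<tau> (SA \<tau> (B w)) - SA \<tau> (B w)) \<le> M * norm (g \<tau>) * \<tau>"
    using g[OF \<tau>0(1)] \<tau> by (intro orbit_lipschitz[OF SC] M) auto
  moreover have "M * norm (g \<tau>) * \<tau> \<le> M * c2 * \<tau>"
    using g[OF \<tau>0(1)] M_nonneg \<tau>0 by (intro mult_right_mono mult_left_mono) auto
  ultimately show ?thesis
    using norm_triangle_ineq[of "SC \<tau> (SA \<tau> (B w)) - SA \<tau> (B w)" "SA \<tau> (B w) - SD \<tau> (B w)"] by simp
qed

lemma perturbation_small:
  assumes w: "w \<in> W" and s: "s \<in> {0..T}"
  shows "norm (V s w - SD s w) \<le> M * (norm B * (M * U)) * s"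
proof -
  obtain d where d: "generator SD w = Some d" using domain_D[OF w] by metis
  then have d': "generator V w = Some (d + B w)" unfolding generator_V by blast
  have gen: "generator SD (V r w) = Some (V r (d + B w) - B (V r w))" if "r \<ge> 0" for r
    using generator_orbit[OF V_semigroup d' that] unfolding generator_V by auto
  have "norm (V s w - SD s w - s *\<^sub>R 0) \<le> M * (norm B * (M * U)) * s"
  proof (rule duhamel_estimate[OF SD V_semigroup _ d'])
    fix r assume r: "r \<in> {0..s}"
    then show "generator SD (V r w) = Some (V r (d + B w) - B (V r w))" by (intro gen) auto
    have "norm (B (V r w)) \<le> norm B * (M * U)"
      using r s U[OF w] M_nonneg
      by (intro order_trans[OF norm_blinfun] mult_left_mono order_trans[OF M_apply(5)]) auto
    then have "norm (SD (s - r) (B (V r w))) \<le> M * (norm B * (M * U))"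
      using r s M_nonneg by (intro order_trans[OF M_apply(3)] mult_left_mono) auto
    then show "norm (SD (s - r) (V r (d + B w) - (V r (d + B w) - B (V r w))) - 0) \<le> M * (norm B * (M * U))"
      by simp
  qed (use s in simp)
  then show ?thesis by simp
qed

text \<open>The derivative of \<open>s \<mapsto> SD (\<tau> - s) (B (SD s w))\<close> is minus the image of the commutator of \<open>D\<close> and \<open>B\<close>.\<close>

lemma commute_B:
  assumes w: "w \<in> W" and \<tau>: "\<tau> \<in> {0..T}" and s: "s \<in> {0..\<tau>}"
  shows "norm (SD (\<tau> - s) (B (SD s w)) - SD \<tau> (B w)) \<le> M * c5 * s"
proof -
  obtain d where d: "generator SD w = Some d" using domain_D[OF w] by metis
  have "\<exists>g. generator SD (B (SD r w)) = Some g \<and> norm (g - B (SD r d)) \<le> c5" if r: "r \<in> {0..s}" for r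
    using DB[OF w, of r] generator_orbit[OF SD d, of r] r s \<tau> by (auto simp: bounded_at_commutator bop_def)
  then obtain g where g: "\<And>r. r \<in> {0..s} \<Longrightarrow> generator SD (B (SD r w)) = Some (g r) \<and> norm (g r - B (SD r d)) \<le> c5"
    by metis
  have "norm (SD (\<tau> - s) (B (SD s w)) - SD (\<tau> - 0) (B (SD 0 w)) - (s - 0) *\<^sub>R 0) \<le> M * c5 * (s - 0)"
  proof (rule mean_value_affine[where f'="\<lambda>r. SD (\<tau> - r) (B (SD r d) - g r)"])
    fix r assume r: "r \<in> {0..s}"
    have "((\<lambda>r. SD r w) has_vector_derivative SD r d) (at r within {0..\<tau>})"
      using r by (intro orbit_derivative[OF SD d]) auto
    then have "((\<lambda>r. B (SD r w)) has_vector_derivative B (SD r d)) (at r within {0..\<tau>})"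
      by (rule bounded_linear.has_vector_derivative[OF blinfun.bounded_linear_right])
    from duhamel_derivative[OF SD this conjunct1[OF g[OF r]]]
    have "((\<lambda>r. SD (\<tau> - r) (B (SD r w))) has_vector_derivative SD (\<tau> - r) (B (SD r d) - g r)) (at r within {0..\<tau>})"
      using r s by auto
    then show "((\<lambda>r. SD (\<tau> - r) (B (SD r w))) has_vector_derivative SD (\<tau> - r) (B (SD r d) - g r)) (at r within {0..s})"
      using s by (elim has_vector_derivative_within_subset) auto
    have "norm (B (SD r d) - g r) \<le> c5" using g[OF r] by (simp add: norm_minus_commute)
    then show "norm (SD (\<tau> - r) (B (SD r d) - g r) - 0) \<le> M * c5"
      using r s \<tau> M_nonneg by (simp, intro order_trans[OF M_apply(3)] mult_left_mono) auto
  qed (use s in simp)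
  then show ?thesis by (simp add: C0_semigroup_0[OF SD])
qed

text \<open>The derivative of \<open>s \<mapsto> SD (\<tau> - s) (V s w)\<close> is \<open>SD (\<tau> - s) (B (V s w))\<close>. It is moved within \<open>O(\<tau>)\<close> to \<open>SD (\<tau> - s) (B (SD s w))\<close>
by \<open>perturbation_small\<close>, to \<open>SD \<tau> (B w)\<close> by \<open>commute_B\<close>, and to the split form by \<open>split_B\<close>.\<close>

lemma taylor_B:
  assumes w: "w \<in> W" and \<tau>: "\<tau> \<in> {0..T}"
  shows "norm (V \<tau> w - SD \<tau> w - \<tau> *\<^sub>R SC \<tau> (SA \<tau> (B w))) \<le>
    (M * (norm B * (M * (norm B * (M * U)))) + M * c5 + 2 * (M * c2)) * \<tau> * \<tau>"
proof -
  obtain d where d: "generator SD w = Some d" using domain_D[OF w] by metis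
  then have d': "generator V w = Some (d + B w)" unfolding generator_V by blast
  have gen: "generator SD (V r w) = Some (V r (d + B w) - B (V r w))" if "r \<ge> 0" for r
    using generator_orbit[OF V_semigroup d' that] unfolding generator_V by auto
  have "U \<ge> 0" using U[OF w] norm_ge_zero order_trans by blast
  have "c5 \<ge> 0" using DB[OF w \<tau>] norm_ge_zero order_trans unfolding bounded_at_def by blast
  show ?thesis
  proof (rule duhamel_estimate[OF SD V_semigroup _ d'])
    fix s assume s: "s \<in> {0..\<tau>}"
    then show "generator SD (V s w) = Some (V s (d + B w) - B (V s w))" by (intro gen) auto
    have s': "s \<in> {0..T}" "\<tau> - s \<in> {0..T}" using s \<tau> by auto
    have "norm (V s w - SD s w) \<le> M * (norm B * (M * U)) * \<tau>"
      using s M_nonneg \<open>U \<ge> 0\<close> by (intro order_trans[OF perturbation_small[OF w s'(1)]] mult_left_mono) auto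
    then have "norm (SD (\<tau> - s) (B (V s w - SD s w))) \<le> M * (norm B * (M * (norm B * (M * U)) * \<tau>))"
      using M_nonneg by (intro order_trans[OF M_apply(3)[OF s'(2)]] mult_left_mono order_trans[OF norm_blinfun]) auto
    moreover have "norm (SD (\<tau> - s) (B (SD s w)) - SD \<tau> (B w)) \<le> M * c5 * \<tau>"
      using s M_nonneg \<open>c5 \<ge> 0\<close> by (intro order_trans[OF commute_B[OF w \<tau> s]] mult_left_mono) auto
    moreover note split_B[OF w \<tau>]
    moreover have "SD (\<tau> - s) (V s (d + B w) - (V s (d + B w) - B (V s w))) - SC \<tau> (SA \<tau> (B w)) =
      SD (\<tau> - s) (B (V s w - SD s w)) + (SD (\<tau> - s) (B (SD s w)) - SD \<tau> (B w)) - (SC \<tau> (SA \<tau> (B w)) - SD \<tau> (B w))"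
      by (simp add: blinfun.diff_right)
    ultimately show "norm (SD (\<tau> - s) (V s (d + B w) - (V s (d + B w) - B (V s w))) - SC \<tau> (SA \<tau> (B w))) \<le>
      (M * (norm B * (M * (norm B * (M * U)))) + M * c5 + 2 * (M * c2)) * \<tau>"
      using norm_triangle_ineq4[of "SD (\<tau> - s) (B (V s w - SD s w)) + (SD (\<tau> - s) (B (SD s w)) - SD \<tau> (B w))"
          "SC \<tau> (SA \<tau> (B w)) - SD \<tau> (B w)"]
        norm_triangle_ineq[of "SD (\<tau> - s) (B (V s w - SD s w))" "SD (\<tau> - s) (B (SD s w)) - SD \<tau> (B w)"]
      by (simp add: algebra_simps)
  qed (use \<tau> in simp)
qed

lemma taylor_exp_B:
  assumes w: "w \<in> W" and \<tau>: "\<tau> \<in> {0..T}"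
  shows "norm (SB \<tau> w - w - \<tau> *\<^sub>R B w) \<le> M * (norm B * (norm B * U)) * \<tau> * \<tau>"
proof (rule orbit_taylor_1[OF SB])
  show "generator SB w = Some (B w)" by (simp add: genB bop_def)
  show "\<tau> \<ge> 0" using \<tau> by simp
  fix s assume s: "s \<in> {0..\<tau>}"
  have "norm (B (B w)) \<le> norm B * (norm B * U)"
    using U[OF w] by (intro order_trans[OF norm_blinfun] mult_left_mono) auto
  moreover have "norm (SB s (B w) - B w) \<le> M * norm (B (B w)) * s"
    using s \<tau> by (intro orbit_lipschitz[OF SB] M) (auto simp: genB bop_def)
  ultimately show "norm (SB s (B w) - B w) \<le> M * (norm B * (norm B * U)) * \<tau>"
    using s M_nonneg norm_ge_zero order_trans[OF norm_ge_zero U[OF w]]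
    by (elim order_trans) (intro mult_mono, auto)
qed

theorem local_error:
  "\<exists>K\<ge>0. \<forall>w\<in>W. \<forall>\<tau>\<in>{0..T}. norm (SC \<tau> (SA \<tau> (SB \<tau> w)) - V \<tau> w) \<le> K * \<tau> * \<tau>"
proof -
  define K where "K = M * (M * (M * (norm B * (norm B * U)))) + M * c3 + (M * (M * c4) + Kc) +
    (M * (norm B * (M * (norm B * (M * U)))) + M * c5 + 2 * (M * c2))"
  have "norm (SC \<tau> (SA \<tau> (SB \<tau> w)) - V \<tau> w) \<le> K * \<tau> * \<tau>" if w: "w \<in> W" and \<tau>: "\<tau> \<in> {0..T}" for w \<tau>
  proof -
    obtain z where z: "generator SC (SA \<tau> w) = Some z"
      using CC[OF w \<tau>] unfolding bounded_at_comp by blast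
    \<comment> \<open>The remainders of the four expansions; the terms \<open>SA \<tau> w + \<tau> z\<close> of \<open>e2\<close> and \<open>e3\<close> cancel, and so do
      the terms \<open>\<tau> SC \<tau> (SA \<tau> (B w))\<close> of \<open>e1\<close> and \<open>e4\<close>.\<close>
    define e1 where "e1 = SC \<tau> (SA \<tau> (SB \<tau> w - w - \<tau> *\<^sub>R B w))"
    define e2 where "e2 = SC \<tau> (SA \<tau> w) - SA \<tau> w - \<tau> *\<^sub>R z"
    define e3 where "e3 = SD \<tau> w - SA \<tau> w - \<tau> *\<^sub>R z"
    define e4 where "e4 = V \<tau> w - SD \<tau> w - \<tau> *\<^sub>R SC \<tau> (SA \<tau> (B w))"
    have eq: "SC \<tau> (SA \<tau> (SB \<tau> w)) - V \<tau> w = e1 + e2 - e3 - e4"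
      by (simp add: e1_def e2_def e3_def e4_def blinfun.diff_right blinfun.scaleR_right)
    have "norm (e1 + e2 - e3 - e4) \<le> norm e1 + norm e2 + norm e3 + norm e4"
      using norm_triangle_ineq4[of "e1 + e2 - e3" e4] norm_triangle_ineq4[of "e1 + e2" e3] norm_triangle_ineq[of e1 e2]
      by linarith
    moreover have "norm e1 \<le> M * (M * (M * (norm B * (norm B * U)) * \<tau> * \<tau>))"
      unfolding e1_def using taylor_exp_B[OF w \<tau>] M_nonneg
      by (intro order_trans[OF M_apply(2)[OF \<tau>]] mult_left_mono order_trans[OF M_apply(1)[OF \<tau>]])
    moreover have "norm e2 \<le> M * c3 * \<tau> * \<tau>" unfolding e2_def by (rule taylor_C[OF w \<tau> z])
    moreover have "norm e3 \<le> (M * (M * c4) + Kc) * \<tau> * \<tau>" unfolding e3_def by (rule taylor_AC[OF w \<tau> z])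
    moreover have "norm e4 \<le> (M * (norm B * (M * (norm B * (M * U)))) + M * c5 + 2 * (M * c2)) * \<tau> * \<tau>"
      unfolding e4_def by (rule taylor_B[OF w \<tau>])
    ultimately have "norm (e1 + e2 - e3 - e4) \<le> M * (M * (M * (norm B * (norm B * U)) * \<tau> * \<tau>)) + M * c3 * \<tau> * \<tau> +
        (M * (M * c4) + Kc) * \<tau> * \<tau> + (M * (norm B * (M * (norm B * (M * U)))) + M * c5 + 2 * (M * c2)) * \<tau> * \<tau>"
      by linarith
    also have "\<dots> = K * \<tau> * \<tau>" by (simp add: K_def algebra_simps)
    finally show ?thesis unfolding eq .
  qed
  then have "norm (SC \<tau> (SA \<tau> (SB \<tau> w)) - V \<tau> w) \<le> \<bar>K\<bar> * \<tau> * \<tau>" if "w \<in> W" "\<tau> \<in> {0..T}" for w \<tau>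
    using that by (intro order_trans[OF _ mult_right_mono[OF mult_right_mono[OF abs_ge_self]]]) auto
  then show ?thesis by (intro exI[of _ "\<bar>K\<bar>"]) auto
qed

end

section \<open>Stability and convergence\<close>

text \<open>Equivalence of the norms makes the quotients bounded above, so that the supremum defining the
induced norm is a genuine one.\<close>

lemma induced_norm_bound:
  assumes N: "equivalent_norm N"
  shows "N (blinfun_apply E x) \<le> induced_norm N E * N x"
proof (cases "x = 0")
  case True
  then show ?thesis using equivalent_norm_eq_0[OF N, of 0] by simp
next
  case False
  obtain NL NU where NL: "NL > 0" "\<And>x. NL * norm x \<le> N x" and NU: "NU > 0" "\<And>x. N x \<le> NU * norm x"
    using equivalent_norm_bounds[OF N] by metis
  have pos: "N x > 0" if "x \<noteq> 0" for x
    using equivalent_norm_nonneg[OF N, of x] equivalent_norm_eq_0[OF N, of x] that by linarith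
  have "N (E x) / N x \<le> NU * norm E / NL" for x
  proof (cases "x = 0")
    case True
    then show ?thesis using NL NU equivalent_norm_eq_0[OF N, of 0] by simp
  next
    case False
    have "N (E x) \<le> NU * (norm E * norm x)"
      using NU by (intro order_trans[OF NU(2)] mult_left_mono norm_blinfun) auto
    also have "\<dots> \<le> NU * (norm E * (N x / NL))"
      using NU NL by (intro mult_left_mono) (auto simp: field_simps)
    finally show ?thesis using pos[OF False] NL by (simp add: field_simps)
  qed
  then have "bdd_above (range (\<lambda>x. N (E x) / N x))" by (intro bdd_aboveI[of _ "NU * norm E / NL"]) auto
  then have "N (E x) / N x \<le> induced_norm N E"
    unfolding induced_norm_def by (intro cSUP_upper) auto
  then show ?thesis using pos[OF False] by (simp add: field_simps)
qed

lemma quasi_contraction_of_induced_norm: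
  assumes N: "equivalent_norm N" and "induced_norm N E \<le> exp (t * \<omega>)" and "t \<ge> 0" and "\<omega> \<le> \<omega>'"
  shows "N (blinfun_apply E x) \<le> exp (\<omega>' * t) * N x"
proof -
  have "exp (t * \<omega>) \<le> exp (\<omega>' * t)"
    using assms(3,4) by (simp add: mult.commute mult_right_mono)
  then have "induced_norm N E * N x \<le> exp (\<omega>' * t) * N x"
    using order_trans[OF assms(2)] equivalent_norm_nonneg[OF N, of x] by (intro mult_right_mono)
  then show ?thesis using induced_norm_bound[OF N, of E x] by linarith
qed

text \<open>From \<open>S t x = x + O(t)\<close> follows \<open>N (S t x) \<le> (1 + \<beta> t) N x\<close>; the constant in front of \<open>N x\<close> tends to \<open>1\<close> for small \<open>t\<close>, as
it must if \<open>n\<close> steps are to be stable.\<close>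

lemma bounded_generator_stable:
  fixes S :: "real \<Rightarrow> 'a::banach \<Rightarrow>\<^sub>L 'a"
  assumes S: "C0_semigroup S" and gen: "generator S = bop B" and N: "equivalent_norm N"
  shows "\<exists>\<beta>\<ge>0. \<forall>t\<in>{0..T}. \<forall>x. N (S t x) \<le> exp (\<beta> * t) * N x"
proof -
  obtain NL NU where NL: "NL > 0" "\<And>x. NL * norm x \<le> N x" and NU: "NU > 0" "\<And>x. N x \<le> NU * norm x"
    using equivalent_norm_bounds[OF N] by metis
  obtain M where M: "M > 0" "\<forall>t\<in>{0..T}. norm (S t) \<le> M"
    using C0_semigroup_locally_bounded[OF S] by blast
  define \<beta> where "\<beta> = NU * (M * (norm B / NL))"
  have "N (S t x) \<le> exp (\<beta> * t) * N x" if t: "t \<in> {0..T}" for t x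
  proof -
    have "norm x \<le> N x / NL" using NL by (simp add: field_simps)
    then have Bx: "norm (B x) \<le> norm B * (N x / NL)"
      by (intro order_trans[OF norm_blinfun] mult_left_mono) auto
    have "norm (S t x - x) \<le> M * norm (B x) * t"
      using M t by (intro orbit_lipschitz[OF S]) (auto simp: gen bop_def)
    also have "\<dots> \<le> M * (norm B * (N x / NL)) * t"
      using M t Bx by (intro mult_right_mono mult_left_mono) auto
    finally have "N (S t x - x) \<le> NU * (M * (norm B * (N x / NL)) * t)"
      using NU by (intro order_trans[OF NU(2)] mult_left_mono) auto
    also have "\<dots> = \<beta> * t * N x" by (simp add: \<beta>_def)
    finally have "N (S t x) \<le> (1 + \<beta> * t) * N x"
      using equivalent_norm_add[OF N, of "S t x - x" x] by (simp add: algebra_simps)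
    also have "\<dots> \<le> exp (\<beta> * t) * N x"
      using exp_ge_add_one_self[of "\<beta> * t"] equivalent_norm_nonneg[OF N] by (intro mult_right_mono) auto
    finally show ?thesis .
  qed
  moreover have "\<beta> \<ge> 0" using NU NL M by (simp add: \<beta>_def)
  ultimately show ?thesis by blast
qed

lemma error_recursion:
  fixes e :: "nat \<Rightarrow> real"
  assumes "e 0 = 0" and L: "L \<ge> 1" and K: "K \<ge> 0"
    and step: "\<And>k. k < n \<Longrightarrow> e (Suc k) \<le> L * e k + K"
  shows "e n \<le> real n * K * L ^ n"
  using step
proof (induction n)
  case (Suc n)
  have "e (Suc n) \<le> L * e n + K" using Suc.prems by simp
  also have "\<dots> \<le> L * (real n * K * L ^ n) + K * L ^ Suc n"
    using Suc L K one_le_power[OF L, of "Suc n"] mult_left_mono[of 1 "L ^ Suc n" K]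
    by (intro add_mono mult_left_mono) auto
  also have "\<dots> = real (Suc n) * K * L ^ Suc n" by (simp add: algebra_simps)
  finally show ?case .
qed (use assms in simp)

theorem theorem3:
  fixes A C :: "'a::banach \<rightharpoonup> 'a" and B :: "'a \<Rightarrow>\<^sub>L 'a"
    and T c1 c2 c3 c4 c5 \<omega>A \<omega>C :: real
    and u0 :: 'a and u :: "real \<Rightarrow> 'a" and N :: "'a \<Rightarrow> real"
  assumes "T > 0"
    and "generates_semigroup A" and "generates_semigroup C" and "generates_semigroup (A +\<^sub>m C)"
    and "\<And>t. t \<in> {0..T} \<Longrightarrow> u t = exp_op (A +\<^sub>m bop B +\<^sub>m C) t u0"
    and "\<And>t s. t \<in> {0..T} \<Longrightarrow> s \<in> {0..T} \<Longrightarrow>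
      bounded_at (commutator A C \<circ>\<^sub>m bop (exp_op A s)) (u t) c1"
    and "\<And>t s. t \<in> {0..T} \<Longrightarrow> s \<in> {0..T} \<Longrightarrow>
      bounded_at (C \<circ>\<^sub>m bop (exp_op A s) \<circ>\<^sub>m bop B) (u t) c2"
    and "\<And>t s. t \<in> {0..T} \<Longrightarrow> s \<in> {0..T} \<Longrightarrow>
      bounded_at (C \<circ>\<^sub>m C \<circ>\<^sub>m bop (exp_op A s)) (u t) c3"
    and "\<And>t s \<sigma>. t \<in> {0..T} \<Longrightarrow> s \<in> {0..T} \<Longrightarrow> \<sigma> \<in> {0..T} \<Longrightarrow>
      bounded_at (C \<circ>\<^sub>m bop (exp_op A \<sigma>) \<circ>\<^sub>m C \<circ>\<^sub>m bop (exp_op (A +\<^sub>m C) s)) (u t) c4"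
    and "\<And>t s. t \<in> {0..T} \<Longrightarrow> s \<in> {0..T} \<Longrightarrow>
      bounded_at (commutator (A +\<^sub>m C) (bop B) \<circ>\<^sub>m bop (exp_op (A +\<^sub>m C) s)) (u t) c5"
    and "equivalent_norm N"
    and "\<And>t. t \<ge> 0 \<Longrightarrow> induced_norm N (exp_op A t) \<le> exp (t * \<omega>A)"
    and "\<And>t. t \<ge> 0 \<Longrightarrow> induced_norm N (exp_op C t) \<le> exp (t * \<omega>C)"
  shows "\<exists>K. \<forall>n \<tau>. \<tau> > 0 \<and> 0 \<le> real n * \<tau> \<and> real n * \<tau> \<le> T \<longrightarrow>
    norm (lie_splitting A B C \<tau> u0 n - u (real n * \<tau>)) \<le> K * \<tau>"
proof -
  note T = assms(1) and N = assms(11)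
  obtain SA where SA: "C0_semigroup SA" "generator SA = A" using assms(2) unfolding generates_semigroup_def by blast
  obtain SC where SC: "C0_semigroup SC" "generator SC = C" using assms(3) unfolding generates_semigroup_def by blast
  obtain SD where SD: "C0_semigroup SD" "generator SD = A +\<^sub>m C" using assms(4) unfolding generates_semigroup_def by blast
  obtain SB where SB: "C0_semigroup SB" "generator SB = bop B" using bounded_operator_generates by blast
  define V where "V = perturbed_semigroup SD B"
  have V: "C0_semigroup V" unfolding V_def by (rule perturbed_semigroup_C0[OF SD(1)])
  have genV: "generator V = A +\<^sub>m bop B +\<^sub>m C"
    unfolding V_def generator_perturbed_semigroup[OF SD(1)] SD(2) by (rule op_add_right_commute)
  have u: "u t = V t u0" if "t \<in> {0..T}" for t
    using assms(5)[OF that] exp_op_eq[OF V genV, of t] that by simp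
  note exps = exp_op_eq[OF SA] exp_op_eq[OF SC] exp_op_eq[OF SD] exp_op_eq[OF SB]
  have "\<exists>M. \<forall>t\<in>{0..T}. norm (SA t) \<le> M \<and> norm (SC t) \<le> M \<and> norm (SD t) \<le> M \<and> norm (SB t) \<le> M \<and> norm (V t) \<le> M"
  proof -
    obtain a where "\<forall>t\<in>{0..T}. norm (SA t) \<le> a" using C0_semigroup_locally_bounded[OF SA(1)] by blast
    moreover obtain b where "\<forall>t\<in>{0..T}. norm (SC t) \<le> b" using C0_semigroup_locally_bounded[OF SC(1)] by blast
    moreover obtain c where "\<forall>t\<in>{0..T}. norm (SD t) \<le> c" using C0_semigroup_locally_bounded[OF SD(1)] by blast
    moreover obtain d where "\<forall>t\<in>{0..T}. norm (SB t) \<le> d" using C0_semigroup_locally_bounded[OF SB(1)] by blast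
    moreover obtain e where "\<forall>t\<in>{0..T}. norm (V t) \<le> e" using C0_semigroup_locally_bounded[OF V] by blast
    ultimately show ?thesis
      by (intro exI[of _ "max a (max b (max c (max d e)))"]) (auto simp: le_max_iff_disj)
  qed
  then obtain M where M: "\<And>t. t \<in> {0..T} \<Longrightarrow>
      norm (SA t) \<le> M \<and> norm (SC t) \<le> M \<and> norm (SD t) \<le> M \<and> norm (SB t) \<le> M \<and> norm (V t) \<le> M" by blast
  \<comment> \<open>A common nonnegative growth rate, so that the exponentials increase in time.\<close>
  define \<omega> where "\<omega> = max 0 (max \<omega>A \<omega>C)"
  have quasi: "N (SA t x) \<le> exp (\<omega> * t) * N x" "N (SC t x) \<le> exp (\<omega> * t) * N x" if "t \<ge> 0" for t x
    using assms(12)[OF that] assms(13)[OF that] exps that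
    by (auto intro!: quasi_contraction_of_induced_norm[OF N _ that] simp: \<omega>_def)
  obtain NL NU where NL: "NL > 0" "\<And>x. NL * norm x \<le> N x" and NU: "NU > 0" "\<And>x. N x \<le> NU * norm x"
    using equivalent_norm_bounds[OF N] by metis
  interpret bounds: splitting_bounds SA SC SD SB B N "u ` {0..T}" NL NU T M "M * norm u0" \<omega> c1 c2 c3 c4 c5
  proof unfold_locales
    fix w assume "w \<in> u ` {0..T}"
    then obtain t where t: "t \<in> {0..T}" "w = u t" by blast
    show "norm w \<le> M * norm u0"
      using M[OF t(1)] u[OF t(1)] t(2) by (metis mult_right_mono norm_blinfun norm_ge_zero order_trans)
    fix s assume s: "s \<in> {0..T}"
    then have "s \<ge> 0" by simp
    note exp_s = exps(1,3)[OF this]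
    show "bounded_at (commutator (generator SA) (generator SC)) (SA s w) c1"
      using assms(6)[OF t(1) s] by (simp add: bounded_at_comp_bop exp_s SA SC t)
    show "bounded_at (generator SC) (SA s (B w)) c2"
      using assms(7)[OF t(1) s] by (simp add: bounded_at_comp_bop exp_s SC t)
    show "bounded_at (generator SC \<circ>\<^sub>m generator SC) (SA s w) c3"
      using assms(8)[OF t(1) s] by (simp add: bounded_at_comp_bop exp_s SC t)
    show "bounded_at (commutator (generator SD) (bop B)) (SD s w) c5"
      using assms(10)[OF t(1) s] by (simp add: bounded_at_comp_bop exp_s SD t)
    fix r assume r: "r \<in> {0..T}"
    then show "bounded_at (generator SC \<circ>\<^sub>m bop (SA r) \<circ>\<^sub>m generator SC) (SD s w) c4"
      using assms(9)[OF t(1) s r] exps(1)[of r] by (simp add: bounded_at_comp_bop exp_s SC t)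
  qed (use SA SC SD SB N NL NU T M quasi in \<open>auto simp: \<omega>_def V_def\<close>)
  obtain K where K: "K \<ge> 0" "\<And>w \<tau>. w \<in> u ` {0..T} \<Longrightarrow> \<tau> \<in> {0..T} \<Longrightarrow>
      norm (SC \<tau> (SA \<tau> (SB \<tau> w)) - V \<tau> w) \<le> K * \<tau> * \<tau>"
    using bounds.local_error unfolding V_def by blast
  obtain \<beta> where \<beta>: "\<beta> \<ge> 0" "\<And>t x. t \<in> {0..T} \<Longrightarrow> N (SB t x) \<le> exp (\<beta> * t) * N x"
    using bounded_generator_stable[OF SB N] by metis
  define \<Lambda> where "\<Lambda> = \<omega> + \<omega> + \<beta>"
  have "\<Lambda> \<ge> 0" using \<beta> by (simp add: \<Lambda>_def \<omega>_def)
  have stable: "N (SC \<tau> (SA \<tau> (SB \<tau> x))) \<le> exp (\<Lambda> * \<tau>) * N x" if "\<tau> \<in> {0..T}" for \<tau> x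
  proof -
    have "N (SC \<tau> (SA \<tau> (SB \<tau> x))) \<le> exp (\<omega> * \<tau>) * (exp (\<omega> * \<tau>) * (exp (\<beta> * \<tau>) * N x))"
      using that \<beta>(2)[OF that]
      by (intro order_trans[OF quasi(2)] order_trans[OF quasi(1)] mult_left_mono) auto
    also have "\<dots> = exp (\<Lambda> * \<tau>) * N x"
      by (simp add: \<Lambda>_def exp_add[symmetric] distrib_right add.assoc flip: mult.assoc)
    finally show ?thesis .
  qed
  have "norm (lie_splitting A B C \<tau> u0 n - u (real n * \<tau>)) \<le> T * (NU * K) * exp (\<Lambda> * T) / NL * \<tau>"
    if \<tau>: "\<tau> > 0" "real n * \<tau> \<le> T" for n \<tau>
  proof -
    define e where "e k = N (lie_splitting A B C \<tau> u0 k - u (real k * \<tau>))" for k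
    have "e n \<le> real n * (NU * (K * \<tau> * \<tau>)) * exp (\<Lambda> * \<tau>) ^ n"
    proof (rule error_recursion)
      show "e 0 = 0"
        using u[of 0] T equivalent_norm_eq_0[OF N, of 0] by (simp add: e_def C0_semigroup_0[OF V])
      show "1 \<le> exp (\<Lambda> * \<tau>)" using \<open>\<Lambda> \<ge> 0\<close> \<tau> by simp
      show "0 \<le> NU * (K * \<tau> * \<tau>)" using NU K \<tau> by simp
      fix k assume "k < n"
      then have "real (Suc k) * \<tau> \<le> real n * \<tau>" using \<tau> by (intro mult_right_mono) auto
      then have k: "real (Suc k) * \<tau> \<le> T" using \<tau> by linarith
      have "0 \<le> real k * \<tau>" using \<tau> by simp
      moreover have "real (Suc k) * \<tau> = real k * \<tau> + \<tau>" by (simp add: distrib_right)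
      ultimately have "real k * \<tau> \<le> T" "\<tau> \<le> T" using k \<tau> by linarith+
      then have mem: "real k * \<tau> \<in> {0..T}" "real (Suc k) * \<tau> \<in> {0..T}" "\<tau> \<in> {0..T}"
        using \<tau> k by (auto simp del: of_nat_Suc)
      define x where "x = lie_splitting A B C \<tau> u0 k"
      define w where "w = u (real k * \<tau>)"
      have next_u: "u (real (Suc k) * \<tau>) = V \<tau> w"
        using u[OF mem(1)] u[OF mem(2)] C0_semigroup_add[OF V, of \<tau> "real k * \<tau>" u0] mem \<tau>
        by (simp add: w_def distrib_right)
      have next_x: "lie_splitting A B C \<tau> u0 (Suc k) = SC \<tau> (SA \<tau> (SB \<tau> x))"
        using exps[of \<tau>] \<tau> by (simp add: x_def)
      have "lie_splitting A B C \<tau> u0 (Suc k) - u (real (Suc k) * \<tau>) =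
        SC \<tau> (SA \<tau> (SB \<tau> (x - w))) + (SC \<tau> (SA \<tau> (SB \<tau> w)) - V \<tau> w)"
        unfolding next_u next_x by (simp add: blinfun.diff_right)
      then have "e (Suc k) \<le> N (SC \<tau> (SA \<tau> (SB \<tau> (x - w)))) + N (SC \<tau> (SA \<tau> (SB \<tau> w)) - V \<tau> w)"
        unfolding e_def using equivalent_norm_add[OF N] by simp
      also have "\<dots> \<le> exp (\<Lambda> * \<tau>) * N (x - w) + NU * (K * \<tau> * \<tau>)"
      proof (rule add_mono[OF stable[OF mem(3)]])
        show "N (SC \<tau> (SA \<tau> (SB \<tau> w)) - V \<tau> w) \<le> NU * (K * \<tau> * \<tau>)"
          using K(2)[of w \<tau>] mem NU
          by (intro order_trans[OF NU(2)] mult_left_mono) (auto simp: w_def)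
      qed
      finally show "e (Suc k) \<le> exp (\<Lambda> * \<tau>) * e k + NU * (K * \<tau> * \<tau>)"
        by (simp add: e_def x_def w_def)
    qed
    also have "\<dots> = (real n * \<tau>) * (NU * K * \<tau>) * exp (\<Lambda> * (real n * \<tau>))"
      by (simp add: exp_of_nat_mult[symmetric] mult_ac)
    also have "\<dots> \<le> T * (NU * K * \<tau>) * exp (\<Lambda> * T)"
      using \<tau> T NU K \<open>\<Lambda> \<ge> 0\<close> by (intro mult_mono) (auto intro: mult_left_mono)
    finally have "NL * norm (lie_splitting A B C \<tau> u0 n - u (real n * \<tau>)) \<le> T * (NU * K * \<tau>) * exp (\<Lambda> * T)"
      unfolding e_def using NL(2) order_trans by blast
    then show ?thesis using NL by (simp add: field_simps)
  qed
  then show ?thesis by blast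
qed

end
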